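(* Let $\beta>0$ and let $\mathcal T$ be an infinite, locally finite rooted tree. The ``true'' self-avoiding walk $\mathbf X$ on $\mathcal T$ with parameter $\beta$ is almost surely recurrent if $\mathrm{br}_r(\mathcal T)<1/2$, and almost surely transient if $\mathrm{br}_r(\mathcal T)>1/2$.
   Context: Let $\mathcal T=(V,E)$ be an infinite, locally finite tree with root $\rho$. ``True'' self-avoiding walk (TSAW): fix $\beta>0$ and set $w(n)=e^{-\beta n}$ for $n\in\mathbb Z_+=\{0,1,2,\dots\}$. The TSAW $\mathbf X=(X_n)_{n\ge 0}$ is the nearest-neighbour random process on $V$ with $X_0=\rho$ and, writing $\mathcal F_n=\sigma(X_0,\dots,X_n)$ and $\mathsf L_n(x,y)=\sum_{k=0}^{n-1}\mathbf 1_{\{\{X_k,X_{k+1}\}=\{x,y\}\}}$ for the number of traversals (in either direction) of the edge $\{x,y\}$ up to time $n$, on the event $\{X_n=x\}$, $$\mathbb P(X_{n+1}=y\mid\mathcal F_n)=\mathbf 1_{\{y\sim x\}}\frac{w(\mathsf L_n(x,y))}{\sum_{z\sim x}w(\mathsf L_n(x,z))}.$$ The process is recurrent if every vertex of $\mathcal T$ is visited infinitely often, and transient if every vertex of $\mathcal T$ is visited only finitely often. Branching-ruin number: for an edge $e=\{v^{-1},v\}$, where $v^{-1}$ is the parent of $v$, let $|e|=|v|$ be the graph distance from $v$ to $\rho$. A cutset is a minimal set $\pi$ of edges separating the root from infinity, i.e. for every infinite self-avoiding path $(v_i)_{i\ge0}$ with $v_0=\rho$ there is a unique $i$ with $\{v_i,v_{i+1}\}\in\pi$.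 Let $\Pi$ be the set of all cutsets. Then $$\mathrm{br}_r(\mathcal T)=\sup\Big\{\gamma>0:\ \inf_{\pi\in\Pi}\sum_{e\in\pi}|e|^{-\gamma}>0\Big\},$$ with the convention $\sup\emptyset=0$. *)

theory Defs
  imports "HOL-Probability.Probability"
begin

section \<open>Rooted trees\<close>

text \<open>
  A graph is a vertex set \<open>V\<close> with a set \<open>E\<close> of two-element subsets of \<open>V\<close>.
\<close>

definition is_walk :: "'a set \<Rightarrow> 'a set set \<Rightarrow> 'a list \<Rightarrow> bool" where
  "is_walk V E p \<longleftrightarrow> p \<noteq> [] \<and> set p \<subseteq> V \<and> successively (\<lambda>x y. {x, y} \<in> E) p"

definition is_cycle :: "'a set \<Rightarrow> 'a set set \<Rightarrow> 'a list \<Rightarrow> bool" where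
  "is_cycle V E p \<longleftrightarrow>
     is_walk V E p \<and> distinct p \<and> 3 \<le> length p \<and> {last p, hd p} \<in> E"

locale rooted_tree =
  fixes V :: "'a set" and E :: "'a set set" and \<rho> :: 'a
  assumes root_in_V: "\<rho> \<in> V"
    and edgeD: "e \<in> E \<Longrightarrow> \<exists>u v. u \<in> V \<and> v \<in> V \<and> u \<noteq> v \<and> e = {u, v}"
    and connected: "u \<in> V \<Longrightarrow> v \<in> V \<Longrightarrow> \<exists>p. is_walk V E p \<and> hd p = u \<and> last p = v"
    and no_cycle: "\<not> is_cycle V E p"

definition neighbours :: "'a set set \<Rightarrow> 'a \<Rightarrow> 'a set" where
  "neighbours E x = {y. {x, y} \<in> E}"

definition locally_finite :: "'a set \<Rightarrow> 'a set set \<Rightarrow> bool" where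
  "locally_finite V E \<longleftrightarrow> (\<forall>x\<in>V. finite (neighbours E x))"

definition graph_dist :: "'a set \<Rightarrow> 'a set set \<Rightarrow> 'a \<Rightarrow> 'a \<Rightarrow> nat" where
  "graph_dist V E u v =
     (LEAST n. \<exists>p. is_walk V E p \<and> hd p = u \<and> last p = v \<and> length p = Suc n)"

text \<open>
  The endpoints of an edge of a tree are a parent and its child; the child is the one
  further from the root, so the maximum below is the distance of the child.
\<close>

definition edge_height :: "'a set \<Rightarrow> 'a set set \<Rightarrow> 'a \<Rightarrow> 'a set \<Rightarrow> nat" where
  "edge_height V E \<rho> e = Max (graph_dist V E \<rho> ` e)"

section \<open>Cutsets and the branching-ruin number\<close>

definition is_ray :: "'a set set \<Rightarrow> 'a \<Rightarrow> (nat \<Rightarrow> 'a) \<Rightarrow> bool" where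
  "is_ray E \<rho> v \<longleftrightarrow> v 0 = \<rho> \<and> inj v \<and> (\<forall>i. {v i, v (Suc i)} \<in> E)"

definition separates_root :: "'a set set \<Rightarrow> 'a \<Rightarrow> 'a set set \<Rightarrow> bool" where
  "separates_root E \<rho> \<pi> \<longleftrightarrow>
     \<pi> \<subseteq> E \<and> (\<forall>v. is_ray E \<rho> v \<longrightarrow> (\<exists>i. {v i, v (Suc i)} \<in> \<pi>))"

text \<open>
  A cutset is a minimal separating set of edges. In a tree, every ray from the root
  crosses it exactly once (\<open>cutset_unique_crossing\<close> below).
\<close>

definition cutsets :: "'a set set \<Rightarrow> 'a \<Rightarrow> 'a set set set" where
  "cutsets E \<rho> =
     {\<pi>. separates_root E \<rho> \<pi> \<and> (\<forall>\<pi>'. \<pi>' \<subset> \<pi> \<longrightarrow> \<not> separates_root E \<rho> \<pi>')}"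

text \<open>
  The supremum is taken in \<^typ>\<open>ennreal\<close>: it may be infinite, and the supremum of the
  empty set is 0 there. Likewise the sum over a cutset is an unconditional sum of
  extended nonnegative reals, which always exists.
\<close>

definition branching_ruin :: "'a set \<Rightarrow> 'a set set \<Rightarrow> 'a \<Rightarrow> ennreal" where
  "branching_ruin V E \<rho> =
     Sup {ennreal \<gamma> | \<gamma> :: real. \<gamma> > 0 \<and>
       (INF \<pi>\<in>cutsets E \<rho>.
          \<Sum>\<^sub>\<infinity>e\<in>\<pi>. ennreal (real (edge_height V E \<rho> e) powr (- \<gamma>))) > 0}"

section \<open>The ``true'' self-avoiding walk\<close>

text \<open>The sigma-algebra generated by \<open>X 0, \<dots>, X n\<close>, where \<open>V\<close> carries all its subsets.\<close>

definition generated_upto ::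
  "'w measure \<Rightarrow> 'a set \<Rightarrow> (nat \<Rightarrow> 'w \<Rightarrow> 'a) \<Rightarrow> nat \<Rightarrow> 'w measure" where
  "generated_upto M V X n = sigma (space M) {X k -` A \<inter> space M | k A. k \<le> n \<and> A \<subseteq> V}"

definition edge_count :: "(nat \<Rightarrow> 'w \<Rightarrow> 'a) \<Rightarrow> nat \<Rightarrow> 'a \<Rightarrow> 'a \<Rightarrow> 'w \<Rightarrow> nat" where
  "edge_count X n x y \<omega> = (\<Sum>k<n. of_bool ({X k \<omega>, X (Suc k) \<omega>} = {x, y}))"

definition tsaw_weight :: "real \<Rightarrow> nat \<Rightarrow> real" where
  "tsaw_weight \<beta> n = exp (- \<beta> * real n)"

text \<open>
  The conditional probability of an event given a sub-sigma-algebra is the library's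
  conditional expectation of its indicator, determined up to null sets.
\<close>

locale tsaw = prob_space M + rooted_tree V E \<rho>
  for M :: "'w measure" and V :: "'a set" and E :: "'a set set" and \<rho> :: 'a +
  fixes \<beta> :: real and X :: "nat \<Rightarrow> 'w \<Rightarrow> 'a"
  assumes measurable_X: "\<And>n. X n \<in> measurable M (count_space V)"
    and start: "AE \<omega> in M. X 0 \<omega> = \<rho>"
    and transition: "\<And>n x y. x \<in> V \<Longrightarrow> y \<in> V \<Longrightarrow>
      AE \<omega> in M. X n \<omega> = x \<longrightarrow>
        real_cond_exp M (generated_upto M V X n)
          (indicator {\<omega> \<in> space M. X (Suc n) \<omega> = y}) \<omega> =
        indicator (neighbours E x) y * tsaw_weight \<beta> (edge_count X n x y \<omega>) /
          (\<Sum>z\<in>neighbours E x. tsaw_weight \<beta> (edge_count X n x z \<omega>))"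

definition as_recurrent :: "'w measure \<Rightarrow> 'a set \<Rightarrow> (nat \<Rightarrow> 'w \<Rightarrow> 'a) \<Rightarrow> bool" where
  "as_recurrent M V X \<longleftrightarrow> (AE \<omega> in M. \<forall>v\<in>V. infinite {n. X n \<omega> = v})"

definition as_transient :: "'w measure \<Rightarrow> 'a set \<Rightarrow> (nat \<Rightarrow> 'w \<Rightarrow> 'a) \<Rightarrow> bool" where
  "as_transient M V X \<longleftrightarrow> (AE \<omega> in M. \<forall>v\<in>V. finite {n. X n \<omega> = v})"

section \<open>Consistency facts\<close>

lemma (in tsaw) subalgebra_generated_upto: "subalgebra M (generated_upto M V X n)"
proof -
  have "{X k -` A \<inter> space M | k A. k \<le> n \<and> A \<subseteq> V} \<subseteq> sets M"
    using measurable_X by (auto simp: measurable_def)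
  moreover have "{X k -` A \<inter> space M | k A. k \<le> n \<and> A \<subseteq> V} \<subseteq> Pow (space M)"
    by auto
  ultimately show ?thesis
    unfolding subalgebra_def generated_upto_def
    by (auto simp: space_measure_of_conv sets.sigma_sets_subset sets_measure_of_conv
        dest!: sets.sigma_sets_subset)
qed

context rooted_tree
begin

lemma ray_in_V:
  assumes "is_ray E \<rho> v"
  shows "v i \<in> V"
  using assms edgeD[of "{v i, v (Suc i)}"] unfolding is_ray_def
  by (metis doubleton_eq_iff)

lemma successively_ray_segment:
  assumes "is_ray E \<rho> u"
  shows "successively (\<lambda>x y. {x, y} \<in> E) (map u [a..<b])"
  using assms by (auto simp: is_ray_def successively_map successively_conv_nth)

lemma successively_ray_segment_rev:
  assumes "is_ray E \<rho> u"
  shows "successively (\<lambda>x y. {x, y} \<in> E) (rev (map u [a..<b]))"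
  using successively_ray_segment[OF assms, of a b]
  by (simp only: successively_rev insert_commute)

lemma rays_agree:
  assumes u: "is_ray E \<rho> u" and v: "is_ray E \<rho> v" and meet: "u k = v j"
  shows "k = j \<and> (\<forall>i\<le>k. u i = v i)"
proof -
  have injs: "inj u" "inj v" using u v by (auto simp: is_ray_def)
  have agree: "u i = v i" if "i \<le> min k j" for i
    using that
  proof (induction i)
    case 0
    then show ?case using u v by (simp add: is_ray_def)
  next
    case (Suc m)
    show ?case
    proof (rule ccontr)
      assume ne: "u (Suc m) \<noteq> v (Suc m)"
      have um: "u m = v m" using Suc by simp
      let ?P = "\<lambda>i. Suc m \<le> i \<and> (\<exists>l\<ge>Suc m. u i = v l)"
      have Pk: "?P k" using Suc.prems meet by auto
      define a where "a = (LEAST i. ?P i)"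
      have Pa: "?P a" unfolding a_def by (rule LeastI[of ?P, OF Pk])
      then obtain b where b: "Suc m \<le> b" "u a = v b" by auto
      have a: "Suc m \<le> a" using Pa by simp
      have least: "\<not> ?P i" if "i < a" for i using not_less_Least that unfolding a_def by blast
      define p where "p = map u [m..<a] @ rev (map v [Suc m..<Suc b])"
      have fresh: "u i \<noteq> v l" if "m \<le> i" "i < a" "Suc m \<le> l" for i l
      proof (cases "i = m")
        case True
        then show ?thesis using um injs that by (auto dest: injD)
      next
        case False
        then show ?thesis using least[of i] that by auto
      qed
      have dist: "distinct p"
        unfolding p_def using injs
        by (auto simp: distinct_map inj_on_def inj_def fresh simp del: upt_Suc)
      have lastu: "last (map u [m..<a]) = u (a - 1)" using a by (simp add: last_map)
      have hdv: "hd (rev (map v [Suc m..<Suc b])) = v b" using b by simp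
      have "{u (a - 1), u (Suc (a - 1))} \<in> E" using u by (simp add: is_ray_def)
      then have "{u (a - 1), v b} \<in> E" using a b by simp
      then have succ: "successively (\<lambda>x y. {x, y} \<in> E) p"
        unfolding p_def successively_append_iff
        using successively_ray_segment[OF u] successively_ray_segment_rev[OF v] lastu hdv
        by (simp del: upt_Suc)
      have setp: "set p \<subseteq> V"
        unfolding p_def using ray_in_V[OF u] ray_in_V[OF v] by auto
      have len: "3 \<le> length p"
      proof -
        have "\<not> (a = Suc m \<and> b = Suc m)" using b ne by auto
        then show ?thesis unfolding p_def using a b by auto
      qed
      have hdp: "hd p = u m" unfolding p_def using a by (simp add: hd_append hd_map)
      have lastp: "last p = v (Suc m)"
        unfolding p_def using b by (simp add: last_rev hd_map del: upt_Suc)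
      have "{v (Suc m), u m} \<in> E" using v um by (simp add: is_ray_def insert_commute)
      then have "is_cycle V E p"
        unfolding is_cycle_def is_walk_def using succ setp len hdp lastp dist by auto
      then show False using no_cycle by simp
    qed
  qed
  have "k = j"
  proof (cases "k \<le> j")
    case True
    then show ?thesis using agree[of k] meet injs by (simp add: inj_eq)
  next
    case False
    then show ?thesis using agree[of j] meet injs by (metis injD linear min.absorb2 order_refl)
  qed
  then show ?thesis using agree by auto
qed

lemma cutset_unique_crossing:
  assumes \<pi>: "\<pi> \<in> cutsets E \<rho>" and v: "is_ray E \<rho> v"
  shows "\<exists>!i. {v i, v (Suc i)} \<in> \<pi>"
proof -
  have sep: "separates_root E \<rho> \<pi>"
    and minim: "\<And>\<pi>'. \<pi>' \<subset> \<pi> \<Longrightarrow> \<not> separates_root E \<rho> \<pi>'"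
    using \<pi> by (auto simp: cutsets_def)
  have no_two: False
    if i: "{v i, v (Suc i)} \<in> \<pi>" and j: "{v j, v (Suc j)} \<in> \<pi>" and "i < j" for i j
  proof -
    let ?e = "{v j, v (Suc j)}"
    have "\<not> separates_root E \<rho> (\<pi> - {?e})" by (rule minim) (use j in auto)
    then obtain u where u: "is_ray E \<rho> u" and avoid: "\<And>l. {u l, u (Suc l)} \<notin> \<pi> - {?e}"
      using sep unfolding separates_root_def by blast
    obtain l where "{u l, u (Suc l)} \<in> \<pi>" using sep u unfolding separates_root_def by blast
    then have "{u l, u (Suc l)} = ?e" using avoid by blast
    then consider "u l = v j" | "u l = v (Suc j)" "u (Suc l) = v j"
      by (auto simp: doubleton_eq_iff)
    then show False
    proof cases
      case 1
      have ag: "l = j" "\<And>m. m \<le> l \<Longrightarrow> u m = v m" using rays_agree[OF u v 1] by auto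
      have "{u i, u (Suc i)} = {v i, v (Suc i)}" using ag \<open>i < j\<close> by simp
      then have "{v i, v (Suc i)} = ?e" using avoid[of i] i by auto
      moreover have "inj v" using v by (simp add: is_ray_def)
      ultimately show False using \<open>i < j\<close> by (auto simp: doubleton_eq_iff inj_eq)
    next
      case 2
      then show False using rays_agree[OF u v 2(1)] rays_agree[OF u v 2(2)] by simp
    qed
  qed
  obtain i where "{v i, v (Suc i)} \<in> \<pi>" using sep v unfolding separates_root_def by blast
  then show ?thesis using no_two by (metis linorder_neqE_nat)
qed

end

end

theory Submission
  imports Defs
begin

text \<open>
  Every vertex is given an independent stack of exits. Since a walk on a tree that sits at \<open>x\<close> has
  crossed an edge to a child an even number of times and the edge to the parent an odd number of times, the exits from
  \<open>x\<close> form an urn process of their own, and the walk may be read off the stacks. When every child of the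
  root has been entered and left \<open>k\<close> times, the numbers of entries into the vertices form a tree-indexed
  Markov chain: if \<open>x\<close> was entered \<open>k\<close> times, a given child of \<open>x\<close> was entered
  as often as it occurs in the stack of \<open>x\<close> before the \<open>k\<close>-th occurrence of the parent. The
  law of that number is compared, through a recursion with a maximum principle, with a discrete Gaussian centred at
  \<open>k\<close> of bounded variance; its drift is \<open>O(1/k^2)\<close>. So the chain along a ray behaves like a
  centred random walk killed at \<open>0\<close> and survives \<open>n\<close> steps with probability of order
  \<open>n powr (-1/2)\<close>, up to arbitrarily small powers. If \<open>br_r < 1/2\<close>, a first moment bound
  over a cutset of small weight shows that almost surely the root is left infinitely often. If \<open>br_r >
  1/2\<close>, max-flow min-cut gives a unit flow with values at most \<open>C |e| powr (-\<gamma>)\<close>,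
  \<open>\<gamma> > 1/2\<close>, and the second moment of the flow-weighted number of entries shows that the walk
  survives to every generation with a probability that tends to 1 as \<open>k\<close> grows; hence infinitely many
  returns to the root have probability 0.
\<close>

section \<open>An urn with two relevant colours\<close>

text \<open>The number of draws of a child before the \<open>k\<close>-th draw of the parent has no
  closed law. The discrete Gaussian enters because its consecutive weights
  \<open>exp (- \<beta> * z ^ 2)\<close> are in the ratio of the odds of the two colours at
  difference \<open>z\<close>: its distribution function solves the same recursion exactly, and only
  the boundary values differ. The odds favour steps away from the centre, so the recursion mostly
  reaches the boundary far out, where the mismatch is a Gaussian tail.

  The chain is only nearly a martingale. A concave power, raised by a constant off 0, decreases in
  mean by order \<open>k powr (a - 2)\<close>, which beats a drift of \<open>O(1/k^2)\<close>;
  adding a multiple of it to the identity gives a supermartingale, subtracting it a submartingale.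
  The same decrease, played against the bounded mean as in Nash's inequality, yields the survival
  estimate without analysis of hitting times.

  Siblings share a stack and are dependent. The second moment copes with this because only pairs
  with a common parent are affected, and for these a crude bound by squares suffices.\<close>

locale repulsion =
  fixes \<beta> :: real
  assumes beta_pos: "\<beta> > 0"
begin

definition step_up :: "int \<Rightarrow> real" where
  "step_up z = 1 / (1 + exp (- \<beta> * (2 * real_of_int z + 1)))"

definition step_down :: "int \<Rightarrow> real" where
  "step_down z = 1 - step_up z"

lemma step_up_pos: "step_up z > 0" and step_up_less_1: "step_up z < 1"
  unfolding step_up_def by (auto simp: add_pos_pos)

lemma step_down_pos: "step_down z > 0" and step_down_less_1: "step_down z < 1"
  unfolding step_down_def using step_up_pos[of z] step_up_less_1[of z] by auto

lemma step_down_step_up: "step_down z + step_up z = 1"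
  by (simp add: step_down_def)

lemma step_down_eq: "step_down z = exp (- \<beta> * (2 * real_of_int z + 1)) * step_up z"
  unfolding step_down_def step_up_def by (simp add: field_simps add_nonneg_eq_0_iff)

text \<open>
  When the parent of a vertex has been drawn \<open>z\<close> times more often than a given child, the next draw
  among these two is the child with probability \<open>step_up z\<close>.  \<open>race z i j\<close> is the probability that
  then \<open>j\<close> further draws of the child occur before \<open>i\<close> further draws of the parent.  It is defined
  by a recursion in which the starting point \<open>z\<close> is fixed, as the maximum principle below needs;
  \<open>race_forward\<close> is the equation obtained by conditioning on the next draw.
\<close>

fun race :: "int \<Rightarrow> nat \<Rightarrow> nat \<Rightarrow> real" where
  "race z i 0 = 1"
| "race z 0 (Suc j) = 0"
| "race z (Suc i) (Suc j) =
     step_down (z + int i - int j) * race z i (Suc j) + step_up (z + int i - int j) * race z (Suc i) j"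

text \<open>Raising \<open>z\<close> while a draw of the parent is used up, or lowering it while a
  draw of the child is used up, keeps \<open>z + int i - int j\<close>; hence the forward step and
  the defining recursion commute, and one induction exchanges them. In Rubin's picture the draws are
  governed by independent exponential clocks with the weights as rates. By lack of memory the race
  can be decided from its last clocks backwards, which is the defining recursion, as well as from
  its first clocks.\<close>

lemma race_forward:
  "race z (Suc i) (Suc j) = step_down z * race (z + 1) i (Suc j) + step_up z * race (z - 1) (Suc i) j"
proof (induction "i + j" arbitrary: i j rule: less_induct)
  case less
  show ?case
  proof (cases i)
    case 0
    show ?thesis
    proof (cases j)
      case 0
      then show ?thesis using \<open>i = 0\<close> by simp
    next
      case (Suc j')
      have "race z (Suc i) (Suc j') = step_up z * race (z - 1) (Suc i) j'"
        using less[of i j'] Suc \<open>i = 0\<close> by simp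
      then show ?thesis using Suc \<open>i = 0\<close> by (simp add: algebra_simps)
    qed
  next
    case (Suc i')
    show ?thesis
    proof (cases j)
      case 0
      have "race z (Suc i') (Suc 0) = step_down z * race (z + 1) i' (Suc 0) + step_up z * race (z - 1) (Suc i') 0"
        using less[of i' 0] Suc 0 by simp
      then have *: "race z (Suc i') (Suc 0) = step_down z * race (z + 1) i' (Suc 0) + step_up z" by simp
      have "race z (Suc i) (Suc j) =
          step_down (z + 1 + int i') * race z (Suc i') (Suc 0) + step_up (z + 1 + int i')"
        using Suc 0 by (simp add: algebra_simps)
      also have "\<dots> = step_down z * (step_down (z + 1 + int i') * race (z + 1) i' (Suc 0) + step_up (z + 1 + int i')) + step_up z"
        unfolding * step_down_def by (simp add: algebra_simps)
      also have "step_down (z + 1 + int i') * race (z + 1) i' (Suc 0) + step_up (z + 1 + int i') = race (z + 1) i (Suc j)"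
        using Suc 0 by simp
      finally show ?thesis using 0 by simp
    next
      case (Suc j')
      have 1: "race z (Suc i') (Suc j) = step_down z * race (z + 1) i' (Suc j) + step_up z * race (z - 1) (Suc i') j"
        using less[of i' j] \<open>i = Suc i'\<close> by simp
      have 2: "race z (Suc i) (Suc j') = step_down z * race (z + 1) i (Suc j') + step_up z * race (z - 1) (Suc i) j'"
        using less[of i j'] Suc by simp
      let ?w = "z + int i - int j"
      have "race z (Suc i) (Suc j) = step_down ?w * race z (Suc i') (Suc j) + step_up ?w * race z (Suc i) (Suc j')"
        using \<open>i = Suc i'\<close> Suc by simp
      also have "\<dots> = step_down z * (step_down ?w * race (z + 1) i' (Suc j) + step_up ?w * race (z + 1) i (Suc j'))
         + step_up z * (step_down ?w * race (z - 1) (Suc i') j + step_up ?w * race (z - 1) (Suc i) j')"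
        unfolding 1 2 by (simp add: algebra_simps)
      also have "step_down ?w * race (z + 1) i' (Suc j) + step_up ?w * race (z + 1) i (Suc j') = race (z + 1) i (Suc j)"
      proof -
        have e: "(z + 1) + int i' - int j = ?w" using \<open>i = Suc i'\<close> by simp
        from race.simps(3)[of "z + 1" i' j] show ?thesis
          unfolding e by (simp only: \<open>i = Suc i'\<close> Suc)
      qed
      also have "step_down ?w * race (z - 1) (Suc i') j + step_up ?w * race (z - 1) (Suc i) j' = race (z - 1) (Suc i) j"
      proof -
        have e: "(z - 1) + int i - int j' = ?w" using Suc by simp
        from race.simps(3)[of "z - 1" i j'] show ?thesis
          unfolding e by (simp only: \<open>i = Suc i'\<close> Suc)
      qed
      finally show ?thesis .
    qed
  qed
qed

text \<open>The two monotonicities support each other: the value at \<open>(Suc i, Suc j)\<close> is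
  an average of those at \<open>(i, Suc j)\<close> and \<open>(Suc i, j)\<close>, and the two
  induction hypotheses, which meet at \<open>(i, j)\<close>, say that the first of these is the
  smaller one.\<close>

lemma race_mono:
  "race z i (Suc j) \<le> race z i j" "race z i j \<le> race z (Suc i) j"
proof (induction "i + j" arbitrary: i j rule: less_induct)
  case less
  have avg: "x \<le> step_down w * x + step_up w * y \<and> step_down w * x + step_up w * y \<le> y" if "x \<le> y" for w x y
  proof -
    have "step_down w * x + step_up w * y = x + step_up w * (y - x)" "step_down w * x + step_up w * y = y - step_down w * (y - x)"
      unfolding step_down_def by (simp_all add: algebra_simps)
    moreover have "step_up w * (y - x) \<ge> 0" "step_down w * (y - x) \<ge> 0"
      using that step_up_pos[of w] step_down_pos[of w] by simp_all
    ultimately show ?thesis by linarith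
  qed
  {
    case 1
    show ?case
    proof (cases i)
      case 0 then show ?thesis by (cases j) auto
    next
      case (Suc i')
      have a: "race z i' (Suc j) \<le> race z i' j" "race z i' j \<le> race z (Suc i') j"
        using less[of i' j] Suc by auto
      show ?thesis unfolding Suc race.simps using avg[of "race z i' (Suc j)" "race z (Suc i') j"] a by auto
    qed
  next
    case 2
    show ?case
    proof (cases j)
      case 0 then show ?thesis by simp
    next
      case (Suc j')
      have a: "race z i (Suc j') \<le> race z i j'" "race z i j' \<le> race z (Suc i) j'"
        using less[of i j'] Suc by auto
      show ?thesis unfolding Suc race.simps using avg[of "race z i (Suc j')" "race z (Suc i) j'"] a by auto
    qed
  }
qed

lemma race_nonneg: "race z i j \<ge> 0"
  by (induction z i j rule: race.induct) (auto simp: less_imp_le[OF step_up_pos] less_imp_le[OF step_down_pos])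

lemma race_le_1: "race z i j \<le> 1"
  by (induction j) (simp, meson order_trans race_mono(1))

section \<open>The discrete Gaussian law\<close>

definition qq :: real where "qq = exp (- \<beta>)"

lemma qq: "0 < qq" "qq < 1"
  using beta_pos by (auto simp: qq_def)

definition gauss :: "nat \<Rightarrow> real" where "gauss n = exp (- \<beta> * real n ^ 2)"

lemma gauss_pos: "gauss n > 0" by (simp add: gauss_def)

lemma gauss_le: "gauss n \<le> qq ^ n"
proof -
  have "real n \<le> real n ^ 2" by (cases n) (auto simp: power2_eq_square)
  then have "- \<beta> * real n ^ 2 \<le> real n * (- \<beta>)" using beta_pos by (simp add: mult.commute)
  then have "gauss n \<le> exp (real n * (- \<beta>))" by (simp add: gauss_def)
  then show ?thesis by (simp only: exp_of_nat_mult qq_def)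
qed

lemma gauss_summable: "summable gauss"
  by (rule summable_comparison_test'[where g="\<lambda>n. qq ^ n" and N=0])
     (use qq gauss_le gauss_pos in \<open>auto simp: less_imp_le intro: summable_geometric\<close>)

definition gtail :: "nat \<Rightarrow> real" where "gtail n = (\<Sum>i. gauss (i + Suc n))"

lemma gtail_Suc: "gtail n = gauss (Suc n) + gtail (Suc n)"
proof -
  have "summable (\<lambda>i. gauss (i + Suc n))"
    using gauss_summable summable_iff_shift by blast
  from suminf_split_initial_segment[OF this, of 1] show ?thesis
    unfolding gtail_def by (simp add: algebra_simps)
qed

lemma gtail_nonneg: "gtail n \<ge> 0"
  unfolding gtail_def using gauss_summable gauss_pos
  by (intro suminf_nonneg) (auto simp: summable_iff_shift less_imp_le simp del: add_Suc_right)

lemma gtail_le: "gtail n \<le> qq ^ n / (1 - qq)"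
proof -
  have s: "summable (\<lambda>i. gauss (i + Suc n))"
    using gauss_summable summable_iff_shift by blast
  have "gauss (i + Suc n) \<le> qq ^ n * qq ^ i" for i
  proof -
    have "gauss (i + Suc n) \<le> qq ^ (i + Suc n)" by (rule gauss_le)
    also have "\<dots> \<le> qq ^ (n + i)" using qq by (intro power_decreasing) auto
    finally show ?thesis by (simp add: power_add)
  qed
  then have "gtail n \<le> (\<Sum>i. qq ^ n * qq ^ i)"
    unfolding gtail_def using s qq by (intro suminf_le) (auto intro!: summable_mult summable_geometric)
  also have "\<dots> = qq ^ n / (1 - qq)"
    using qq by (subst suminf_mult) (auto simp: suminf_geometric summable_geometric)
  finally show ?thesis .
qed

definition gtot :: real where "gtot = 1 + 2 * gtail 0"

lemma gtot: "gtot \<ge> 1" using gtail_nonneg[of 0] by (simp add: gtot_def)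

text \<open>The distribution function of the law with weights
  \<open>exp (- \<beta> * z ^ 2)\<close>. By symmetry both halves are written through upper tails,
  so that its distance from the boundary values 1 and 0 of \<open>race\<close> is visibly a
  tail.\<close>

definition dgauss_cdf :: "int \<Rightarrow> real" where
  "dgauss_cdf z = (if z \<ge> 0 then 1 - gtail (nat z) / gtot else gtail (nat (- 1 - z)) / gtot)"

definition dgauss_mass :: "int \<Rightarrow> real" where
  "dgauss_mass z = exp (- \<beta> * real_of_int z ^ 2) / gtot"

lemma dgauss_cdf_diff: "dgauss_cdf z - dgauss_cdf (z - 1) = dgauss_mass z"
proof -
  consider "z \<ge> 1" | "z = 0" | "z < 0" by linarith
  then show ?thesis
  proof cases
    case 1
    then have n: "z = int (Suc (nat (z - 1)))" by simp
    define n where "n = nat (z - 1)"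
    have n: "z = int (Suc n)" using n by (simp add: n_def)
    have "dgauss_cdf z - dgauss_cdf (z - 1) = (gtail n - gtail (Suc n)) / gtot"
      unfolding n dgauss_cdf_def by (simp add: nat_add_distrib diff_divide_distrib)
    also have "\<dots> = gauss (Suc n) / gtot" using gtail_Suc[of n] by simp
    finally show ?thesis unfolding n dgauss_mass_def gauss_def by simp
  next
    case 2
    have "dgauss_cdf z - dgauss_cdf (z - 1) = (gtot - 2 * gtail 0) / gtot"
      using gtot unfolding 2 dgauss_cdf_def by (simp add: field_simps)
    then show ?thesis using 2 by (simp add: dgauss_mass_def gtot_def)
  next
    case 3
    then obtain n where n: "z = - int (Suc n)" using negD by blast
    have "dgauss_cdf z - dgauss_cdf (z - 1) = (gtail n - gtail (Suc n)) / gtot"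
      unfolding n dgauss_cdf_def by (simp add: nat_add_distrib diff_divide_distrib)
    also have "\<dots> = gauss (Suc n) / gtot" using gtail_Suc[of n] by simp
    also have "real (Suc n) ^ 2 = real_of_int z ^ 2" unfolding n by (simp add: power2_eq_square algebra_simps)
    then have "gauss (Suc n) / gtot = dgauss_mass z" by (simp add: dgauss_mass_def gauss_def)
    finally show ?thesis .
  qed
qed

lemma dgauss_mass_Suc: "dgauss_mass (z + 1) = exp (- \<beta> * (2 * real_of_int z + 1)) * dgauss_mass z"
  unfolding dgauss_mass_def by (simp add: power2_eq_square algebra_simps flip: exp_add)

text \<open>Detailed balance: the masses at \<open>z + 1\<close> and \<open>z\<close> are in the
  ratio \<open>step_down z / step_up z\<close>, so the increments to the right and to the left of
  \<open>z\<close> cancel in the average. With \<open>z = int k - int m\<close> this is the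
  recursion of \<open>race 0 k m\<close>.\<close>

lemma dgauss_cdf_harmonic: "dgauss_cdf z = step_down z * dgauss_cdf (z - 1) + step_up z * dgauss_cdf (z + 1)"
proof -
  have 1: "dgauss_cdf (z - 1) = dgauss_cdf z - dgauss_mass z" using dgauss_cdf_diff[of z] by simp
  have 2: "dgauss_cdf (z + 1) = dgauss_cdf z + dgauss_mass (z + 1)" using dgauss_cdf_diff[of "z + 1"] by simp
  have 3: "step_up z * dgauss_mass (z + 1) = step_down z * dgauss_mass z" by (simp add: dgauss_mass_Suc step_down_eq)
  have "step_down z * dgauss_cdf (z - 1) + step_up z * dgauss_cdf (z + 1) = (step_down z + step_up z) * dgauss_cdf z - step_down z * dgauss_mass z + step_up z * dgauss_mass (z + 1)"
    unfolding 1 2 by (simp add: algebra_simps)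
  then show ?thesis using 3 step_down_step_up[of z] by simp
qed

section \<open>A supersolution of the recursion\<close>

definition sg :: real where "sg = exp (- \<beta> / 4)"
text \<open>For step probabilities in the ratio \<open>qq\<close> the weighted average of
  \<open>t\<close> and \<open>1 / t\<close> is smallest at \<open>t = sqrt qq\<close>. Hence
  \<open>sg ^ 2 = sqrt qq\<close>, and \<open>contr\<close>, which is
  \<open>1 / cosh (\<beta> / 2)\<close>, is that smallest value.\<close>

definition contr :: real where "contr = 2 * sg ^ 2 / (1 + sg ^ 4)"

lemma sg: "0 < sg" "sg < 1" using beta_pos by (auto simp: sg_def)

lemma sg4: "sg ^ 4 = qq"
  unfolding sg_def qq_def by (simp flip: exp_of_nat_mult)

lemma contr: "0 < contr" "contr < 1"
proof -
  show "0 < contr" using sg by (simp add: contr_def add_pos_pos)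
  have "sg ^ 2 < 1" using sg by (simp add: power_strict_decreasing[of 0 2 sg, simplified])
  then have "(1 - sg ^ 2) ^ 2 > 0" by simp
  then have "2 * sg ^ 2 < 1 + sg ^ 4" by (simp add: power2_eq_square algebra_simps power4_eq_xxxx)
  then show "contr < 1" using sg by (simp add: contr_def add_pos_pos)
qed

text \<open>Symmetric about \<open>-1/2\<close>, the point at which \<open>step_up\<close> would
  equal one half. On either side the recursion prefers the outward step, on which
  \<open>barrier\<close> loses a factor \<open>sg ^ 2\<close>.\<close>

definition barrier :: "int \<Rightarrow> real" where "barrier z = sg ^ nat \<bar>2 * z + 1\<bar>"

lemma barrier_pos: "barrier z > 0" using sg by (simp add: barrier_def)

lemma barrier_super: "step_down z * barrier (z - 1) + step_up z * barrier (z + 1) \<le> contr * barrier z"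
proof -
  have main: "p' * (1 / sg ^ 2) + p * sg ^ 2 \<le> contr"
    if "p \<ge> 1 / (1 + sg ^ 4)" "p + p' = 1" for p p'
  proof -
    have "1 / sg ^ 2 \<ge> 1" "sg ^ 2 \<le> 1" using sg by (auto simp: power_le_one)
    then have d: "1 / sg ^ 2 - sg ^ 2 \<ge> 0" by simp
    have "p' * (1 / sg ^ 2) + p * sg ^ 2 = 1 / sg ^ 2 - p * (1 / sg ^ 2 - sg ^ 2)"
    proof -
      have "p' = 1 - p" using that(2) by simp
      then show ?thesis by (simp only: left_diff_distrib right_diff_distrib mult_1_left)
    qed
    also have "\<dots> \<le> 1 / sg ^ 2 - 1 / (1 + sg ^ 4) * (1 / sg ^ 2 - sg ^ 2)"
      using that(1) d by (intro diff_left_mono mult_right_mono) auto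
    also have "\<dots> = contr"
    proof -
      define t where "t = sg ^ 2"
      have t: "t \<noteq> 0" "1 + t ^ 2 \<noteq> 0" using sg by (auto simp: t_def add_nonneg_eq_0_iff)
      have "1 / t - 1 / (1 + t ^ 2) * (1 / t - t) = 2 * t / (1 + t ^ 2)"
        using t by (simp add: divide_simps) (simp add: algebra_simps power2_eq_square)
      then show ?thesis unfolding contr_def t_def by (simp flip: power_mult)
    qed
    finally show ?thesis .
  qed
  \<comment> \<open>At 0 and -1 the inward neighbour lies across the centre and has the same value
    of \<open>barrier\<close>, so these two points are computed separately.\<close>
  consider "z \<ge> 1" | "z = 0" | "z = -1" | "z \<le> -2" by linarith
  then show ?thesis
  proof cases
    case 1
    have "nat \<bar>2 * (z - 1) + 1\<bar> + 2 = nat \<bar>2 * z + 1\<bar>" "nat \<bar>2 * (z + 1) + 1\<bar> = nat \<bar>2 * z + 1\<bar> + 2"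
      using 1 by auto
    then have w: "barrier z = sg ^ 2 * barrier (z - 1)" "barrier (z + 1) = sg ^ 2 * barrier z"
      unfolding barrier_def by (metis power_add mult.commute)+
    have "exp (- \<beta> * (2 * real_of_int z + 1)) \<le> exp (- \<beta>)" using 1 beta_pos by simp
    then have "step_up z \<ge> 1 / (1 + sg ^ 4)" unfolding step_up_def sg4 qq_def
      by (intro divide_left_mono mult_pos_pos) (auto simp: add_pos_pos)
    from main[OF this, of "step_down z"] have "step_down z * (1 / sg ^ 2) + step_up z * sg ^ 2 \<le> contr" by (simp add: step_down_def)
    then have "(step_down z * (1 / sg ^ 2) + step_up z * sg ^ 2) * barrier z \<le> contr * barrier z" using barrier_pos[of z] by (simp add: mult_right_mono)
    moreover have "barrier (z - 1) = 1 / sg ^ 2 * barrier z" using w sg by simp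
    ultimately show ?thesis unfolding w(2) by (simp only: algebra_simps)
  next
    case 2
    have p: "step_up 0 = 1 / (1 + sg ^ 4)" unfolding step_up_def sg4 qq_def by simp
    have l: "step_down 0 = sg ^ 4 / (1 + sg ^ 4)" using step_down_eq[of 0] p by (simp add: sg4 qq_def)
    have w: "barrier (-1) = sg" "barrier 1 = sg ^ 3" by (simp_all add: barrier_def)
    have "step_down z * barrier (z - 1) + step_up z * barrier (z + 1) = (sg ^ 4 * sg + sg ^ 3) / (1 + sg ^ 4)"
      unfolding 2 by (simp add: p l w add_divide_distrib)
    also have "\<dots> \<le> (2 * sg ^ 2 * sg) / (1 + sg ^ 4)"
    proof -
      have "sg ^ 4 \<le> sg ^ 2" using sg by (intro power_decreasing) auto
      then have "sg ^ 4 * sg \<le> sg ^ 2 * sg" using sg by (intro mult_right_mono) auto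
      moreover have "sg ^ 3 = sg ^ 2 * sg" by (simp add: power3_eq_cube power2_eq_square)
      ultimately show ?thesis using sg by (intro divide_right_mono) (auto simp: add_nonneg_nonneg)
    qed
    also have "\<dots> = contr * barrier z" using 2 by (simp add: contr_def barrier_def)
    finally show ?thesis .
  next
    case 3
    have "step_up (-1) = 1 / (1 + exp \<beta>)" by (simp add: step_up_def)
    also have "\<dots> = qq / (1 + qq)" unfolding qq_def by (simp add: exp_minus field_simps add_pos_pos less_imp_neq[symmetric])
    finally have p: "step_up (-1) = sg ^ 4 / (1 + sg ^ 4)" by (simp add: sg4)
    have "1 + sg ^ 4 \<noteq> 0" using sg by (auto simp: add_nonneg_eq_0_iff)
    then have l: "step_down (-1) = 1 / (1 + sg ^ 4)" unfolding step_down_def p by (simp add: field_simps)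
    have w: "barrier (-2) = sg ^ 3" "barrier 0 = sg" by (simp_all add: barrier_def)
    have "step_down z * barrier (z - 1) + step_up z * barrier (z + 1) = (sg ^ 3 + sg ^ 4 * sg) / (1 + sg ^ 4)"
      unfolding 3 by (simp add: p l w add_divide_distrib)
    also have "\<dots> \<le> (2 * sg ^ 2 * sg) / (1 + sg ^ 4)"
    proof -
      have "sg ^ 4 \<le> sg ^ 2" using sg by (intro power_decreasing) auto
      then have "sg ^ 4 * sg \<le> sg ^ 2 * sg" using sg by (intro mult_right_mono) auto
      moreover have "sg ^ 3 = sg ^ 2 * sg" by (simp add: power3_eq_cube power2_eq_square)
      ultimately show ?thesis using sg by (intro divide_right_mono) (auto simp: add_nonneg_nonneg)
    qed
    also have "\<dots> = contr * barrier z" using 3 by (simp add: contr_def barrier_def)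
    finally show ?thesis .
  next
    case 4
    have "nat \<bar>2 * (z + 1) + 1\<bar> + 2 = nat \<bar>2 * z + 1\<bar>" "nat \<bar>2 * (z - 1) + 1\<bar> = nat \<bar>2 * z + 1\<bar> + 2"
      using 4 by auto
    then have w: "barrier z = sg ^ 2 * barrier (z + 1)" "barrier (z - 1) = sg ^ 2 * barrier z"
      unfolding barrier_def by (metis power_add mult.commute)+
    have "exp \<beta> \<le> exp (- \<beta> * (2 * real_of_int z + 1))"
    proof -
      have "\<beta> * (2 * real_of_int z + 1) \<le> \<beta> * (- 1)" using 4 beta_pos by (intro mult_left_mono) auto
      then show ?thesis by simp
    qed
    then have "step_up z \<le> 1 / (1 + exp \<beta>)" unfolding step_up_def
      by (intro divide_left_mono mult_pos_pos) (auto simp: add_pos_pos)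
    also have "\<dots> = sg ^ 4 / (1 + sg ^ 4)" unfolding sg4 qq_def by (simp add: exp_minus field_simps add_pos_pos less_imp_neq[symmetric])
    also have "\<dots> = 1 - 1 / (1 + sg ^ 4)"
    proof -
      have "1 + sg ^ 4 \<noteq> 0" using sg by (auto simp: add_nonneg_eq_0_iff)
      then show ?thesis by (simp add: field_simps)
    qed
    finally have "step_down z \<ge> 1 / (1 + sg ^ 4)" unfolding step_down_def by simp
    from main[OF this, of "step_up z"] have "step_up z * (1 / sg ^ 2) + step_down z * sg ^ 2 \<le> contr" by (simp add: step_down_def)
    then have "(step_up z * (1 / sg ^ 2) + step_down z * sg ^ 2) * barrier z \<le> contr * barrier z" using barrier_pos[of z] by (simp add: mult_right_mono)
    moreover have "barrier (z + 1) = 1 / sg ^ 2 * barrier z" using w sg by simp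
    ultimately show ?thesis unfolding w(2) by (simp only: algebra_simps)
  qed
qed

text \<open>The boundary mismatch is a Gaussian tail, at most \<open>qq ^ n / (1 - qq)\<close>, and
  \<open>qq \<le> contr * sg ^ 2\<close>; the odd exponent in \<open>barrier\<close> costs the
  further factor \<open>1 / sg\<close>.\<close>

definition CC :: real where "CC = 1 / (sg * (1 - qq))"

lemma CC_pos: "CC > 0" using sg qq by (simp add: CC_def)

lemma qq_le: "qq \<le> contr * sg ^ 2"
proof -
  have "contr * sg ^ 2 = 2 * qq / (1 + qq)" unfolding contr_def sg4[symmetric] by (simp add: power4_eq_xxxx power2_eq_square)
  moreover have "qq * (1 + qq) \<le> 2 * qq" using qq by simp
  ultimately show ?thesis using qq by (simp add: pos_le_divide_eq)
qed

lemma gtail_bound: "gtail n / gtot \<le> CC * (contr ^ n * sg ^ (2 * n + 1))"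
proof -
  have "gtail n / gtot \<le> gtail n" using gtot gtail_nonneg[of n] by (simp add: divide_le_eq mult_le_cancel_left1)
  also have "\<dots> \<le> qq ^ n / (1 - qq)" by (rule gtail_le)
  also have "\<dots> \<le> (contr * sg ^ 2) ^ n / (1 - qq)" using qq qq_le by (intro divide_right_mono power_mono) auto
  also have "\<dots> = CC * (contr ^ n * sg ^ (2 * n + 1))"
    using sg unfolding CC_def by (simp add: power_mult_distrib power_mult)
  finally show ?thesis .
qed

text \<open>Maximum principle: the difference satisfies the recursion of \<open>race\<close>, and
  \<open>contr\<close>, \<open>sg\<close> are chosen such that the right-hand side is a supersolution of it.\<close>

lemma race_dgauss_cdf:
  "\<bar>race 0 k m - dgauss_cdf (int k - int m)\<bar> \<le> CC * (contr ^ (k + m) * barrier (int k - int m))"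
proof (induction "0::int" k m rule: race.induct)
  case (1 k)
  have "\<bar>race 0 k 0 - dgauss_cdf (int k - int 0)\<bar> = gtail k / gtot"
    using gtail_nonneg[of k] gtot by (simp add: dgauss_cdf_def)
  also have "\<dots> \<le> CC * (contr ^ k * sg ^ (2 * k + 1))" by (rule gtail_bound)
  also have "sg ^ (2 * k + 1) = barrier (int k - int 0)" unfolding barrier_def
    by (rule arg_cong[where f="\<lambda>n. sg ^ n"]) auto
  finally show ?case by simp
next
  case (2 j)
  have "\<bar>race 0 0 (Suc j) - dgauss_cdf (int 0 - int (Suc j))\<bar> = gtail j / gtot"
    using gtail_nonneg[of j] gtot by (simp add: dgauss_cdf_def)
  \<comment> \<open>On this side of the boundary the exponent of \<open>contr\<close> is one more
    than the index of the tail. Splitting off the first term of the tail gains the factor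
    \<open>qq\<close> that \<open>gtail_bound\<close> would miss.\<close>
  also have "\<dots> = gauss (Suc j) / gtot + gtail (Suc j) / gtot" using gtail_Suc[of j] by (simp add: add_divide_distrib)
  also have "\<dots> \<le> CC * (contr ^ Suc j * sg ^ (2 * j + 1))"
  proof -
    have "gauss (Suc j) / gtot + gtail (Suc j) / gtot \<le> gauss (Suc j) + gtail (Suc j)"
      using gtot gtail_nonneg[of "Suc j"] gauss_pos[of "Suc j"] by (intro add_mono) (auto simp: divide_le_eq mult_le_cancel_left1)
    also have "\<dots> \<le> qq ^ Suc j + qq ^ Suc j * qq / (1 - qq)"
    proof -
      have "gtail (Suc j) = (\<Sum>i. gauss (i + Suc (Suc j)))" by (simp add: gtail_def)
      also have "\<dots> \<le> (\<Sum>i. qq ^ Suc (Suc j) * qq ^ i)"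
      proof (intro suminf_le)
        show "gauss (i + Suc (Suc j)) \<le> qq ^ Suc (Suc j) * qq ^ i" for i
          using gauss_le[of "i + Suc (Suc j)"] by (simp add: power_add mult_ac)
      qed (use gauss_summable summable_iff_shift qq in \<open>auto intro!: summable_mult summable_geometric simp del: add_Suc_right\<close>)
      also have "\<dots> = qq ^ Suc j * qq / (1 - qq)"
        using qq by (subst suminf_mult) (auto simp: suminf_geometric summable_geometric)
      finally show ?thesis using gauss_le[of "Suc j"] by simp
    qed
    also have "\<dots> = qq ^ Suc j / (1 - qq)" using qq by (simp add: field_simps)
    also have "\<dots> \<le> (contr * sg ^ 2) ^ Suc j / (1 - qq)" using qq qq_le by (intro divide_right_mono power_mono) auto
    also have "\<dots> = contr ^ Suc j * sg ^ (2 * j + 2) / (1 - qq)" by (simp add: power_mult_distrib power_mult power2_eq_square)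
    also have "\<dots> = (contr ^ Suc j * sg ^ (2 * j + 1) * sg) / (1 - qq)" by (simp add: mult_ac)
    also have "\<dots> \<le> (contr ^ Suc j * sg ^ (2 * j + 1) * (1 / sg)) / (1 - qq)"
    proof -
      have "sg \<le> 1 / sg" using sg by (simp add: pos_le_divide_eq mult_le_one)
      then show ?thesis using qq contr sg by (intro divide_right_mono mult_left_mono) auto
    qed
    also have "\<dots> = CC * (contr ^ Suc j * sg ^ (2 * j + 1))" unfolding CC_def by simp
    finally show ?thesis .
  qed
  also have "sg ^ (2 * j + 1) = barrier (int 0 - int (Suc j))" unfolding barrier_def
    by (rule arg_cong[where f="\<lambda>n. sg ^ n"]) auto
  finally show ?case by simp
next
  case (3 i j)
  let ?w = "int i - int j"
  have e: "int (Suc i) - int (Suc j) = ?w" "int i - int (Suc j) = ?w - 1" "int (Suc i) - int j = ?w + 1" by auto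
  have ih1: "\<bar>race 0 i (Suc j) - dgauss_cdf (?w - 1)\<bar> \<le> CC * (contr ^ (i + Suc j) * barrier (?w - 1))"
    using 3(1) unfolding e by simp
  have ih2: "\<bar>race 0 (Suc i) j - dgauss_cdf (?w + 1)\<bar> \<le> CC * (contr ^ (Suc i + j) * barrier (?w + 1))"
    using 3(2) unfolding e by simp
  have "race 0 (Suc i) (Suc j) - dgauss_cdf ?w =
     step_down ?w * (race 0 i (Suc j) - dgauss_cdf (?w - 1)) + step_up ?w * (race 0 (Suc i) j - dgauss_cdf (?w + 1))"
    using dgauss_cdf_harmonic[of ?w] by (simp add: algebra_simps)
  also have "\<bar>\<dots>\<bar> \<le> step_down ?w * \<bar>race 0 i (Suc j) - dgauss_cdf (?w - 1)\<bar> + step_up ?w * \<bar>race 0 (Suc i) j - dgauss_cdf (?w + 1)\<bar>"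
    using step_down_pos[of ?w] step_up_pos[of ?w] by (intro order_trans[OF abs_triangle_ineq]) (simp add: abs_mult)
  also have "\<dots> \<le> step_down ?w * (CC * (contr ^ (i + Suc j) * barrier (?w - 1))) + step_up ?w * (CC * (contr ^ (Suc i + j) * barrier (?w + 1)))"
    using step_down_pos[of ?w] step_up_pos[of ?w] ih1 ih2 by (intro add_mono mult_left_mono) auto
  also have "\<dots> = CC * contr ^ (Suc (i + j)) * (step_down ?w * barrier (?w - 1) + step_up ?w * barrier (?w + 1))"
    by (simp add: algebra_simps)
  also have "\<dots> \<le> CC * contr ^ (Suc (i + j)) * (contr * barrier ?w)"
    using CC_pos contr barrier_super by (intro mult_left_mono) auto
  finally show ?case unfolding e by (simp add: mult_ac)
qed

end

section \<open>Elementary estimates for sums and powers\<close>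

lemma pow_geo_bounded:
  fixes x :: real
  assumes "0 < x" "x < 1"
  obtains D where "D > 0" "\<And>k::nat. real k ^ p * x ^ k \<le> D"
proof -
  define u where "u = - ln x"
  have u: "u > 0" using assms by (simp add: u_def)
  have "real k ^ p * x ^ k \<le> fact p / u ^ p" for k :: nat
  proof -
    let ?y = "real k * u"
    have y: "?y \<ge> 0" using u by simp
    have "?y ^ p / fact p \<le> exp ?y"
    proof -
      have "(\<Sum>n\<in>{p}. ?y ^ n /\<^sub>R fact n) \<le> (\<Sum>n. ?y ^ n /\<^sub>R fact n)"
        using y by (intro sum_le_suminf summable_exp_generic) auto
      then show ?thesis by (simp add: exp_def field_simps)
    qed
    moreover have "x ^ k = exp (- ?y)" using assms
      by (simp add: u_def exp_minus exp_of_nat_mult)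
    ultimately have "?y ^ p / fact p * x ^ k \<le> exp ?y * exp (- ?y)"
      using y by (intro mult_mono) auto
    then have "?y ^ p * x ^ k \<le> fact p" by (simp add: field_simps flip: exp_add)
    then show ?thesis using u by (simp add: power_mult_distrib field_simps)
  qed
  moreover have "fact p / u ^ p > 0" using u by simp
  ultimately show ?thesis using that by blast
qed

lemma summable_pow_geo:
  fixes x :: real
  assumes "0 < x" "x < 1"
  shows "summable (\<lambda>k. real k ^ p * x ^ k)"
proof -
  have s: "0 < sqrt x" "sqrt x < 1" using assms by auto
  obtain D where D: "D > 0" "\<And>k::nat. real k ^ p * sqrt x ^ k \<le> D" using pow_geo_bounded[OF s, of p] by blast
  show ?thesis
  proof (rule summable_comparison_test'[where g="\<lambda>k. D * sqrt x ^ k" and N=0])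
    show "summable (\<lambda>k. D * sqrt x ^ k)" using s by (intro summable_mult summable_geometric) auto
    show "norm (real k ^ p * x ^ k) \<le> D * sqrt x ^ k" for k
    proof -
      have "x ^ k = sqrt x ^ k * sqrt x ^ k" using assms by (simp flip: power_mult_distrib)
      then have "real k ^ p * x ^ k = (real k ^ p * sqrt x ^ k) * sqrt x ^ k" by simp
      also have "\<dots> \<le> D * sqrt x ^ k" using D s by (intro mult_right_mono) auto
      finally show ?thesis using assms by simp
    qed
  qed
qed

definition ndist :: "nat \<Rightarrow> nat \<Rightarrow> nat" where
  "ndist k m = (if m \<le> k then k - m else m - k)"

lemma real_ndist: "real (ndist k m) = \<bar>real m - real k\<bar>"
  by (auto simp: ndist_def)

text \<open>Every distance from \<open>k\<close> is attained at most twice.\<close>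

lemma suminf_ndist_le:
  fixes G :: "nat \<Rightarrow> ennreal"
  shows "(\<Sum>m. G (ndist k m)) \<le> 2 * (\<Sum>j. G j)"
proof -
  have "(\<Sum>m. G (ndist k m)) = (\<Sum>m. G (ndist k (m + k))) + (\<Sum>m<k. G (ndist k m))"
    by (rule suminf_offset) auto
  also have "(\<Sum>m. G (ndist k (m + k))) = (\<Sum>j. G j)" by (simp add: ndist_def cong: if_cong)
  also have "(\<Sum>m<k. G (ndist k m)) = (\<Sum>m<k. G (Suc m))"
    by (rule sum.reindex_bij_witness[where i="\<lambda>m. k - Suc m" and j="\<lambda>m. k - Suc m"]) (auto simp: ndist_def Suc_diff_Suc)
  also have "\<dots> \<le> (\<Sum>m<Suc k. G m)" by (subst sum.lessThan_Suc_shift) simp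
  also have "\<dots> \<le> (\<Sum>j. G j)" by (rule sum_le_suminf) auto
  finally show ?thesis by (simp add: mult_2 add_mono)
qed

text \<open>The third derivative of \<open>x powr a\<close> is positive and decreasing. Left of
  \<open>k\<close> the cubic remainder is therefore negative and may be dropped; right of
  \<open>k\<close> it is largest at \<open>k\<close>, with a coefficient of at most 1. The point
  \<open>y = 0\<close>, where the chain is absorbed, has to be included although the derivatives
  blow up there: the quadratic part then equals \<open>k powr a * ((1 - a) * (1 - a / 2))\<close>,
  which is nonnegative.\<close>

lemma powr_cubic_bound:
  fixes a k y :: real
  assumes a: "0 < a" "a < 1" and k: "k > 0" and y: "y \<ge> 0"
  shows "y powr a \<le> k powr a + a * k powr (a - 1) * (y - k) - a * (1 - a) / 2 * k powr (a - 2) * (y - k) ^ 2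
           + k powr (a - 3) * \<bar>y - k\<bar> ^ 3"
proof -
  have c: "a * (1 - a) * (2 - a) / 6 \<ge> 0" "a * (1 - a) * (2 - a) / 6 \<le> 1"
  proof -
    show "a * (1 - a) * (2 - a) / 6 \<ge> 0" using a by simp
    have "a * (1 - a) \<le> 1 * 1" using a by (intro mult_mono) auto
    then have "a * (1 - a) * (2 - a) \<le> 1 * 2" using a by (intro mult_mono) auto
    then show "a * (1 - a) * (2 - a) / 6 \<le> 1" by simp
  qed
  define diff where "diff m x = (if m = 0 then x powr a else if m = 1 then a * x powr (a - 1)
      else if m = 2 then a * (a - 1) * x powr (a - 2) else a * (a - 1) * (a - 2) * x powr (a - 3))" for m :: nat and x :: real
  have der: "DERIV (diff m) t :> diff (Suc m) t" if "m < 3" "t > 0" for m t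
  proof -
    consider "m = 0" | "m = 1" | "m = 2" using \<open>m < 3\<close> by linarith
    then show ?thesis
    proof cases
      case 1
      have "((\<lambda>x. x powr a) has_real_derivative a * t powr (a - 1)) (at t)"
        using has_real_derivative_powr[OF \<open>t > 0\<close>] by blast
      then show ?thesis using 1 by (simp add: diff_def[abs_def])
    next
      case 2
      have "((\<lambda>x. a * x powr (a - 1)) has_real_derivative a * ((a - 1) * t powr (a - 1 - 1))) (at t)"
        by (intro DERIV_cmult has_real_derivative_powr that)
      then show ?thesis using 2 by (simp add: diff_def[abs_def] mult.assoc)
    next
      case 3
      have "((\<lambda>x. a * (a - 1) * x powr (a - 2)) has_real_derivative a * (a - 1) * ((a - 2) * t powr (a - 2 - 1))) (at t)"
        by (intro DERIV_cmult has_real_derivative_powr that)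
      then show ?thesis using 3 by (simp add: diff_def[abs_def] mult.assoc)
    qed
  qed
  have poly: "(\<Sum>m<3. (diff m k / fact m) * (y - k)^m)
      = k powr a + a * k powr (a - 1) * (y - k) - a * (1 - a) / 2 * k powr (a - 2) * (y - k) ^ 2"
    by (simp add: eval_nat_numeral diff_def algebra_simps diff_divide_distrib add_divide_distrib)
  have d3: "diff 3 t / fact 3 = a * (1 - a) * (2 - a) / 6 * t powr (a - 3)" for t
    by (simp add: diff_def eval_nat_numeral algebra_simps)
  consider "y = 0" | "y > 0" "y < k" | "y = k" | "y > k" using y by linarith
  then show ?thesis
  proof cases
    case 1
    have kk: "k powr (a - 1) * k = k powr a" "k powr (a - 2) * k ^ 2 = k powr a"
      using k by (simp_all add: powr_diff powr_numeral power2_eq_square)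
    have "k powr a + a * k powr (a - 1) * (y - k) - a * (1 - a) / 2 * k powr (a - 2) * (y - k) ^ 2
       = k powr a - a * (k powr (a - 1) * k) - a * (1 - a) / 2 * (k powr (a - 2) * k ^ 2)" using 1 by simp
    also have "\<dots> = k powr a * ((1 - a) * (1 - a / 2))" unfolding kk by (simp add: algebra_simps diff_divide_distrib)
    also have "\<dots> \<ge> 0" using a by simp
    finally show ?thesis using 1 a by simp
  next
    case 2
    have "\<exists>t. y < t \<and> t < k \<and> y powr a = (\<Sum>m<3. (diff m k / fact m) * (y - k)^m) + (diff 3 t / fact 3) * (y - k)^3"
      by (rule Taylor_down[of 3 diff "\<lambda>x. x powr a" y k k]) (use 2 der in \<open>auto simp: diff_def[abs_def]\<close>)
    then obtain t where t: "y < t" "t < k" and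
       e: "y powr a = (\<Sum>m<3. (diff m k / fact m) * (y - k)^m) + (diff 3 t / fact 3) * (y - k)^3" by blast
    have "(diff 3 t / fact 3) * (y - k)^3 \<le> 0"
      unfolding d3 using c 2 by (intro mult_nonneg_nonpos mult_nonneg_nonneg) (auto simp: power_le_zero_eq)
    moreover have "0 \<le> k powr (a - 3) * \<bar>y - k\<bar> ^ 3" by simp
    ultimately show ?thesis using e poly by linarith
  next
    case 3
    then show ?thesis by simp
  next
    case 4
    have "\<exists>t. k < t \<and> t < y \<and> y powr a = (\<Sum>m<3. (diff m k / fact m) * (y - k)^m) + (diff 3 t / fact 3) * (y - k)^3"
      by (rule Taylor_up[of 3 diff "\<lambda>x. x powr a" k y k]) (use 4 k der in \<open>auto simp: diff_def[abs_def]\<close>)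
    then obtain t where t: "k < t" "t < y" and
       e: "y powr a = (\<Sum>m<3. (diff m k / fact m) * (y - k)^m) + (diff 3 t / fact 3) * (y - k)^3" by blast
    have "t powr (a - 3) \<le> k powr (a - 3)" using t k a by (intro powr_mono2') auto
    then have "a * (1 - a) * (2 - a) / 6 * t powr (a - 3) \<le> 1 * k powr (a - 3)" using c by (intro mult_mono) auto
    then have "(diff 3 t / fact 3) * (y - k)^3 \<le> k powr (a - 3) * \<bar>y - k\<bar> ^ 3"
      unfolding d3 using 4 by (intro mult_mono) auto
    then show ?thesis using e poly by linarith
  qed
qed

context repulsion
begin

section \<open>The Markov kernel of the numbers of entries\<close>

text \<open>Started from equal counts, \<open>race 0 k m\<close> is the probability of at least
  \<open>m\<close> draws of the child before the \<open>k\<close>-th draw of the parent.\<close>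

definition kern_prob :: "nat \<Rightarrow> nat \<Rightarrow> real" where
  "kern_prob k m = race 0 k m - race 0 k (Suc m)"

lemma kern_prob_nonneg: "kern_prob k m \<ge> 0"
  using race_mono(1) by (simp add: kern_prob_def)

lemma CC_ge_1: "CC \<ge> 1"
proof -
  have "sg * (1 - qq) \<le> 1 * 1" using sg qq by (intro mult_mono) auto
  then show ?thesis using sg qq by (simp add: CC_def le_divide_eq)
qed

lemma barrier_le: "nat \<bar>2 * z + 1\<bar> \<ge> n \<Longrightarrow> barrier z \<le> sg ^ n"
  unfolding barrier_def using sg by (intro power_decreasing) auto

lemma race_err: "\<bar>race 0 k m - dgauss_cdf (int k - int m)\<bar> \<le> CC * sg ^ n"
  if "nat \<bar>2 * (int k - int m) + 1\<bar> \<ge> n"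
proof -
  have "contr ^ (k + m) * barrier (int k - int m) \<le> 1 * sg ^ n"
    using contr barrier_le[OF that] barrier_pos[of "int k - int m"] sg
    by (intro mult_mono power_le_one) (auto simp: less_imp_le)
  then have "CC * (contr ^ (k + m) * barrier (int k - int m)) \<le> CC * sg ^ n"
    using CC_pos by (intro mult_left_mono) auto
  with race_dgauss_cdf[of k m] show ?thesis by linarith
qed

lemma gtail_bound': "gtail n / gtot \<le> CC * sg ^ (n + 1)"
proof -
  have "contr ^ n * sg ^ (2 * n + 1) \<le> 1 * sg ^ (n + 1)"
    using contr sg by (intro mult_mono power_le_one power_decreasing) (auto simp: less_imp_le)
  then have "CC * (contr ^ n * sg ^ (2 * n + 1)) \<le> CC * sg ^ (n + 1)"
    using CC_pos by (intro mult_left_mono) auto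
  with gtail_bound[of n] show ?thesis by linarith
qed

lemma race_upper: "m \<ge> k \<Longrightarrow> race 0 k m \<le> 2 * CC * sg ^ (m - k)"
proof (cases "m = k")
  case True
  then show ?thesis using race_le_1[of 0 k m] CC_ge_1 by simp
next
  case False
  assume "m \<ge> k"
  with False have mk: "m > k" by simp
  have "\<bar>race 0 k m - dgauss_cdf (int k - int m)\<bar> \<le> CC * sg ^ (m - k)"
    by (rule race_err) (use mk in auto)
  moreover have "dgauss_cdf (int k - int m) \<le> CC * sg ^ (m - k)"
  proof -
    have "nat (- 1 - (int k - int m)) = m - k - 1" using mk by linarith
    then have "dgauss_cdf (int k - int m) = gtail (m - k - 1) / gtot" using mk by (simp add: dgauss_cdf_def)
    also have "\<dots> \<le> CC * sg ^ (m - k - 1 + 1)" by (rule gtail_bound')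
    also have "m - k - 1 + 1 = m - k" using mk by simp
    finally show ?thesis .
  qed
  ultimately show ?thesis by linarith
qed

lemma race_lower: "m < k \<Longrightarrow> 1 - race 0 k (Suc m) \<le> 2 * CC * sg ^ (k - m)"
proof -
  assume mk: "m < k"
  have "\<bar>race 0 k (Suc m) - dgauss_cdf (int k - int (Suc m))\<bar> \<le> CC * sg ^ (k - m)"
    by (rule race_err) (use mk in auto)
  moreover have "1 - dgauss_cdf (int k - int (Suc m)) \<le> CC * sg ^ (k - m)"
  proof -
    have "nat (int k - int (Suc m)) = k - m - 1" using mk by linarith
    then have "1 - dgauss_cdf (int k - int (Suc m)) = gtail (k - m - 1) / gtot" using mk by (simp add: dgauss_cdf_def)
    also have "\<dots> \<le> CC * sg ^ (k - m - 1 + 1)" by (rule gtail_bound')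
    also have "k - m - 1 + 1 = k - m" using mk by simp
    finally show ?thesis .
  qed
  ultimately show ?thesis by linarith
qed

text \<open>Uniform in \<open>k\<close>, since the tails of the Gaussian and the error of the
  comparison are both geometric in the distance from \<open>k\<close>. All upper bounds on moments
  rest on this.\<close>

lemma kern_prob_le: "kern_prob k m \<le> 2 * CC * sg ^ ndist k m"
proof (cases "m < k")
  case True
  then show ?thesis using race_lower[OF True] race_le_1[of 0 k m] by (simp add: kern_prob_def ndist_def)
next
  case False
  then show ?thesis using race_upper[of k m] race_nonneg[of 0 k "Suc m"] by (auto simp: kern_prob_def ndist_def)
qed

lemma race_tendsto_0: "race 0 k \<longlonglongrightarrow> 0"
proof (rule tendsto_sandwich[of "\<lambda>_. 0" _ _ "\<lambda>m. 2 * CC * sg ^ (m - k)"])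
  show "\<forall>\<^sub>F m in sequentially. race 0 k m \<le> 2 * CC * sg ^ (m - k)"
    using eventually_ge_at_top[of k] by eventually_elim (rule race_upper)
  have "(\<lambda>m. sg ^ m) \<longlonglongrightarrow> 0" using sg by (intro LIMSEQ_realpow_zero) auto
  then have "(\<lambda>m. sg ^ (m + k - k)) \<longlonglongrightarrow> 0" by simp
  then have "(\<lambda>m. sg ^ (m - k)) \<longlonglongrightarrow> 0" by (rule LIMSEQ_offset)
  then show "(\<lambda>m. 2 * CC * sg ^ (m - k)) \<longlonglongrightarrow> 0" by (auto intro: tendsto_mult_right_zero)
qed (auto simp: race_nonneg)

lemma kern_prob_sums: "kern_prob k sums 1"
  using telescope_sums'[OF race_tendsto_0[of k]] by (simp add: kern_prob_def[abs_def])

definition kern :: "nat \<Rightarrow> nat pmf" where "kern k = embed_pmf (kern_prob k)"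

lemma pmf_kern: "pmf (kern k) m = kern_prob k m"
  unfolding kern_def
proof (rule pmf_embed_pmf)
  have "(\<integral>\<^sup>+m. ennreal (kern_prob k m) \<partial>count_space UNIV) = (\<Sum>m. ennreal (kern_prob k m))"
    by (rule nn_integral_count_space_nat)
  also have "\<dots> = ennreal 1" using kern_prob_sums[of k] kern_prob_nonneg by (intro suminf_ennreal_eq) auto
  finally show "(\<integral>\<^sup>+m. ennreal (kern_prob k m) \<partial>count_space UNIV) = 1" by simp
qed (rule kern_prob_nonneg)

lemma kern_0: "kern 0 = return_pmf 0"
proof (rule pmf_eqI)
  show "pmf (kern 0) m = pmf (return_pmf 0) m" for m
    unfolding pmf_kern kern_prob_def by (cases m) auto
qed

lemma kern_hits_0: "pmf (kern k) 0 > 0"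
proof -
  have "race 0 k (Suc 0) < 1"
  proof (induction k)
    case (Suc k)
    have "race 0 (Suc k) (Suc 0) = step_down (int k) * race 0 k (Suc 0) + step_up (int k)" by simp
    also have "\<dots> < step_down (int k) * 1 + step_up (int k)" using Suc step_down_pos by (intro add_strict_right_mono mult_strict_left_mono) auto
    finally show ?case by (simp add: step_down_step_up)
  qed simp
  then show ?thesis by (simp add: pmf_kern kern_prob_def)
qed

lemma kern_moment_nn:
  obtains C where "C > 0" "\<And>k. (\<integral>\<^sup>+m. ennreal (\<bar>real m - real k\<bar> ^ p) \<partial>kern k) \<le> ennreal C"
proof -
  define S where "S = (\<Sum>j. real j ^ p * sg ^ j)"
  have S: "summable (\<lambda>j. real j ^ p * sg ^ j)" using sg by (intro summable_pow_geo) auto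
  have "(\<integral>\<^sup>+m. ennreal (\<bar>real m - real k\<bar> ^ p) \<partial>kern k) \<le> ennreal (2 * CC * (2 * S) + 1)" for k
  proof -
    have "(\<integral>\<^sup>+m. ennreal (\<bar>real m - real k\<bar> ^ p) \<partial>kern k)
       = (\<Sum>m. ennreal (kern_prob k m) * ennreal (\<bar>real m - real k\<bar> ^ p))"
      by (simp add: nn_integral_measure_pmf nn_integral_count_space_nat pmf_kern)
    also have "\<dots> \<le> (\<Sum>m. ennreal (2 * CC) * ennreal (real (ndist k m) ^ p * sg ^ ndist k m))"
    proof (intro suminf_le allI)
      fix m
      have "kern_prob k m * \<bar>real m - real k\<bar> ^ p \<le> (2 * CC * sg ^ ndist k m) * real (ndist k m) ^ p"
        unfolding real_ndist by (intro mult_right_mono kern_prob_le) auto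
      then have "ennreal (kern_prob k m * \<bar>real m - real k\<bar> ^ p) \<le> ennreal (2 * CC * (real (ndist k m) ^ p * sg ^ ndist k m))"
        by (intro ennreal_leI) (simp add: mult_ac)
      then show "ennreal (kern_prob k m) * ennreal (\<bar>real m - real k\<bar> ^ p) \<le> ennreal (2 * CC) * ennreal (real (ndist k m) ^ p * sg ^ ndist k m)"
        using CC_pos kern_prob_nonneg sg by (simp add: ennreal_mult'[symmetric] ennreal_mult''[symmetric])
    qed auto
    also have "\<dots> = ennreal (2 * CC) * (\<Sum>m. ennreal (real (ndist k m) ^ p * sg ^ ndist k m))"
      by (rule ennreal_suminf_cmult)
    also have "\<dots> \<le> ennreal (2 * CC) * (2 * (\<Sum>j. ennreal (real j ^ p * sg ^ j)))"
      by (intro mult_left_mono suminf_ndist_le) auto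
    also have "(\<Sum>j. ennreal (real j ^ p * sg ^ j)) = ennreal S"
      unfolding S_def using sg S by (intro suminf_ennreal2) auto
    also have "ennreal (2 * CC) * (2 * ennreal S) = ennreal (2 * CC * (2 * S))"
    proof -
      have "S \<ge> 0" unfolding S_def using S sg by (intro suminf_nonneg) auto
      moreover have "(2 :: ennreal) = ennreal 2" by simp
      ultimately show ?thesis using CC_pos by (simp only: ennreal_mult[symmetric] mult_nonneg_nonneg zero_le_numeral less_imp_le)
    qed
    also have "\<dots> \<le> ennreal (2 * CC * (2 * S) + 1)" by (intro ennreal_leI) simp
    finally show ?thesis .
  qed
  moreover have "2 * CC * (2 * S) + 1 > 0"
  proof -
    have "S \<ge> 0" unfolding S_def using S sg by (intro suminf_nonneg) auto
    then show ?thesis using CC_pos by (simp add: add_nonneg_pos)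
  qed
  ultimately show ?thesis using that by blast
qed

lemma kern_integrable_pow: "integrable (kern k) (\<lambda>m. \<bar>real m - real k\<bar> ^ p)"
proof -
  obtain C where C: "\<And>k. (\<integral>\<^sup>+m. ennreal (\<bar>real m - real k\<bar> ^ p) \<partial>kern k) \<le> ennreal C"
    using kern_moment_nn by blast
  have "(\<integral>\<^sup>+m. ennreal (\<bar>real m - real k\<bar> ^ p) \<partial>kern k) \<le> ennreal C" by (rule C)
  also have "\<dots> < \<infinity>" by simp
  finally have "(\<integral>\<^sup>+m. ennreal (\<bar>real m - real k\<bar> ^ p) \<partial>kern k) < \<infinity>" .
  then show ?thesis by (intro integrableI_bounded) auto
qed

lemma kern_moment:
  obtains C where "C > 0" "\<And>k. measure_pmf.expectation (kern k) (\<lambda>m. \<bar>real m - real k\<bar> ^ p) \<le> C"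
proof -
  obtain C where C: "C > 0" "\<And>k. (\<integral>\<^sup>+m. ennreal (\<bar>real m - real k\<bar> ^ p) \<partial>kern k) \<le> ennreal C"
    using kern_moment_nn by blast
  have "measure_pmf.expectation (kern k) (\<lambda>m. \<bar>real m - real k\<bar> ^ p) \<le> C" for k
  proof -
    have "ennreal (measure_pmf.expectation (kern k) (\<lambda>m. \<bar>real m - real k\<bar> ^ p)) \<le> ennreal C"
      using C(2)[of k] by (subst nn_integral_eq_integral[symmetric, OF kern_integrable_pow]) auto
    then show ?thesis using C(1) by (simp add: ennreal_le_iff)
  qed
  then show ?thesis using that C by blast
qed

lemma kern_integrable: "integrable (kern k) (\<lambda>m. real m - real k)" "integrable (kern k) (\<lambda>m. (real m - real k) ^ 2)"
proof -
  show "integrable (kern k) (\<lambda>m. real m - real k)"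
    by (rule Bochner_Integration.integrable_bound[OF kern_integrable_pow[of k 1]]) auto
  show "integrable (kern k) (\<lambda>m. (real m - real k) ^ 2)"
    using kern_integrable_pow[of k 2] by simp
qed

lemma kern_prob_dgauss_mass: "\<bar>kern_prob k m - dgauss_mass (int k - int m)\<bar> \<le> 2 * CC * contr ^ k"
proof -
  have *: "\<bar>race 0 k i - dgauss_cdf (int k - int i)\<bar> \<le> CC * contr ^ k" for i
  proof -
    have "contr ^ (k + i) * barrier (int k - int i) \<le> contr ^ k * 1"
      using contr barrier_le[of 0 "int k - int i"] barrier_pos[of "int k - int i"]
      by (intro mult_mono power_decreasing) (auto simp: less_imp_le)
    then have "CC * (contr ^ (k + i) * barrier (int k - int i)) \<le> CC * contr ^ k"
      using CC_pos by (intro mult_left_mono) auto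
    with race_dgauss_cdf[of k i] show ?thesis by linarith
  qed
  have "kern_prob k m - dgauss_mass (int k - int m) =
     (race 0 k m - dgauss_cdf (int k - int m)) - (race 0 k (Suc m) - dgauss_cdf (int k - int (Suc m)))"
    unfolding kern_prob_def dgauss_cdf_diff[symmetric] by (simp add: algebra_simps)
  then show ?thesis using *[of m] *[of "Suc m"] by linarith
qed

text \<open>Over the window \<open>{..2*k}\<close>, which is symmetric about \<open>k\<close>, the
  first moment of the Gaussian vanishes exactly, and the error of the comparison is exponentially
  small in \<open>k\<close>. Beyond the window a deviation exceeds \<open>k\<close> and is bounded
  by its cube divided by \<open>k ^ 2\<close>.\<close>

lemma kern_drift:
  obtains C where "C > 0" "\<And>k. k \<ge> 1 \<Longrightarrow> \<bar>measure_pmf.expectation (kern k) (\<lambda>m. real m - real k)\<bar> \<le> C / real k ^ 2"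
proof -
  \<comment> \<open>Fourth power: the length of the window and the size of the deviation cost one
    factor \<open>k\<close> each, and the claim asks for two more.\<close>
  obtain D where D: "D > 0" "\<And>k. real k ^ 4 * contr ^ k \<le> D" using pow_geo_bounded[OF contr, of 4] by blast
  obtain E where E: "E > 0" "\<And>k. measure_pmf.expectation (kern k) (\<lambda>m. \<bar>real m - real k\<bar> ^ 3) \<le> E"
    using kern_moment by blast
  have "\<bar>measure_pmf.expectation (kern k) (\<lambda>m. real m - real k)\<bar> \<le> (6 * CC * D + E) / real k ^ 2" if k: "k \<ge> 1" for k
  proof -
    let ?f = "\<lambda>m::nat. real m - real k"
    let ?E = "measure_pmf.expectation (kern k)"
    have i1: "integrable (kern k) (\<lambda>m. ?f m * indicator {..2*k} m)"
      by (rule Bochner_Integration.integrable_bound[OF kern_integrable(1)[of k]]) (auto simp: indicator_def)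
    have i2: "integrable (kern k) (\<lambda>m. ?f m * indicator {2*k<..} m)"
      by (rule Bochner_Integration.integrable_bound[OF kern_integrable(1)[of k]]) (auto simp: indicator_def)
    have "?E ?f = ?E (\<lambda>m. ?f m * indicator {..2*k} m + ?f m * indicator {2*k<..} m)"
      by (intro Bochner_Integration.integral_cong) (auto simp: indicator_def)
    also have "\<dots> = ?E (\<lambda>m. ?f m * indicator {..2*k} m) + ?E (\<lambda>m. ?f m * indicator {2*k<..} m)"
      using i1 i2 by (rule Bochner_Integration.integral_add)
    finally have split: "?E ?f = \<dots>" .
    have tail: "\<bar>?E (\<lambda>m. ?f m * indicator {2*k<..} m)\<bar> \<le> E / real k ^ 2"
    proof -
      have "\<bar>?E (\<lambda>m. ?f m * indicator {2*k<..} m)\<bar> \<le> ?E (\<lambda>m. \<bar>?f m * indicator {2*k<..} m\<bar>)"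
        by (rule integral_abs_bound)
      also have "\<dots> \<le> ?E (\<lambda>m. \<bar>?f m\<bar> ^ 3 / real k ^ 2)"
      proof (rule integral_mono)
        show "integrable (kern k) (\<lambda>m. \<bar>?f m * indicator {2*k<..} m\<bar>)" using i2 by (rule integrable_abs)
        show "integrable (kern k) (\<lambda>m. \<bar>?f m\<bar> ^ 3 / real k ^ 2)" by (intro integrable_divide kern_integrable_pow)
        show "\<bar>?f m * indicator {2*k<..} m\<bar> \<le> \<bar>?f m\<bar> ^ 3 / real k ^ 2" for m
        proof (cases "2 * k < m")
          case True
          then have "real k \<le> ?f m" by linarith
          then have "real k ^ 2 \<le> ?f m ^ 2" by (intro power_mono) auto
          then have "?f m * real k ^ 2 \<le> ?f m * ?f m ^ 2" using True by (intro mult_left_mono) auto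
          then show ?thesis using True k by (simp add: le_divide_eq power3_eq_cube power2_eq_square)
        qed simp
      qed
      also have "\<dots> \<le> E / real k ^ 2" using E(2)[of k] by (simp add: divide_right_mono)
      finally show ?thesis .
    qed
    have mid: "\<bar>?E (\<lambda>m. ?f m * indicator {..2*k} m)\<bar> \<le> 6 * CC * D / real k ^ 2"
    proof -
      have "?E (\<lambda>m. ?f m * indicator {..2*k} m) = (\<Sum>m\<le>2*k. ?f m * indicator {..2*k} m * pmf (kern k) m)"
        by (rule integral_measure_pmf_real) (auto simp: indicator_def split: if_splits)
      also have "\<dots> = (\<Sum>m\<le>2*k. ?f m * kern_prob k m)" by (intro sum.cong) (auto simp: pmf_kern)
      also have "\<dots> = (\<Sum>m\<le>2*k. ?f m * (kern_prob k m - dgauss_mass (int k - int m))) + (\<Sum>m\<le>2*k. ?f m * dgauss_mass (int k - int m))"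
        by (simp add: algebra_simps flip: sum.distrib)
      also have "(\<Sum>m\<le>2*k. ?f m * dgauss_mass (int k - int m)) = 0"
      proof -
        let ?S = "\<Sum>m\<le>2*k. ?f m * dgauss_mass (int k - int m)"
        have "?S = (\<Sum>m\<le>2*k. - (?f m * dgauss_mass (int k - int m)))"
        proof (rule sum.reindex_bij_witness[where i="\<lambda>m. 2*k - m" and j="\<lambda>m. 2*k - m"])
          fix m assume m: "m \<in> {..2*k}"
          then have "int k - int (2 * k - m) = - (int k - int m)" "?f (2 * k - m) = - ?f m" by auto
          then show "- (?f (2 * k - m) * dgauss_mass (int k - int (2 * k - m))) = ?f m * dgauss_mass (int k - int m)"
            by (simp add: dgauss_mass_def power2_commute algebra_simps diff_divide_distrib)
        qed auto
        then have "?S = - ?S" by (simp add: sum_negf)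
        then show ?thesis by linarith
      qed
      finally have "\<bar>?E (\<lambda>m. ?f m * indicator {..2*k} m)\<bar> = \<bar>\<Sum>m\<le>2*k. ?f m * (kern_prob k m - dgauss_mass (int k - int m))\<bar>" by simp
      also have "\<dots> \<le> (\<Sum>m\<le>2*k. real k * (2 * CC * contr ^ k))"
      proof (intro order_trans[OF sum_abs] sum_mono)
        fix m assume "m \<in> {..2*k}"
        then have "\<bar>?f m\<bar> \<le> real k" by auto
        then show "\<bar>?f m * (kern_prob k m - dgauss_mass (int k - int m))\<bar> \<le> real k * (2 * CC * contr ^ k)"
          unfolding abs_mult using kern_prob_dgauss_mass by (intro mult_mono) auto
      qed
      also have "\<dots> = real (2 * k + 1) * (real k * (2 * CC * contr ^ k))" by simp
      also have "\<dots> \<le> (3 * real k) * (real k * (2 * CC * contr ^ k))"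
        using k CC_pos contr by (intro mult_right_mono) auto
      also have "\<dots> = 6 * CC * (real k ^ 4 * contr ^ k) / real k ^ 2" using k
        by (simp add: power2_eq_square power4_eq_xxxx)
      also have "\<dots> \<le> 6 * CC * D / real k ^ 2"
        using D(2)[of k] CC_pos by (intro divide_right_mono mult_left_mono) auto
      finally show ?thesis .
    qed
    show ?thesis unfolding split using tail mid by (simp add: add_divide_distrib)
  qed
  moreover have "6 * CC * D + E > 0" using CC_pos D E by (simp add: add_pos_pos)
  ultimately show ?thesis using that by blast
qed

text \<open>The variance is at least the probability of moving at all, which tends to
  \<open>1 - dgauss_mass 0 > 0\<close>; half of this limit is kept.\<close>

lemma kern_variance:
  obtains \<sigma> k0 where "\<sigma> > 0" "\<And>k. k \<ge> k0 \<Longrightarrow> measure_pmf.expectation (kern k) (\<lambda>m. (real m - real k) ^ 2) \<ge> \<sigma>"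
proof -
  have "gtail 0 > 0" using gtail_Suc[of 0] gtail_nonneg[of 1] gauss_pos[of 1] by simp
  then have g: "dgauss_mass 0 < 1" unfolding dgauss_mass_def gtot_def by (simp add: field_simps)
  define \<sigma> where "\<sigma> = (1 - dgauss_mass 0) / 2"
  have s: "\<sigma> > 0" using g by (simp add: \<sigma>_def)
  have "(\<lambda>k. 2 * CC * contr ^ k) \<longlonglongrightarrow> 2 * CC * 0"
    using contr by (intro tendsto_mult_left LIMSEQ_realpow_zero) auto
  then have "\<forall>\<^sub>F k in sequentially. 2 * CC * contr ^ k < \<sigma>" using s by (intro order_tendstoD) auto
  then obtain k0 where k0: "\<And>k. k \<ge> k0 \<Longrightarrow> 2 * CC * contr ^ k < \<sigma>" by (auto simp: eventually_sequentially)
  have "measure_pmf.expectation (kern k) (\<lambda>m. (real m - real k) ^ 2) \<ge> \<sigma>" if "k \<ge> k0" for k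
  proof -
    have "kern_prob k k \<le> dgauss_mass 0 + 2 * CC * contr ^ k" using kern_prob_dgauss_mass[of k k] by simp
    also have "\<dots> \<le> 1 - \<sigma>" using k0[OF that] by (simp add: \<sigma>_def field_simps)
    finally have p: "measure_pmf.prob (kern k) {k} \<le> 1 - \<sigma>" by (simp add: pmf_kern measure_pmf_single)
    have "\<sigma> \<le> 1 - measure_pmf.prob (kern k) {k}" using p by simp
    also have "\<dots> = measure_pmf.prob (kern k) (- {k})" using measure_pmf.prob_compl[of "{k}" "kern k"] by (simp add: Compl_eq_Diff_UNIV)
    also have "\<dots> = measure_pmf.expectation (kern k) (indicator (- {k}))" by simp
    also have "\<dots> \<le> measure_pmf.expectation (kern k) (\<lambda>m. (real m - real k) ^ 2)"
    proof (rule integral_mono)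
      show "indicator (- {k}) m \<le> (real m - real k) ^ 2" for m
      proof (cases "m = k")
        case False
        then have "1 \<le> \<bar>real m - real k\<bar>" by linarith
        then have "1 ^ 2 \<le> \<bar>real m - real k\<bar> ^ 2" by (intro power_mono) auto
        then show ?thesis using False by simp
      qed simp
    qed (auto intro: kern_integrable measure_pmf.integrable_const_bound[where B=1])
    finally show ?thesis .
  qed
  then show ?thesis using that s by blast
qed

end

text \<open>Discrete form of the differential inequality
  \<open>u' \<le> - c * u powr (1 + \<kappa>)\<close>: each step raises
  \<open>u powr (- \<kappa>)\<close> by at least \<open>c * \<kappa>\<close>, because \<open>(1 - t)
  powr (- \<kappa>) \<ge> exp (\<kappa> * t) \<ge> 1 + \<kappa> * t\<close>.\<close>

lemma decay_rate:
  fixes u :: "nat \<Rightarrow> real"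
  assumes u: "\<And>n. u n \<ge> 0" and c: "c > 0" and \<kappa>: "\<kappa> > 0"
    and step: "\<And>n. u (Suc n) \<le> u n - c * u n * u n powr \<kappa>"
    and n: "n \<ge> 1"
  shows "u n \<le> (c * \<kappa> * real n) powr (- 1 / \<kappa>)"
proof (cases "u n = 0")
  case False
  have le: "u (Suc n) \<le> u n" for n
    using step[of n] u[of n] c by (smt (verit) mult_nonneg_nonneg powr_ge_zero)
  have inv: "u n powr (- \<kappa>) \<ge> c * \<kappa> * real n" if "u n > 0" for n
    using that
  proof (induction n)
    case (Suc n)
    have pos: "u n > 0" using Suc.prems le[of n] by linarith
    let ?t = "c * u n powr \<kappa>"
    have b: "u (Suc n) \<le> u n * (1 - ?t)" using step[of n] by (simp add: algebra_simps)
    then have t1: "?t < 1" using Suc.prems pos by (smt (verit) mult_nonneg_nonpos)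
    have t0: "?t > 0" using pos c by simp
    have "c * \<kappa> * real (Suc n) \<le> u n powr (- \<kappa>) + \<kappa> * c" using Suc.IH[OF pos] by (simp add: algebra_simps)
    also have "\<dots> = u n powr (- \<kappa>) * (1 + \<kappa> * ?t)"
    proof -
      have "u n powr (- \<kappa>) * u n powr \<kappa> = 1" using pos by (simp flip: powr_add)
      then show ?thesis by (simp add: algebra_simps)
    qed
    also have "\<dots> \<le> u n powr (- \<kappa>) * (1 - ?t) powr (- \<kappa>)"
    proof (intro mult_left_mono)
      have "ln (1 - ?t) \<le> - ?t" using ln_le_minus_one[of "1 - ?t"] t1 by simp
      then have "\<kappa> * ?t \<le> \<kappa> * (- ln (1 - ?t))" using \<kappa> by (intro mult_left_mono) auto
      then have "- \<kappa> * ln (1 - ?t) \<ge> \<kappa> * ?t" by simp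
      then have "exp (\<kappa> * ?t) \<le> exp (- \<kappa> * ln (1 - ?t))" by simp
      moreover have "(1 - ?t) powr (- \<kappa>) = exp (- \<kappa> * ln (1 - ?t))" using t1 by (subst powr_def) simp
      ultimately show "1 + \<kappa> * ?t \<le> (1 - ?t) powr (- \<kappa>)"
        using exp_ge_add_one_self[of "\<kappa> * ?t"] by linarith
    qed simp
    also have "\<dots> = (u n * (1 - ?t)) powr (- \<kappa>)" using pos t1 by (simp add: powr_mult)
    also have "\<dots> \<le> u (Suc n) powr (- \<kappa>)"
      using b Suc.prems \<kappa> by (intro powr_mono2') auto
    finally show ?case .
  qed simp
  have pos: "u n > 0" using False u[of n] by simp
  have "u n = (u n powr (- \<kappa>)) powr (- 1 / \<kappa>)" using pos \<kappa> by (simp add: powr_powr)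
  also have "\<dots> \<le> (c * \<kappa> * real n) powr (- 1 / \<kappa>)"
    using inv[OF pos] c \<kappa> n by (intro powr_mono2') auto
  finally show ?thesis .
qed simp

lemma powr_nat_le: "0 < a \<Longrightarrow> a < 1 \<Longrightarrow> real m powr a \<le> real m"
proof (cases "m = 0")
  case False
  assume "0 < a" "a < 1"
  then have "real m powr a \<le> real m powr 1" using False by (intro powr_mono) auto
  then show ?thesis using False by simp
qed simp

lemma powr_nonpos_le_1: "k \<ge> 1 \<Longrightarrow> b \<le> 0 \<Longrightarrow> (k::real) powr b \<le> 1"
  using powr_mono[of b 0 k] by simp

section \<open>A Lyapunov function and the survival of the chain\<close>

context repulsion
begin

text \<open>For large \<open>k\<close> the concavity of the power turns the variance into a negative
  drift. For small \<open>k\<close> Taylor expansion says nothing; there the jump by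
  \<open>A\<close> at 0 provides the decrease, since 0 is reached with positive probability.\<close>

definition lyap :: "real \<Rightarrow> real \<Rightarrow> nat \<Rightarrow> real" where
  "lyap a A k = (if k = 0 then 0 else real k powr a + A)"

lemma lyap_0 [simp]: "lyap a A 0 = 0" by (simp add: lyap_def)

text \<open>On the natural numbers the power is Lipschitz with constant 1, and the jump by
  \<open>A\<close> is spread over a distance of at least 1.\<close>

lemma lyap_lipschitz:
  assumes a: "0 < a" "a < 1" and A: "A \<ge> 0"
  shows "\<bar>lyap a A m - lyap a A k\<bar> \<le> (1 + A) * \<bar>real m - real k\<bar>"
proof -
  have main: "lyap a A m \<le> lyap a A k \<and> lyap a A k - lyap a A m \<le> (1 + A) * (real k - real m)" if "m < k" for m k
  proof (cases "m = 0")
    case True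
    have "A * 1 \<le> A * real k" using that A by (intro mult_left_mono) auto
    then have "real k powr a + A \<le> real k + A * real k" using powr_nat_le[OF a, of k] by linarith
    then show ?thesis using True that A by (simp add: lyap_def algebra_simps)
  next
    case False
    have "real k powr a = real m powr a * (real k / real m) powr a"
      using False that by (simp flip: powr_mult)
    also have "\<dots> \<le> real m powr a * (real k / real m)"
    proof (intro mult_left_mono)
      have "(real k / real m) powr a \<le> (real k / real m) powr 1" using False that a by (intro powr_mono) auto
      then show "(real k / real m) powr a \<le> real k / real m" using False that by simp
    qed simp
    also have "\<dots> = real m powr a + real m powr a / real m * (real k - real m)"
      using False by (simp add: field_simps)
    also have "\<dots> \<le> real m powr a + 1 * (real k - real m)"
      using False that powr_nat_le[OF a, of m] by (intro add_left_mono mult_right_mono) (auto simp: divide_le_eq)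
    finally have 1: "real k powr a - real m powr a \<le> real k - real m" by simp
    have 2: "real m powr a \<le> real k powr a" using that a by (intro powr_mono2) auto
    have "0 \<le> A * (real k - real m)" using A that by simp
    then show ?thesis using False that 1 2 A by (simp add: lyap_def algebra_simps)
  qed
  consider "m < k" | "m = k" | "k < m" by linarith
  then show ?thesis
  proof cases
    case 1 then show ?thesis using main[of m k] by auto
  next
    case 3 then show ?thesis using main[of k m] by auto
  qed simp
qed

lemma integrable_lipschitz:
  assumes "\<And>m. \<bar>f m - f k\<bar> \<le> L * \<bar>real m - real k\<bar>"
  shows "integrable (kern k) f" "integrable (kern k) (\<lambda>m. (f m - f k) ^ 2)"
proof -
  have "integrable (kern k) (\<lambda>m. f m - f k)"
    by (rule Bochner_Integration.integrable_bound[OF integrable_mult_right[OF kern_integrable_pow[of k 1], of L]])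
       (use assms in \<open>auto intro!: AE_I2 order_trans[OF assms]\<close>)
  then have "integrable (kern k) (\<lambda>m. (f m - f k) + f k)"
    by (intro Bochner_Integration.integrable_add measure_pmf.integrable_const)
  then show "integrable (kern k) f" by simp
  show "integrable (kern k) (\<lambda>m. (f m - f k) ^ 2)"
  proof (rule Bochner_Integration.integrable_bound[OF integrable_mult_right[OF kern_integrable_pow[of k 2], of "L ^ 2"]])
    have "(f m - f k) ^ 2 \<le> L ^ 2 * \<bar>real m - real k\<bar> ^ 2" for m
      using power_mono[OF assms, of m 2] by (simp add: power_mult_distrib)
    then show "AE m in kern k. norm ((f m - f k) ^ 2) \<le> norm (L ^ 2 * \<bar>real m - real k\<bar> ^ 2)" by auto
  qed auto
qed

lemma lyap_integrable: "0 < a \<Longrightarrow> a < 1 \<Longrightarrow> A \<ge> 0 \<Longrightarrow> integrable (kern k) (lyap a A)"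
  by (rule integrable_lipschitz[where L="1 + A"]) (rule lyap_lipschitz)

lemma lyap_drift:
  assumes a: "0 < a" "a < 1"
  obtains A c where "A \<ge> 0" "c > 0"
    "\<And>k. k \<ge> 1 \<Longrightarrow> measure_pmf.expectation (kern k) (lyap a A) \<le> lyap a A k - c * real k powr (a - 2)"
proof -
  obtain C1 where C1: "C1 > 0" "\<And>k. k \<ge> 1 \<Longrightarrow> \<bar>measure_pmf.expectation (kern k) (\<lambda>m. real m - real k)\<bar> \<le> C1 / real k ^ 2"
    using kern_drift by blast
  obtain M1 where M1: "M1 > 0" "\<And>k. measure_pmf.expectation (kern k) (\<lambda>m. \<bar>real m - real k\<bar> ^ 1) \<le> M1"
    using kern_moment by blast
  obtain M3 where M3: "M3 > 0" "\<And>k. measure_pmf.expectation (kern k) (\<lambda>m. \<bar>real m - real k\<bar> ^ 3) \<le> M3"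
    using kern_moment by blast
  obtain \<sigma> k0 where \<sigma>: "\<sigma> > 0" "\<And>k. k \<ge> k0 \<Longrightarrow> measure_pmf.expectation (kern k) (\<lambda>m. (real m - real k) ^ 2) \<ge> \<sigma>"
    using kern_variance by blast
  \<comment> \<open>The quadratic Taylor term yields a decrease of
    \<open>2 * c * real k powr (a - 2)\<close>. One half of it is given up to absorb the drift and
    the third moment as soon as \<open>k\<close> is at least \<open>(C1 + M3) / c\<close>.\<close>
  define c where "c = a * (1 - a) * \<sigma> / 4"
  have c: "c > 0" using a \<sigma> by (simp add: c_def)
  define k1 where "k1 = Suc (max k0 (nat \<lceil>(C1 + M3) / c\<rceil>))"
  let ?E = "\<lambda>k. measure_pmf.expectation (kern k)"
  have ip: "integrable (kern k) (\<lambda>m. real m powr a)" for k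
  proof -
    have "(\<lambda>m. real m powr a) = lyap a 0" by (auto simp: lyap_def)
    then show ?thesis using lyap_integrable[OF a, of 0] by simp
  qed
  have large: "?E k (\<lambda>m. real m powr a) \<le> real k powr a - c * real k powr (a - 2)" if k: "k \<ge> k1" for k
  proof -
    have k': "k \<ge> 1" "k \<ge> k0" "(C1 + M3) / c \<le> real k" using k by (auto simp: k1_def) linarith
    let ?k = "real k"
    have "?E k (\<lambda>m. real m powr a) \<le> ?E k (\<lambda>m. ?k powr a + a * ?k powr (a - 1) * (real m - ?k)
        - a * (1 - a) / 2 * ?k powr (a - 2) * (real m - ?k) ^ 2 + ?k powr (a - 3) * \<bar>real m - ?k\<bar> ^ 3)"
      using k' a by (intro integral_mono ip powr_cubic_bound Bochner_Integration.integrable_add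
          Bochner_Integration.integrable_diff integrable_mult_right kern_integrable kern_integrable_pow measure_pmf.integrable_const) auto
    also have "\<dots> = ?k powr a + a * ?k powr (a - 1) * ?E k (\<lambda>m. real m - ?k)
        - a * (1 - a) / 2 * ?k powr (a - 2) * ?E k (\<lambda>m. (real m - ?k) ^ 2) + ?k powr (a - 3) * ?E k (\<lambda>m. \<bar>real m - ?k\<bar> ^ 3)"
      by (subst Bochner_Integration.integral_add Bochner_Integration.integral_diff,
          (intro Bochner_Integration.integrable_add
          Bochner_Integration.integrable_diff integrable_mult_right kern_integrable kern_integrable_pow measure_pmf.integrable_const)+)+ simp
    also have "\<dots> \<le> ?k powr a + ?k powr (a - 1) * (C1 / ?k ^ 2) - a * (1 - a) / 2 * ?k powr (a - 2) * \<sigma> + ?k powr (a - 3) * M3"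
    proof (intro add_mono diff_mono order_refl mult_left_mono)
      have "a * ?k powr (a - 1) * ?E k (\<lambda>m. real m - ?k) \<le> \<bar>a * ?k powr (a - 1)\<bar> * \<bar>?E k (\<lambda>m. real m - ?k)\<bar>"
        by (metis abs_ge_self abs_mult)
      also have "\<dots> \<le> ?k powr (a - 1) * (C1 / ?k ^ 2)"
      proof (intro mult_mono)
        show "\<bar>a * ?k powr (a - 1)\<bar> \<le> ?k powr (a - 1)" using a by (simp add: abs_mult mult_left_le_one_le)
      qed (use C1 k' in auto)
      finally show "a * ?k powr (a - 1) * ?E k (\<lambda>m. real m - ?k) \<le> ?k powr (a - 1) * (C1 / ?k ^ 2)" .
    qed (use \<sigma>(2)[OF k'(2)] M3 a in auto)
    also have "\<dots> = ?k powr a + ?k powr (a - 2) * ((C1 + M3) / ?k - 2 * c)"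
    proof -
      have 1: "?k powr (a - 1) * (C1 / ?k ^ 2) = ?k powr (a - 2) * (C1 / ?k)"
        using k' by (simp add: powr_diff powr_numeral power2_eq_square)
      have 2: "?k powr (a - 3) = ?k powr (a - 2) / ?k"
        using k' by (simp add: powr_diff powr_numeral power2_eq_square power3_eq_cube)
      show ?thesis unfolding 1 2 c_def by (simp add: algebra_simps add_divide_distrib diff_divide_distrib)
    qed
    also have "\<dots> \<le> ?k powr a + ?k powr (a - 2) * (- c)"
    proof -
      have "(C1 + M3) / ?k \<le> c" using k' c by (simp add: field_simps)
      then show ?thesis by (intro add_left_mono mult_left_mono) auto
    qed
    finally show ?thesis by (simp add: algebra_simps)
  qed
  define p0 where "p0 = Min ((\<lambda>k. pmf (kern k) 0) ` {0..k1})"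
  have p0: "p0 > 0" "\<And>k. k \<le> k1 \<Longrightarrow> p0 \<le> pmf (kern k) 0"
  proof -
    show "p0 > 0" unfolding p0_def using kern_hits_0 by (subst Min_gr_iff) auto
    show "p0 \<le> pmf (kern k) 0" if "k \<le> k1" for k unfolding p0_def using that by (intro Min_le) auto
  qed
  \<comment> \<open>Below \<open>k1\<close> the mean of the power is at most
    \<open>real k1 + M1\<close>, whereas absorption removes \<open>A\<close> with probability at
    least \<open>p0\<close>. This \<open>A\<close> leaves a decrease of at least \<open>c\<close>,
    and \<open>real k powr (a - 2) \<le> 1\<close>.\<close>
  define A where "A = (real k1 + M1 + c) / p0"
  have A: "A \<ge> 0" using M1 c p0 by (simp add: A_def)
  have "?E k (lyap a A) \<le> lyap a A k - c * real k powr (a - 2)" if k: "k \<ge> 1" for k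
  proof -
    have "?E k (lyap a A) = ?E k (\<lambda>m. real m powr a + A * indicator (- {0}) m)"
      by (intro Bochner_Integration.integral_cong) (auto simp: lyap_def)
    also have "\<dots> = ?E k (\<lambda>m. real m powr a) + A * measure_pmf.prob (kern k) (- {0})"
    proof (subst Bochner_Integration.integral_add)
      show "integrable (kern k) (\<lambda>m. A * indicator (- {0}) m :: real)"
        by (intro integrable_mult_right measure_pmf.integrable_const_bound[where B=1]) (auto simp: indicator_def)
    qed (use ip in simp_all)
    also have "measure_pmf.prob (kern k) (- {0}) = 1 - pmf (kern k) 0"
      using measure_pmf.prob_compl[of "{0}" "kern k"] by (simp add: Compl_eq_Diff_UNIV measure_pmf_single)
    finally have e: "?E k (lyap a A) = ?E k (\<lambda>m. real m powr a) + A * (1 - pmf (kern k) 0)" .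
    show ?thesis
    proof (cases "k \<ge> k1")
      case True
      have "A * (1 - pmf (kern k) 0) \<le> A" using A pmf_nonneg[of "kern k" 0] by (simp add: algebra_simps)
      then show ?thesis using e large[OF True] k by (simp add: lyap_def)
    next
      case False
      have "?E k (\<lambda>m. real m powr a) \<le> ?E k (\<lambda>m. real k + \<bar>real m - real k\<bar> ^ 1)"
      proof (intro integral_mono ip Bochner_Integration.integrable_add kern_integrable_pow measure_pmf.integrable_const)
        show "real m powr a \<le> real k + \<bar>real m - real k\<bar> ^ 1" for m using powr_nat_le[OF a, of m] by simp
      qed
      also have "\<dots> = real k + ?E k (\<lambda>m. \<bar>real m - real k\<bar> ^ 1)"
        by (subst Bochner_Integration.integral_add) (auto intro: kern_integrable_pow[of k 1, simplified])
      also have "\<dots> \<le> real k1 + M1" using M1(2)[of k] False by simp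
      finally have 1: "?E k (\<lambda>m. real m powr a) \<le> real k1 + M1" .
      have "A * p0 \<le> A * pmf (kern k) 0" using A p0(2)[of k] False by (intro mult_left_mono) auto
      moreover have "A * p0 = real k1 + M1 + c" using p0(1) by (simp add: A_def)
      ultimately have 2: "A * (1 - pmf (kern k) 0) \<le> A - (real k1 + M1 + c)" by (simp add: right_diff_distrib)
      have 3: "c * real k powr (a - 2) \<le> c * 1"
      proof (intro mult_left_mono)
        show "real k powr (a - 2) \<le> 1" using k a by (intro powr_nonpos_le_1) auto
      qed (use c in auto)
      have "real k powr a \<ge> 0" "lyap a A k = real k powr a + A" using k by (auto simp: lyap_def)
      then show ?thesis using e 1 2 3 by linarith
    qed
  qed
  then show ?thesis using that A c by blast
qed

primrec chain :: "nat \<Rightarrow> nat \<Rightarrow> nat pmf" where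
  "chain k 0 = return_pmf k"
| "chain k (Suc n) = bind_pmf (chain k n) kern"

lemma kern_nn_integral: "integrable (kern k) f \<Longrightarrow> (\<And>m. f m \<ge> 0) \<Longrightarrow>
    (\<integral>\<^sup>+m. ennreal (f m) \<partial>kern k) = ennreal (measure_pmf.expectation (kern k) f)"
  by (rule nn_integral_eq_integral) auto

lemma lyap_nonneg: "A \<ge> 0 \<Longrightarrow> lyap a A k \<ge> 0" by (simp add: lyap_def)

text \<open>The negative drift of \<open>lyap\<close> absorbs the \<open>O(1/k^2)\<close> drift of the identity.\<close>

lemma harmonic_bounds:
  assumes a: "0 < a" "a < 1"
  obtains A c B where "A \<ge> 0" "c > 0" "B \<ge> 0"
    "\<And>k. k \<ge> 1 \<Longrightarrow> (\<integral>\<^sup>+m. ennreal (lyap a A m) \<partial>kern k) + ennreal (c * real k powr (a - 2)) \<le> ennreal (lyap a A k)"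
    "\<And>k. (\<integral>\<^sup>+m. ennreal (real m + B * lyap a A m) \<partial>kern k) \<le> ennreal (real k + B * lyap a A k)"
    "\<And>k. ennreal (real k - B * lyap a A k) \<le> (\<integral>\<^sup>+m. ennreal (real m - B * lyap a A m) \<partial>kern k)"
proof -
  obtain A c where A: "A \<ge> 0" and c: "c > 0" and drift:
    "\<And>k. k \<ge> 1 \<Longrightarrow> measure_pmf.expectation (kern k) (lyap a A) \<le> lyap a A k - c * real k powr (a - 2)"
    using lyap_drift[OF a] by blast
  obtain C1 where C1: "C1 > 0" "\<And>k. k \<ge> 1 \<Longrightarrow> \<bar>measure_pmf.expectation (kern k) (\<lambda>m. real m - real k)\<bar> \<le> C1 / real k ^ 2"
    using kern_drift by blast
  \<comment> \<open>The drift is at most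
    \<open>C1 / real k ^ 2 \<le> C1 * real k powr (a - 2)\<close>, which is \<open>B\<close> times
    the guaranteed decrease of \<open>lyap\<close>.\<close>
  define B where "B = C1 / c"
  have B: "B \<ge> 0" using C1 c by (simp add: B_def)
  let ?E = "\<lambda>k. measure_pmf.expectation (kern k)"
  have il: "integrable (kern k) (lyap a A)" for k by (rule lyap_integrable[OF a A])
  have ireal: "integrable (kern k) real" for k
    by (rule integrable_lipschitz(1)[where L=1]) auto
  have mean: "?E k real = real k + ?E k (\<lambda>m. real m - real k)" for k
    by (subst Bochner_Integration.integral_diff[OF ireal]) auto
  have bound: "\<bar>?E k (\<lambda>m. real m - real k)\<bar> \<le> B * (c * real k powr (a - 2))" if "k \<ge> 1" for k
  proof -
    have "\<bar>?E k (\<lambda>m. real m - real k)\<bar> \<le> C1 / real k ^ 2" by (rule C1(2)[OF that])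
    also have "\<dots> = C1 * real k powr (- 2)" using that by (simp add: powr_minus powr_numeral divide_simps)
    also have "\<dots> \<le> C1 * real k powr (a - 2)" using that a C1 by (intro mult_left_mono powr_mono) auto
    finally show ?thesis using c by (simp add: B_def)
  qed
  have 1: "(\<integral>\<^sup>+m. ennreal (lyap a A m) \<partial>kern k) + ennreal (c * real k powr (a - 2)) \<le> ennreal (lyap a A k)" if "k \<ge> 1" for k
  proof -
    have "(\<integral>\<^sup>+m. ennreal (lyap a A m) \<partial>kern k) + ennreal (c * real k powr (a - 2)) = ennreal (?E k (lyap a A) + c * real k powr (a - 2))"
      using kern_nn_integral[OF il[of k]] lyap_nonneg[OF A] c
      by (simp add: ennreal_plus[symmetric] Bochner_Integration.integral_nonneg del: ennreal_plus)
    also have "\<dots> \<le> ennreal (lyap a A k)" using drift[OF that] by (intro ennreal_leI) simp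
    finally show ?thesis .
  qed
  have 2: "(\<integral>\<^sup>+m. ennreal (real m + B * lyap a A m) \<partial>kern k) \<le> ennreal (real k + B * lyap a A k)" for k
  proof (cases "k = 0")
    case True
    then show ?thesis by (simp add: kern_0)
  next
    case False
    have "(\<integral>\<^sup>+m. ennreal (real m + B * lyap a A m) \<partial>kern k) = ennreal (?E k (\<lambda>m. real m + B * lyap a A m))"
      using lyap_nonneg[OF A] B by (intro kern_nn_integral Bochner_Integration.integrable_add ireal integrable_mult_right il) auto
    also have "?E k (\<lambda>m. real m + B * lyap a A m) = ?E k real + B * ?E k (lyap a A)"
      using ireal il by (subst Bochner_Integration.integral_add) auto
    also have "ennreal \<dots> \<le> ennreal (real k + B * lyap a A k)"
    proof (intro ennreal_leI)
      have "B * ?E k (lyap a A) \<le> B * (lyap a A k - c * real k powr (a - 2))"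
        using drift[of k] False B by (intro mult_left_mono) auto
      then show "?E k real + B * ?E k (lyap a A) \<le> real k + B * lyap a A k"
        using bound[of k] False mean[of k] by (simp add: algebra_simps)
    qed
    finally show ?thesis .
  qed
  have 3: "ennreal (real k - B * lyap a A k) \<le> (\<integral>\<^sup>+m. ennreal (real m - B * lyap a A m) \<partial>kern k)" for k
  proof (cases "k = 0")
    case False
    have i: "integrable (kern k) (\<lambda>m. real m - B * lyap a A m)"
      by (intro Bochner_Integration.integrable_diff ireal integrable_mult_right il)
    have "real k - B * lyap a A k \<le> ?E k real - B * ?E k (lyap a A)"
    proof -
      have "B * ?E k (lyap a A) \<le> B * (lyap a A k - c * real k powr (a - 2))"
        using drift[of k] False B by (intro mult_left_mono) auto
      then show ?thesis
        using bound[of k] False mean[of k] by (simp add: algebra_simps)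
    qed
    also have "\<dots> = ?E k (\<lambda>m. real m - B * lyap a A m)"
      using ireal il by (subst Bochner_Integration.integral_diff) auto
    \<comment> \<open>\<open>ennreal\<close> sends negative numbers to 0, so the claim is about the
      positive part, whose mean is no smaller.\<close>
    also have "\<dots> \<le> ?E k (\<lambda>m. max 0 (real m - B * lyap a A m))"
      by (intro integral_mono integrable_max i) auto
    finally have "ennreal (real k - B * lyap a A k) \<le> ennreal (?E k (\<lambda>m. max 0 (real m - B * lyap a A m)))"
      by (rule ennreal_leI)
    also have "\<dots> = (\<integral>\<^sup>+m. ennreal (max 0 (real m - B * lyap a A m)) \<partial>kern k)"
      by (intro kern_nn_integral[symmetric] integrable_max i) auto
    also have "\<dots> = (\<integral>\<^sup>+m. ennreal (real m - B * lyap a A m) \<partial>kern k)"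
      by (intro nn_integral_cong) (auto simp: max_def ennreal_neg)
    finally show ?thesis .
  qed (simp add: kern_0)
  show ?thesis using that[OF A c B 1 2 3] .
qed

text \<open>Expand the square around \<open>f k\<close>: the cross term
  \<open>2 * f k * (f m - f k)\<close> has nonpositive mean by \<open>super\<close>, and what
  remains is at most \<open>L ^ 2\<close> times a bounded second moment. The factor
  \<open>of_bool (k \<ge> 1)\<close> records that 0 is absorbing; it ties the growth of the second
  moment to the survival probability.\<close>

lemma second_moment_step:
  assumes L: "\<And>m k. \<bar>f m - f k\<bar> \<le> L * \<bar>real m - real k\<bar>" and f: "\<And>m. f m \<ge> 0"
    and super: "\<And>k. (\<integral>\<^sup>+m. ennreal (f m) \<partial>kern k) \<le> ennreal (f k)"
  obtains C where "C \<ge> 0" "\<And>k. (\<integral>\<^sup>+m. ennreal (f m ^ 2) \<partial>kern k) \<le> ennreal (f k ^ 2 + C * of_bool (k \<ge> 1))"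
proof -
  obtain M where M: "M > 0" "\<And>k. measure_pmf.expectation (kern k) (\<lambda>m. \<bar>real m - real k\<bar> ^ 2) \<le> M"
    using kern_moment by blast
  let ?E = "\<lambda>k. measure_pmf.expectation (kern k)"
  have "(\<integral>\<^sup>+m. ennreal (f m ^ 2) \<partial>kern k) \<le> ennreal (f k ^ 2 + L ^ 2 * M * of_bool (k \<ge> 1))" for k
  proof (cases "k = 0")
    case False
    have i1: "integrable (kern k) f" and i2: "integrable (kern k) (\<lambda>m. (f m - f k) ^ 2)"
      using integrable_lipschitz[of f k L] L by auto
    have e: "(\<lambda>m. f m ^ 2) = (\<lambda>m. (f m - f k) ^ 2 + 2 * f k * f m - f k ^ 2)"
      by (simp add: power2_eq_square algebra_simps fun_eq_iff)
    have i3: "integrable (kern k) (\<lambda>m. f m ^ 2)"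
      by (subst e) (intro Bochner_Integration.integrable_add Bochner_Integration.integrable_diff i2 integrable_mult_right i1 measure_pmf.integrable_const)
    have "ennreal (?E k f) \<le> ennreal (f k)" using super[of k] kern_nn_integral[OF i1 f] by simp
    then have s: "?E k f \<le> f k" using f by (simp add: ennreal_le_iff)
    have "?E k (\<lambda>m. f m ^ 2) = ?E k (\<lambda>m. (f m - f k) ^ 2) + 2 * f k * ?E k f - f k ^ 2"
      using i1 i2 by (subst e) simp
    also have "2 * f k * ?E k f \<le> 2 * f k * f k" using s f by (intro mult_left_mono) auto
    also have "?E k (\<lambda>m. (f m - f k) ^ 2) \<le> ?E k (\<lambda>m. L ^ 2 * \<bar>real m - real k\<bar> ^ 2)"
    proof (intro integral_mono i2 integrable_mult_right kern_integrable_pow)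
      show "(f m - f k) ^ 2 \<le> L ^ 2 * \<bar>real m - real k\<bar> ^ 2" for m
        using power_mono[OF L, of m k 2] by (simp add: power_mult_distrib)
    qed
    also have "\<dots> \<le> L ^ 2 * M" using mult_left_mono[OF M(2)[of k], of "L ^ 2"] by simp
    finally have "?E k (\<lambda>m. f m ^ 2) \<le> f k ^ 2 + L ^ 2 * M" by (simp add: power2_eq_square)
    then show ?thesis using False kern_nn_integral[OF i3] by (auto intro!: ennreal_leI)
  qed (simp add: kern_0)
  then show ?thesis using that[of "L ^ 2 * M"] M by simp
qed

text \<open>Nash's argument. The mean of \<open>lyap\<close> dominates the survival probability and
  decreases in each step by at least \<open>c\<close> times the mean of \<open>e\<close>. As the
  mean of the chain never exceeds \<open>K * real k\<close>, interpolation bounds the mean of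
  \<open>e\<close> from below by a power of the mean of \<open>lyap\<close>, and
  \<open>decay_rate\<close> solves the resulting inequality. The exponent tends to 1/2 as
  \<open>a\<close> tends to 0.\<close>

lemma survival_bound:
  assumes a: "0 < a" "a < 1"
  obtains C where "C > 0"
    "\<And>k n. n \<ge> 1 \<Longrightarrow> measure_pmf.prob (chain k n) {1..} \<le> C * real k * real n powr (- (1 - a) / 2)"
proof -
  obtain A c B where A: "A \<ge> 0" and c: "c > 0" and B: "B \<ge> 0"
    and ly: "\<And>k. k \<ge> 1 \<Longrightarrow> (\<integral>\<^sup>+m. ennreal (lyap a A m) \<partial>kern k) + ennreal (c * real k powr (a - 2)) \<le> ennreal (lyap a A k)"
    and sup: "\<And>k. (\<integral>\<^sup>+m. ennreal (real m + B * lyap a A m) \<partial>kern k) \<le> ennreal (real k + B * lyap a A k)"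
    and "\<And>k. ennreal (real k - B * lyap a A k) \<le> (\<integral>\<^sup>+m. ennreal (real m - B * lyap a A m) \<partial>kern k)"
    by (rule harmonic_bounds[OF a]) (rule that)
  define e where "e y = of_bool (y \<ge> 1) * real y powr (a - 2)" for y :: nat
  have e0: "e y \<ge> 0" and e1: "e y \<le> 1" for y using a by (auto simp: e_def intro!: powr_nonpos_le_1)
  have ly': "(\<integral>\<^sup>+m. ennreal (lyap a A m) \<partial>kern k) + ennreal c * ennreal (e k) \<le> ennreal (lyap a A k)" for k
  proof (cases "k = 0")
    case True then show ?thesis by (simp add: kern_0 e_def)
  next
    case False then show ?thesis using ly[of k] c by (simp add: e_def ennreal_mult'[symmetric])
  qed
  define K where "K = 1 + B * (1 + A)"
  have K: "K > 0" using A B by (simp add: K_def add_pos_nonneg)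
  have lin: "real k + B * lyap a A k \<le> K * real k" for k
  proof (cases "k = 0")
    case False
    have "A * 1 \<le> A * real k" using False A by (intro mult_left_mono) auto
    then have "lyap a A k \<le> (1 + A) * real k" using powr_nat_le[OF a, of k] False by (simp add: lyap_def algebra_simps)
    then have "B * lyap a A k \<le> B * ((1 + A) * real k)" using B by (intro mult_left_mono) auto
    then show ?thesis by (simp add: K_def algebra_simps)
  qed simp
  define \<kappa> where "\<kappa> = 2 / (1 - a)"
  have \<kappa>: "\<kappa> > 0" using a by (simp add: \<kappa>_def)
  define d where "d = c / (2 * (1 + A))"
  have d: "d > 0" using c A by (simp add: d_def)
  define G where "G = 2 * (1 + A) * K"
  have G: "G > 0" using A K by (simp add: G_def)
  have "measure_pmf.prob (chain k n) {1..} \<le> G * (d * \<kappa>) powr (- 1 / \<kappa>) * real k * real n powr (- (1 - a) / 2)"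
    if n: "n \<ge> 1" for k n
  proof (cases "k = 0")
    case True
    have "chain 0 n = return_pmf 0" by (induction n) (auto simp: bind_return_pmf kern_0)
    then show ?thesis using True by simp
  next
    case False
    define m where "m n = (\<integral>\<^sup>+y. ennreal (lyap a A y) \<partial>chain k n)" for n
    define en where "en n = (\<integral>\<^sup>+y. ennreal (e y) \<partial>chain k n)" for n
    have mstep: "m (Suc n) + ennreal c * en n \<le> m n" for n
    proof -
      have "m (Suc n) + ennreal c * en n = (\<integral>\<^sup>+y. (\<integral>\<^sup>+z. ennreal (lyap a A z) \<partial>kern y) + ennreal c * ennreal (e y) \<partial>chain k n)"
        unfolding m_def en_def by (simp add: nn_integral_add nn_integral_cmult)
      also have "\<dots> \<le> m n" unfolding m_def by (intro nn_integral_mono ly')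
      finally show ?thesis .
    qed
    have mean: "(\<integral>\<^sup>+y. ennreal (real y) \<partial>chain k n) \<le> ennreal (K * real k)" for n
    proof -
      have "(\<integral>\<^sup>+y. ennreal (real y) \<partial>chain k n) \<le> (\<integral>\<^sup>+y. ennreal (real y + B * lyap a A y) \<partial>chain k n)"
        using B lyap_nonneg[OF A] by (intro nn_integral_mono ennreal_leI) auto
      also have "\<dots> \<le> ennreal (real k + B * lyap a A k)"
      proof (induction n)
        case (Suc n)
        have "(\<integral>\<^sup>+y. ennreal (real y + B * lyap a A y) \<partial>chain k (Suc n)) \<le> (\<integral>\<^sup>+y. ennreal (real y + B * lyap a A y) \<partial>chain k n)"
          by (simp add: nn_integral_mono[OF sup])
        then show ?case using Suc by simp
      qed simp
      also have "\<dots> \<le> ennreal (K * real k)" by (intro ennreal_leI lin)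
      finally show ?thesis .
    qed
    have mfin: "m n \<le> ennreal (lyap a A k)" for n
    proof (induction n)
      case (Suc n)
      have "m (Suc n) \<le> m n" using mstep[of n] by (metis add_increasing2 order_trans zero_le le_iff_add)
      then show ?case using Suc by simp
    qed (simp add: m_def)
    have enfin: "en n \<le> 1" for n
    proof -
      have "en n \<le> (\<integral>\<^sup>+y. 1 \<partial>chain k n)" unfolding en_def using e1 by (intro nn_integral_mono) (simp add: ennreal_le_1)
      then show ?thesis by simp
    qed
    define x where "x n = enn2real (m n)" for n
    define r where "r n = enn2real (en n)" for n
    have mx: "m n = ennreal (x n)" for n using mfin[of n] by (simp add: x_def ennreal_enn2real_if top_unique) (metis ennreal_neq_top top.extremum_uniqueI)
    have er: "en n = ennreal (r n)" for n using enfin[of n] by (simp add: r_def ennreal_enn2real_if top_unique) (metis ennreal_one_neq_top top.extremum_uniqueI)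
    have x0: "x n \<ge> 0" and r0: "r n \<ge> 0" for n by (auto simp: x_def r_def)
    have xstep: "x (Suc n) + c * r n \<le> x n" for n
      using mstep[of n] x0 r0 c unfolding mx er
      by (simp add: ennreal_mult'[symmetric] ennreal_plus[symmetric] ennreal_le_iff del: ennreal_plus)
    \<comment> \<open>Split at height \<open>R\<close>: values up to \<open>R\<close> are charged to
      \<open>e\<close>, larger ones to the mean.\<close>
    have interp: "x n \<le> (1 + A) * (R ^ 2 * r n + R powr (a - 1) * (K * real k))" if R: "R > 0" for R n
    proof -
      have pt: "lyap a A y \<le> (1 + A) * (R ^ 2 * e y + R powr (a - 1) * real y)" for y
      proof (cases "y = 0")
        case False
        have "1 \<le> real y powr a" using False a by (simp add: ge_one_powr_ge_zero)
        then have "A * 1 \<le> A * real y powr a" using A by (intro mult_left_mono) auto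
        then have "lyap a A y \<le> (1 + A) * real y powr a" using False by (simp add: lyap_def algebra_simps)
        also have "real y powr a \<le> R ^ 2 * e y + R powr (a - 1) * real y"
        proof (cases "real y \<le> R")
          case True
          have "real y powr a = real y ^ 2 * real y powr (a - 2)" using False by (simp add: powr_diff powr_numeral)
          also have "\<dots> \<le> R ^ 2 * real y powr (a - 2)" using True by (intro mult_right_mono power_mono) auto
          finally show ?thesis using False by (simp add: e_def add_increasing2)
        next
          case False2: False
          have "real y powr a = real y powr (a - 1) * real y" using False by (simp add: powr_diff)
          also have "\<dots> \<le> R powr (a - 1) * real y" using False2 a R by (intro mult_right_mono powr_mono2') auto
          finally show ?thesis using e0[of y] by (simp add: add_increasing)
        qed
        finally show ?thesis using A by (simp add: mult_left_mono)
      qed (use A e0 in auto)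
      have "m n \<le> (\<integral>\<^sup>+y. ennreal ((1 + A) * R ^ 2) * ennreal (e y) + ennreal ((1 + A) * R powr (a - 1)) * ennreal (real y) \<partial>chain k n)"
        unfolding m_def
      proof (intro nn_integral_mono)
        fix y
        have "ennreal (lyap a A y) \<le> ennreal ((1 + A) * R ^ 2 * e y + (1 + A) * R powr (a - 1) * real y)"
          using pt[of y] by (intro ennreal_leI) (simp add: algebra_simps)
        then show "ennreal (lyap a A y) \<le> ennreal ((1 + A) * R ^ 2) * ennreal (e y) + ennreal ((1 + A) * R powr (a - 1)) * ennreal (real y)"
          using A e0[of y] by (simp add: ennreal_mult[symmetric] ennreal_plus[symmetric] del: ennreal_plus)
      qed
      also have "\<dots> = ennreal ((1 + A) * R ^ 2) * en n + ennreal ((1 + A) * R powr (a - 1)) * (\<integral>\<^sup>+y. ennreal (real y) \<partial>chain k n)"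
        unfolding en_def by (simp add: nn_integral_add nn_integral_cmult)
      also have "\<dots> \<le> ennreal ((1 + A) * R ^ 2) * ennreal (r n) + ennreal ((1 + A) * R powr (a - 1)) * ennreal (K * real k)"
        unfolding er by (intro add_left_mono mult_left_mono mean) auto
      also have "\<dots> = ennreal ((1 + A) * R ^ 2 * r n + (1 + A) * R powr (a - 1) * (K * real k))"
        using A r0[of n] K by (simp add: ennreal_mult[symmetric] ennreal_plus[symmetric] del: ennreal_plus)
      finally have "ennreal (x n) \<le> \<dots>" unfolding mx .
      then have "x n \<le> (1 + A) * R ^ 2 * r n + (1 + A) * R powr (a - 1) * (K * real k)"
        using A r0[of n] K by (subst (asm) ennreal_le_iff) auto
      then show ?thesis by (simp add: algebra_simps)
    qed
    define u where "u n = x n / (G * real k)" for n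
    have Gk: "G * real k > 0" using G False by simp
    have u0: "u n \<ge> 0" for n using x0 Gk by (simp add: u_def)
    have ustep: "u (Suc n) \<le> u n - d * u n * u n powr \<kappa>" for n
    proof (cases "x n = 0")
      case True
      then have "x (Suc n) = 0" using xstep[of n] c r0[of n] x0[of "Suc n"] by (smt (verit) mult_nonneg_nonneg)
      then show ?thesis using True by (simp add: u_def)
    next
      case False
      then have un: "u n > 0" using x0[of n] Gk by (simp add: u_def)
      \<comment> \<open>This \<open>R\<close> makes the part charged to the mean exactly half of
        \<open>x n\<close>, which is why \<open>G\<close> carries a factor 2; the other half must
        come from \<open>r n\<close>.\<close>
      define R where "R = u n powr (- 1 / (1 - a))"
      have R: "R > 0" using un by (simp add: R_def)
      have "R powr (a - 1) = u n powr (- 1 / (1 - a) * (a - 1))" by (simp add: R_def powr_powr)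
      also have "- 1 / (1 - a) * (a - 1) = 1" using a by (simp add: field_simps)
      finally have R1: "R powr (a - 1) = u n" using un by simp
      have "R ^ 2 = R powr 2" using R by (simp add: powr_numeral)
      also have "\<dots> = u n powr (- \<kappa>)" by (simp add: R_def powr_powr \<kappa>_def)
      finally have R2: "R ^ 2 = u n powr (- \<kappa>)" .
      have half: "(1 + A) * (R powr (a - 1) * (K * real k)) = x n / 2"
      proof -
        have "P * (x n / (2 * P * K * real k) * (K * real k)) = x n / 2" if "P > 0" for P
          using that K \<open>k \<noteq> 0\<close> by (simp add: field_simps)
        from this[of "1 + A"] show ?thesis unfolding R1 u_def G_def using A by simp
      qed
      have "x n / 2 \<le> (1 + A) * R ^ 2 * r n" using interp[OF R, of n] half by (simp add: algebra_simps)
      then have "x n / 2 * u n powr \<kappa> \<le> (1 + A) * r n * (u n powr (- \<kappa>) * u n powr \<kappa>)"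
      proof -
        assume "x n / 2 \<le> (1 + A) * R ^ 2 * r n"
        then have "x n / 2 * u n powr \<kappa> \<le> (1 + A) * R ^ 2 * r n * u n powr \<kappa>" by (rule mult_right_mono) simp
        then show ?thesis unfolding R2 by (simp only: mult_ac)
      qed
      also have "u n powr (- \<kappa>) * u n powr \<kappa> = 1" using un by (simp flip: powr_add)
      finally have "x n * u n powr \<kappa> / (2 * (1 + A)) \<le> r n" using A by (simp add: field_simps)
      then have "c * (x n * u n powr \<kappa> / (2 * (1 + A))) \<le> c * r n" using c by (intro mult_left_mono) auto
      then have "x (Suc n) \<le> x n - d * x n * u n powr \<kappa>" using xstep[of n] by (simp add: d_def mult_ac)
      then have "x (Suc n) / (G * real k) \<le> (x n - d * x n * u n powr \<kappa>) / (G * real k)" using Gk by (intro divide_right_mono) auto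
      then show ?thesis unfolding u_def by (simp add: diff_divide_distrib)
    qed
    have "u n \<le> (d * \<kappa> * real n) powr (- 1 / \<kappa>)" by (rule decay_rate[where u=u, OF u0 d \<kappa> ustep n])
    also have "\<dots> = (d * \<kappa>) powr (- 1 / \<kappa>) * real n powr (- 1 / \<kappa>)" by (rule powr_mult)
    also have "- 1 / \<kappa> = - (1 - a) / 2" using a by (simp add: \<kappa>_def)
    finally have "u n * (G * real k) \<le> (d * \<kappa>) powr (- (1 - a) / 2) * real n powr (- (1 - a) / 2) * (G * real k)"
      using Gk by (intro mult_right_mono) auto
    then have xb: "x n \<le> G * (d * \<kappa>) powr (- (1 - a) / 2) * real k * real n powr (- (1 - a) / 2)"
      using Gk G False by (simp add: u_def mult_ac)
    have "ennreal (measure_pmf.prob (chain k n) {1..}) = (\<integral>\<^sup>+y. indicator {1..} y \<partial>chain k n)"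
      by (simp add: measure_pmf.emeasure_eq_measure)
    also have "\<dots> \<le> m n" unfolding m_def
    proof (intro nn_integral_mono)
      show "indicator {1..} y \<le> ennreal (lyap a A y)" for y
      proof (cases "y \<ge> 1")
        case True
        then have "1 \<le> real y powr a" using a by (simp add: ge_one_powr_ge_zero)
        then have "1 \<le> lyap a A y" using A True by (simp add: lyap_def)
        then have "ennreal 1 \<le> ennreal (lyap a A y)" by (rule ennreal_leI)
        then show ?thesis using True by simp
      qed simp
    qed
    finally have "measure_pmf.prob (chain k n) {1..} \<le> x n" unfolding mx using x0 by (simp add: ennreal_le_iff)
    moreover have "- 1 / \<kappa> = - (1 - a) / 2" using a by (simp add: \<kappa>_def)
    ultimately show ?thesis using xb by (simp only:)
  qed
  moreover have "G * (d * \<kappa>) powr (- 1 / \<kappa>) > 0" using G d \<kappa> by simp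
  ultimately show ?thesis using that by blast
qed

end

section \<open>Stacks\<close>

text \<open>One coordinate of a product is independent of the others, so drawing it anew changes no
  integral. The independence of draws and of stacks is used in this form in place of
  conditioning.\<close>

lemma nn_integral_PiM_resample:
  fixes M :: "'i \<Rightarrow> 'b measure"
  assumes M: "\<And>i. prob_space (M i)" and G[measurable]: "G \<in> borel_measurable (PiM UNIV M)"
  shows "(\<integral>\<^sup>+\<omega>. G \<omega> \<partial>PiM UNIV M) = (\<integral>\<^sup>+\<omega>. (\<integral>\<^sup>+x. G (\<omega> (i := x)) \<partial>M i) \<partial>PiM UNIV M)"
proof -
  interpret I: prob_space "PiM UNIV M" using M by (intro prob_space_PiM) auto
  interpret Mi: prob_space "M i" by (rule M)
  interpret P: pair_sigma_finite "M i" "PiM UNIV M" ..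
  have meas: "(\<lambda>(x, X). X(i := x)) \<in> measurable (M i \<Otimes>\<^sub>M PiM UNIV M) (PiM UNIV M)"
    using measurable_fun_upd[where I="UNIV" and J=UNIV and i=i and M=M] 
    by (auto simp: split_beta' intro!: measurable_fun_upd[where J=UNIV])
  have "(\<integral>\<^sup>+\<omega>. G \<omega> \<partial>PiM UNIV M) = (\<integral>\<^sup>+\<omega>. G \<omega> \<partial>distr (M i \<Otimes>\<^sub>M PiM UNIV M) (PiM UNIV M) (\<lambda>(x, X). X(i := x)))"
    using distr_pair_PiM_eq_PiM[of UNIV M i] M by simp
  also have "\<dots> = (\<integral>\<^sup>+z. G (case z of (x, X) \<Rightarrow> X(i := x)) \<partial>(M i \<Otimes>\<^sub>M PiM UNIV M))"
    by (rule nn_integral_distr[OF meas]) simp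
  also have "\<dots> = (\<integral>\<^sup>+\<omega>. (\<integral>\<^sup>+x. G (\<omega> (i := x)) \<partial>M i) \<partial>PiM UNIV M)"
    using measurable_compose[OF meas G] by (subst P.nn_integral_snd[symmetric]) auto
  finally show ?thesis .
qed

text \<open>
  A stack is stored as a function that assigns to every finite history the next draw after it, so
  that the draws after all histories can be taken independent; \<open>stack_seq f\<close> is the resulting
  sequence of draws.
\<close>

primrec stack_prefix :: "(nat list \<Rightarrow> nat) \<Rightarrow> nat \<Rightarrow> nat list" where
  "stack_prefix f 0 = []"
| "stack_prefix f (Suc t) = stack_prefix f t @ [f (stack_prefix f t)]"

definition stack_seq :: "(nat list \<Rightarrow> nat) \<Rightarrow> nat \<Rightarrow> nat" where "stack_seq f t = f (stack_prefix f t)"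

lemma length_stack_prefix [simp]: "length (stack_prefix f t) = t"
  by (induction t) auto

lemma stack_prefix_upd: "t \<le> length h \<Longrightarrow> stack_prefix (f(h := x)) t = stack_prefix f t"
proof (induction t)
  case (Suc t)
  then have "stack_prefix f t \<noteq> h" by auto
  then show ?case using Suc by simp
qed simp

lemma stack_seq_upd: "t < length h \<Longrightarrow> stack_seq (f(h := v)) t = stack_seq f t"
proof -
  assume t: "t < length h"
  then have "stack_prefix f t \<noteq> h" by (metis length_stack_prefix nat_neq_iff)
  then show ?thesis using t by (simp add: stack_seq_def stack_prefix_upd)
qed

lemma stack_prefix_eq_map: "stack_prefix f t = map (stack_seq f) [0..<t]"
  by (induction t) (auto simp: stack_seq_def)

lemma count_stack_prefix: "count_list (stack_prefix f t) j = card {i. i < t \<and> stack_seq f i = j}"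
proof (induction t)
  case (Suc t)
  have "{i. i < Suc t \<and> stack_seq f i = j} = {i. i < t \<and> stack_seq f i = j} \<union> (if stack_seq f t = j then {t} else {})"
    by (auto simp: less_Suc_eq)
  then show ?case using Suc by (auto simp: stack_seq_def)
qed simp

text \<open>The value 0 of \<open>card\<close> on infinite sets could matter only if
  \<open>s\<close> has fewer than \<open>k\<close> zeros; \<open>good_seq\<close> excludes this when
  there is a colour 0.\<close>

definition count_before :: "(nat \<Rightarrow> nat) \<Rightarrow> nat \<Rightarrow> nat \<Rightarrow> nat" where
  "count_before s j k = card {i. s i = j \<and> card {i'. i' < i \<and> s i' = 0} < k}"

text \<open>The part of \<open>count_before\<close> that a finite history decides; it is frozen once
  \<open>h\<close> contains \<open>k\<close> zeros.\<close>

definition count_before_list :: "nat list \<Rightarrow> nat \<Rightarrow> nat \<Rightarrow> nat" where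
  "count_before_list h j k = card {i. i < length h \<and> h ! i = j \<and> count_list (take i h) 0 < k}"

lemma count_before_list_Nil [simp]: "count_before_list [] j k = 0" by (simp add: count_before_list_def)

lemma count_before_list_snoc: "count_before_list (h @ [x]) j k = count_before_list h j k + of_bool (x = j \<and> count_list h 0 < k)"
proof -
  have "{i. i < length (h @ [x]) \<and> (h @ [x]) ! i = j \<and> count_list (take i (h @ [x])) 0 < k}
    = {i. i < length h \<and> h ! i = j \<and> count_list (take i h) 0 < k}
      \<union> (if x = j \<and> count_list h 0 < k then {length h} else {})"
    by (auto simp: less_Suc_eq nth_append)
  then show ?thesis unfolding count_before_list_def by (auto simp: card_insert_if)
qed

lemma count_before_list_eq_count: "count_list h 0 < k \<Longrightarrow> count_before_list h j k = count_list h j"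
  by (induction h rule: rev_induct) (auto simp: count_before_list_snoc split: if_splits)

lemma count_before_list_stack_prefix: "count_before_list (stack_prefix f t) j k = card {i. i < t \<and> stack_seq f i = j \<and> card {i'. i' < i \<and> stack_seq f i' = 0} < k}"
proof (induction t)
  case (Suc t)
  have "{i. i < Suc t \<and> stack_seq f i = j \<and> card {i'. i' < i \<and> stack_seq f i' = 0} < k}
    = {i. i < t \<and> stack_seq f i = j \<and> card {i'. i' < i \<and> stack_seq f i' = 0} < k}
      \<union> (if stack_seq f t = j \<and> count_list (stack_prefix f t) 0 < k then {t} else {})"
    by (auto simp: less_Suc_eq count_stack_prefix)
  then show ?case using Suc by (auto simp: count_before_list_snoc stack_seq_def)
qed simp

definition good_seq :: "nat \<Rightarrow> (nat \<Rightarrow> nat) \<Rightarrow> bool" where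
  "good_seq D s \<longleftrightarrow> (\<forall>i. s i < D) \<and> (\<forall>j<D. infinite {i. s i = j})"

lemma infinite_count: "infinite {i::nat. P i} \<Longrightarrow> \<exists>t. card {i. i < t \<and> P i} \<ge> n"
proof -
  assume "infinite {i. P i}"
  then obtain T where T: "T \<subseteq> {i. P i}" "finite T" "card T = n"
    using infinite_arbitrarily_large by blast
  obtain t where "\<forall>i\<in>T. i < t" using T(2) by (meson finite_nat_set_iff_bounded)
  then have "T \<subseteq> {i. i < t \<and> P i}" using T(1) by auto
  then have "n \<le> card {i. i < t \<and> P i}" using T(3) card_mono[of "{i. i < t \<and> P i}" T] by auto
  then show ?thesis by blast
qed

lemma finite_before_kth:
  fixes s :: "nat \<Rightarrow> nat"
  assumes "infinite {i. s i = 0}"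
  obtains t where "\<And>i. card {i'. i' < i \<and> s i' = 0} < k \<Longrightarrow> i < t"
proof -
  obtain t where t: "card {i. i < t \<and> s i = 0} \<ge> k" using infinite_count[OF assms] by blast
  have "i < t" if "card {i'. i' < i \<and> s i' = 0} < k" for i
  proof (rule ccontr)
    assume "\<not> i < t"
    then have "card {i. i < t \<and> s i = 0} \<le> card {i'. i' < i \<and> s i' = 0}" by (intro card_mono) auto
    then show False using that t by simp
  qed
  then show ?thesis using that by blast
qed

section \<open>The urn as a random stack\<close>

context repulsion
begin

text \<open>
  Colour \<open>j\<close> drawn \<open>n\<close> times stands for an edge crossed \<open>2 * n\<close> times.  The flag \<open>b\<close> tells whether
  colour 0 is the parent, whose edge has been crossed once more.
\<close>

definition urn_weight :: "bool \<Rightarrow> nat list \<Rightarrow> nat \<Rightarrow> real" where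
  "urn_weight b h j = exp (- \<beta> * (2 * real (count_list h j) + of_bool (b \<and> j = 0)))"

definition urn :: "nat \<Rightarrow> bool \<Rightarrow> nat list \<Rightarrow> nat pmf" where
  "urn D b h = embed_pmf (\<lambda>j. if j < D then urn_weight b h j / (\<Sum>i<D. urn_weight b h i) else 0)"

lemma urn_weight_pos: "urn_weight b h j > 0" by (simp add: urn_weight_def)

lemma urn_weight_le_1: "urn_weight b h j \<le> 1" using beta_pos by (simp add: urn_weight_def)

lemma urn_weight_sum_pos: "D \<ge> 1 \<Longrightarrow> (\<Sum>i<D. urn_weight b h i) > 0"
  by (rule sum_pos) (auto simp: urn_weight_pos lessThan_empty_iff)

lemma pmf_urn:
  assumes "D \<ge> 1"
  shows "pmf (urn D b h) j = (if j < D then urn_weight b h j / (\<Sum>i<D. urn_weight b h i) else 0)"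
  unfolding urn_def
proof (rule pmf_embed_pmf)
  show "0 \<le> (if j < D then urn_weight b h j / (\<Sum>i<D. urn_weight b h i) else 0)" for j
    using urn_weight_pos urn_weight_sum_pos[OF assms] by (auto simp: less_imp_le)
  have "(\<integral>\<^sup>+j. ennreal (if j < D then urn_weight b h j / (\<Sum>i<D. urn_weight b h i) else 0) \<partial>count_space UNIV)
     = (\<integral>\<^sup>+j. ennreal (urn_weight b h j / (\<Sum>i<D. urn_weight b h i)) * indicator {..<D} j \<partial>count_space UNIV)"
    by (intro nn_integral_cong) (auto simp: indicator_def)
  also have "\<dots> = (\<integral>\<^sup>+j. ennreal (urn_weight b h j / (\<Sum>i<D. urn_weight b h i)) \<partial>count_space {..<D})"
    by (subst nn_integral_count_space_indicator) auto
  also have "\<dots> = (\<Sum>j<D. ennreal (urn_weight b h j / (\<Sum>i<D. urn_weight b h i)))"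
    by (rule nn_integral_count_space_finite) simp
  also have "\<dots> = ennreal (\<Sum>j<D. urn_weight b h j / (\<Sum>i<D. urn_weight b h i))"
    using urn_weight_pos urn_weight_sum_pos[OF assms] by (intro sum_ennreal) (auto simp: less_imp_le)
  also have "(\<Sum>j<D. urn_weight b h j / (\<Sum>i<D. urn_weight b h i)) = 1"
    using urn_weight_sum_pos[OF assms, of b h] by (simp add: sum_divide_distrib[symmetric])
  finally show "(\<integral>\<^sup>+j. ennreal (if j < D then urn_weight b h j / (\<Sum>i<D. urn_weight b h i) else 0) \<partial>count_space UNIV) = 1" by simp
qed

lemma set_pmf_urn: "D \<ge> 1 \<Longrightarrow> set_pmf (urn D b h) \<subseteq> {..<D}"
  by (auto simp: set_pmf_eq pmf_urn split: if_splits)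

definition field :: "nat \<Rightarrow> bool \<Rightarrow> (nat list \<Rightarrow> nat) measure" where
  "field D b = PiM UNIV (\<lambda>h. measure_pmf (urn D b h))"

lemma prob_space_field: "prob_space (field D b)"
  unfolding field_def by (intro prob_space_PiM measure_pmf.prob_space_axioms)

lemma space_field [simp]: "space (field D b) = UNIV"
  by (auto simp: field_def space_PiM)

lemma measurable_field_component [measurable]: "(\<lambda>f. f h) \<in> measurable (field D b) (count_space UNIV)"
proof -
  have "(\<lambda>f. f h) \<in> measurable (field D b) (measure_pmf (urn D b h))"
    unfolding field_def by (rule measurable_component_singleton) simp
  then show ?thesis by (simp add: measurable_def)
qed

lemma measurable_stack_prefix [measurable]: "(\<lambda>f. stack_prefix f t) \<in> measurable (field D b) (count_space UNIV)"
proof (induction t)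
  case (Suc t)
  have "(\<lambda>f. (\<lambda>h f. h @ [f h]) (stack_prefix f t) f) \<in> measurable (field D b) (count_space UNIV)"
  proof (rule measurable_compose_countable[OF _ Suc])
    fix h :: "nat list"
    have "(\<lambda>y. h @ [y]) \<in> measurable (count_space UNIV) (count_space UNIV)" by simp
    from measurable_compose[OF measurable_field_component this]
    show "(\<lambda>f. h @ [f h]) \<in> measurable (field D b) (count_space UNIV)" .
  qed
  then show ?case by simp
qed simp

lemma measurable_stack_seq [measurable]: "(\<lambda>f. stack_seq f t) \<in> measurable (field D b) (count_space UNIV)"
  unfolding stack_seq_def
  by (rule measurable_compose_countable[where f="\<lambda>h f. f h", OF _ measurable_stack_prefix]) simp

text \<open>The Markov property of a stack. If the first \<open>t\<close> draws are
  \<open>h\<close>, the next draw is the coordinate at \<open>h\<close>, while the prefix itself has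
  read only coordinates at shorter histories. That coordinate may therefore be resampled from its
  urn.\<close>

lemma nn_integral_stack_prefix_Suc:
  fixes g :: "nat list \<Rightarrow> ennreal"
  shows "(\<integral>\<^sup>+f. g (stack_prefix f (Suc t)) \<partial>field D b) = (\<integral>\<^sup>+f. (\<integral>\<^sup>+j. g (stack_prefix f t @ [j]) \<partial>urn D b (stack_prefix f t)) \<partial>field D b)"
proof -
  have m: "(\<lambda>f. indicator {h} (stack_prefix f t) * g (h @ [f h])) \<in> borel_measurable (field D b)" for h
  proof -
    have 1: "(\<lambda>f. indicator {h} (stack_prefix f t) :: ennreal) \<in> borel_measurable (field D b)"
      by (rule measurable_compose[OF measurable_stack_prefix]) simp
    have 2: "(\<lambda>f. g (h @ [f h])) \<in> borel_measurable (field D b)"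
      by (rule measurable_compose[OF measurable_field_component]) simp
    note [measurable] = 1 2
    show ?thesis by measurable
  qed
  have m2: "(\<lambda>f. indicator {h} (stack_prefix f t) * c) \<in> borel_measurable (field D b)" for h and c :: ennreal
  proof -
    have 1: "(\<lambda>f. indicator {h} (stack_prefix f t) :: ennreal) \<in> borel_measurable (field D b)"
      by (rule measurable_compose[OF measurable_stack_prefix]) simp
    note [measurable] = 1
    show ?thesis by measurable
  qed
  \<comment> \<open>Summing over all possible values \<open>h\<close> of the prefix replaces the
    random coordinate by fixed ones, to which resampling applies.\<close>
  have pick: "(\<integral>\<^sup>+h. indicator {h} x * F h \<partial>count_space UNIV) = F x" for x :: "nat list" and F :: "nat list \<Rightarrow> ennreal"
  proof -
    have "(\<integral>\<^sup>+h. indicator {h} x * F h \<partial>count_space UNIV) = (\<integral>\<^sup>+h. F h * indicator {x} h \<partial>count_space UNIV)"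
      by (intro nn_integral_cong) (auto simp: indicator_def)
    also have "\<dots> = F x" by (subst nn_integral_count_space_indicator[symmetric]) (auto simp: nn_integral_count_space_finite)
    finally show ?thesis .
  qed
  have "(\<integral>\<^sup>+f. g (stack_prefix f (Suc t)) \<partial>field D b) = (\<integral>\<^sup>+f. (\<integral>\<^sup>+h. indicator {h} (stack_prefix f t) * g (h @ [f h]) \<partial>count_space UNIV) \<partial>field D b)"
    by (simp add: pick)
  also have "\<dots> = (\<integral>\<^sup>+h. (\<integral>\<^sup>+f. indicator {h} (stack_prefix f t) * g (h @ [f h]) \<partial>field D b) \<partial>count_space UNIV)"
    by (rule nn_integral_count_space_nn_integral) (auto intro: m)
  also have "\<dots> = (\<integral>\<^sup>+h. (\<integral>\<^sup>+f. indicator {h} (stack_prefix f t) * (\<integral>\<^sup>+j. g (h @ [j]) \<partial>urn D b h) \<partial>field D b) \<partial>count_space UNIV)"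
  proof (rule nn_integral_cong)
    fix h
    have "(\<integral>\<^sup>+f. indicator {h} (stack_prefix f t) * g (h @ [f h]) \<partial>field D b)
       = (\<integral>\<^sup>+f. (\<integral>\<^sup>+x. indicator {h} (stack_prefix (f(h := x)) t) * g (h @ [(f(h := x)) h]) \<partial>urn D b h) \<partial>field D b)"
      unfolding field_def
      by (rule nn_integral_PiM_resample) (use m[of h] in \<open>auto simp: field_def intro: measure_pmf.prob_space_axioms\<close>)
    also have "\<dots> = (\<integral>\<^sup>+f. (\<integral>\<^sup>+x. indicator {h} (stack_prefix f t) * g (h @ [x]) \<partial>urn D b h) \<partial>field D b)"
    proof (intro nn_integral_cong)
      fix f x
      show "indicator {h} (stack_prefix (f(h := x)) t) * g (h @ [(f(h := x)) h]) = indicator {h} (stack_prefix f t) * g (h @ [x])"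
      proof (cases "length h = t")
        case True
        then show ?thesis by (simp add: stack_prefix_upd)
      next
        case False
        then have "stack_prefix (f(h := x)) t \<noteq> h" "stack_prefix f t \<noteq> h" by (metis length_stack_prefix)+
        then show ?thesis by simp
      qed
    qed
    also have "\<dots> = (\<integral>\<^sup>+f. indicator {h} (stack_prefix f t) * (\<integral>\<^sup>+j. g (h @ [j]) \<partial>urn D b h) \<partial>field D b)"
      by (simp add: nn_integral_cmult)
    finally show "(\<integral>\<^sup>+f. indicator {h} (stack_prefix f t) * g (h @ [f h]) \<partial>field D b) = \<dots>" .
  qed
  also have "\<dots> = (\<integral>\<^sup>+f. (\<integral>\<^sup>+h. indicator {h} (stack_prefix f t) * (\<integral>\<^sup>+j. g (h @ [j]) \<partial>urn D b h) \<partial>count_space UNIV) \<partial>field D b)"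
    by (rule nn_integral_count_space_nn_integral[symmetric]) (auto intro: m2)
  also have "\<dots> = (\<integral>\<^sup>+f. (\<integral>\<^sup>+j. g (stack_prefix f t @ [j]) \<partial>urn D b (stack_prefix f t)) \<partial>field D b)"
    by (simp add: pick)
  finally show ?thesis .
qed

lemma AE_field_in_range:
  assumes "D \<ge> 1"
  shows "AE f in field D b. \<forall>h. f h < D"
proof -
  have "AE f in field D b. f h < D" for h
    unfolding field_def
    by (rule AE_PiM_component[where P="\<lambda>x. x < D"])
       (use set_pmf_urn[OF assms] in \<open>auto simp: AE_measure_pmf_iff intro: measure_pmf.prob_space_axioms\<close>)
  then show ?thesis by (subst AE_all_countable) auto
qed

text \<open>\<open>F\<close> is what colour \<open>j\<close> lacks to \<open>C + 1\<close> draws. It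
  starts at \<open>C + 1\<close>, never increases, and decreases in mean by at least
  \<open>\<delta>\<close> in each step before which at most \<open>C\<close> draws of
  \<open>j\<close> were made. The expected number of such steps is thus finite, and stopping at
  \<open>C\<close> draws forever has probability 0.\<close>

lemma AE_field_infinitely_often:
  assumes D: "j < D"
  shows "AE f in field D b. infinite {i. stack_seq f i = j}"
proof -
  interpret prob_space "field D b" by (rule prob_space_field)
  have D1: "D \<ge> 1" using D by simp
  have "AE f in field D b. \<exists>t. count_list (stack_prefix f t) j > C" for C
  proof -
    \<comment> \<open>The numerator is the least weight of \<open>j\<close> after at most
      \<open>C\<close> draws, the summand 1 allowing for the edge to the parent; the
      \<open>D\<close> weights in the normalisation are at most 1 each.\<close>
    define \<delta> where "\<delta> = exp (- \<beta> * (2 * real C + 1)) / real D"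
    have \<delta>: "\<delta> > 0" using D by (simp add: \<delta>_def)
    have urn_ge: "pmf (urn D b h) j \<ge> \<delta>" if "count_list h j \<le> C" for h
    proof -
      have "(\<Sum>i<D. urn_weight b h i) \<le> real D" using sum_mono[of "{..<D}" "urn_weight b h" "\<lambda>_. 1"] urn_weight_le_1 by simp
      moreover have "\<beta> * (2 * real (count_list h j) + of_bool (b \<and> j = 0)) \<le> \<beta> * (2 * real C + 1)"
        using that beta_pos by (intro mult_left_mono) auto
      then have "exp (- \<beta> * (2 * real C + 1)) \<le> urn_weight b h j" unfolding urn_weight_def by simp
      ultimately show ?thesis using D urn_weight_sum_pos[OF D1] urn_weight_pos[of b h j] by (simp add: pmf_urn[OF D1] \<delta>_def frac_le)
    qed
    define F where "F h = ennreal (real (C + 1 - count_list h j))" for h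
    define B where "B = {f. \<forall>t. count_list (stack_prefix f t) j \<le> C}"
    have Bm: "B \<in> sets (field D b)"
    proof -
      have "{f \<in> space (field D b). \<forall>t. count_list (stack_prefix f t) j \<le> C} \<in> sets (field D b)"
      proof (rule sets.sets_Collect_countable_All)
        fix t
        have "(\<lambda>f. stack_prefix f t) -` {h. count_list h j \<le> C} \<inter> space (field D b) \<in> sets (field D b)"
          by (rule measurable_sets[OF measurable_stack_prefix]) simp
        then show "{f \<in> space (field D b). count_list (stack_prefix f t) j \<le> C} \<in> sets (field D b)"
          by (simp add: vimage_def)
      qed
      then show ?thesis by (simp add: B_def)
    qed
    have urn_step: "(\<integral>\<^sup>+x. F (h @ [x]) \<partial>urn D b h) + ennreal \<delta> * indicator {h. count_list h j \<le> C} h \<le> F h" for h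
    proof (cases "count_list h j \<le> C")
      case True
      have "(\<integral>\<^sup>+x. F (h @ [x]) \<partial>urn D b h) + ennreal \<delta> * indicator {h. count_list h j \<le> C} h
        \<le> (\<integral>\<^sup>+x. F (h @ [x]) \<partial>urn D b h) + (\<integral>\<^sup>+x. indicator {j} x \<partial>urn D b h)"
        using urn_ge[OF True] True by (intro add_left_mono) (simp add: emeasure_pmf_single ennreal_leI)
      also have "\<dots> = (\<integral>\<^sup>+x. F (h @ [x]) + indicator {j} x \<partial>urn D b h)"
        by (rule nn_integral_add[symmetric]) auto
      also have "\<dots> \<le> (\<integral>\<^sup>+x. F h \<partial>urn D b h)"
      proof (intro nn_integral_mono)
        fix x
        have "F (h @ [x]) + indicator {j} x = ennreal (real (C + 1 - count_list (h @ [x]) j) + indicator {j} x)"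
          unfolding F_def by (auto simp: indicator_def)
        also have "\<dots> \<le> F h" unfolding F_def using True by (intro ennreal_leI) (auto simp: indicator_def)
        finally show "F (h @ [x]) + indicator {j} x \<le> F h" .
      qed
      also have "\<dots> = F h" by simp
      finally show ?thesis .
    next
      case False
      have "(\<integral>\<^sup>+x. F (h @ [x]) \<partial>urn D b h) \<le> (\<integral>\<^sup>+x. F h \<partial>urn D b h)"
        by (intro nn_integral_mono) (auto simp: F_def intro!: ennreal_leI)
      then show ?thesis using False by simp
    qed
    have key: "(\<integral>\<^sup>+f. F (stack_prefix f n) \<partial>field D b) + ennreal (real n * \<delta> * prob B) \<le> ennreal (real C + 1)" for n
    proof (induction n)
      case 0
      show ?case using emeasure_space_1 by (simp add: F_def add.commute)
    next
      case (Suc n)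
      have "ennreal (\<delta> * prob B) = (\<integral>\<^sup>+f. ennreal \<delta> * indicator B f \<partial>field D b)"
        using Bm \<delta> by (simp add: nn_integral_cmult_indicator emeasure_eq_measure ennreal_mult')
      also have "\<dots> \<le> (\<integral>\<^sup>+f. ennreal \<delta> * indicator {h. count_list h j \<le> C} (stack_prefix f n) \<partial>field D b)"
        by (intro nn_integral_mono mult_left_mono) (auto simp: B_def indicator_def)
      finally have d: "ennreal (\<delta> * prob B) \<le> \<dots>" .
      have m1: "(\<lambda>f. ennreal \<delta> * indicator {h. count_list h j \<le> C} (stack_prefix f n)) \<in> borel_measurable (field D b)"
        by (rule measurable_compose[OF measurable_stack_prefix]) simp
      have m2: "(\<lambda>f. \<integral>\<^sup>+x. F (stack_prefix f n @ [x]) \<partial>urn D b (stack_prefix f n)) \<in> borel_measurable (field D b)"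
        by (rule measurable_compose[OF measurable_stack_prefix]) simp
      have "(\<integral>\<^sup>+f. F (stack_prefix f (Suc n)) \<partial>field D b) + ennreal (\<delta> * prob B)
         \<le> (\<integral>\<^sup>+f. (\<integral>\<^sup>+x. F (stack_prefix f n @ [x]) \<partial>urn D b (stack_prefix f n)) \<partial>field D b) + (\<integral>\<^sup>+f. ennreal \<delta> * indicator {h. count_list h j \<le> C} (stack_prefix f n) \<partial>field D b)"
        unfolding nn_integral_stack_prefix_Suc by (intro add_left_mono d)
      also have "\<dots> = (\<integral>\<^sup>+f. (\<integral>\<^sup>+x. F (stack_prefix f n @ [x]) \<partial>urn D b (stack_prefix f n)) + ennreal \<delta> * indicator {h. count_list h j \<le> C} (stack_prefix f n) \<partial>field D b)"
        using m1 m2 by (rule nn_integral_add[symmetric, rotated])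
      also have "\<dots> \<le> (\<integral>\<^sup>+f. F (stack_prefix f n) \<partial>field D b)" by (intro nn_integral_mono urn_step)
      finally have *: "(\<integral>\<^sup>+f. F (stack_prefix f (Suc n)) \<partial>field D b) + ennreal (\<delta> * prob B) \<le> (\<integral>\<^sup>+f. F (stack_prefix f n) \<partial>field D b)" .
      have "real (Suc n) * \<delta> * prob B = \<delta> * prob B + real n * \<delta> * prob B" by (simp add: algebra_simps)
      then have "ennreal (real (Suc n) * \<delta> * prob B) = ennreal (\<delta> * prob B) + ennreal (real n * \<delta> * prob B)"
        using \<delta> by (simp add: ennreal_plus)
      then have "(\<integral>\<^sup>+f. F (stack_prefix f (Suc n)) \<partial>field D b) + ennreal (real (Suc n) * \<delta> * prob B)
        = ((\<integral>\<^sup>+f. F (stack_prefix f (Suc n)) \<partial>field D b) + ennreal (\<delta> * prob B)) + ennreal (real n * \<delta> * prob B)"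
        by (simp only: add.assoc)
      also have "\<dots> \<le> (\<integral>\<^sup>+f. F (stack_prefix f n) \<partial>field D b) + ennreal (real n * \<delta> * prob B)" by (intro add_right_mono *)
      also have "\<dots> \<le> ennreal (real C + 1)" by (rule Suc)
      finally show ?case .
    qed
    have "prob B = 0"
    proof (rule ccontr)
      assume "prob B \<noteq> 0"
      then have p: "\<delta> * prob B > 0" using \<delta> by (simp add: zero_less_measure_iff)
      then obtain n where n: "real n * (\<delta> * prob B) > real C + 1" using reals_Archimedean3 by blast
      have "ennreal (real n * \<delta> * prob B) \<le> ennreal (real C + 1)"
        by (rule order_trans[OF _ key[of n]]) simp
      then have "real n * \<delta> * prob B \<le> real C + 1" by (subst (asm) ennreal_le_iff) auto
      then show False using n by (simp add: mult.assoc)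
    qed
    then have "AE f in field D b. f \<notin> B" using prob_eq_0[OF Bm] by simp
    then show ?thesis by eventually_elim (auto simp: B_def not_le)
  qed
  then have "AE f in field D b. \<forall>C. \<exists>t. count_list (stack_prefix f t) j > C" by (subst AE_all_countable) auto
  then show ?thesis
  proof eventually_elim
    case (elim f)
    show ?case
    proof
      assume fin: "finite {i. stack_seq f i = j}"
      obtain t where "count_list (stack_prefix f t) j > card {i. stack_seq f i = j}" using elim by blast
      moreover have "card {i. i < t \<and> stack_seq f i = j} \<le> card {i. stack_seq f i = j}" using fin by (intro card_mono) auto
      ultimately show False by (simp add: count_stack_prefix)
    qed
  qed
qed

lemma AE_field_good:
  assumes D: "D \<ge> 1"
  shows "AE f in field D b. good_seq D (stack_seq f)"
proof -
  have "AE f in field D b. \<forall>j\<in>{..<D}. infinite {i. stack_seq f i = j}"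
    by (subst AE_ball_countable) (auto intro: AE_field_infinitely_often)
  with AE_field_in_range[OF D] show ?thesis
    by eventually_elim (auto simp: good_seq_def stack_seq_def)
qed

text \<open>The probability, given the history \<open>h\<close>, that \<open>j\<close> is drawn \<open>m\<close> times before the \<open>k\<close>-th 0.\<close>

definition race_state :: "nat \<Rightarrow> nat \<Rightarrow> nat \<Rightarrow> nat list \<Rightarrow> real" where
  "race_state j k m h = race (int (min k (count_list h 0)) - int (count_before_list h j k)) (k - count_list h 0) (m - count_before_list h j k)"

lemma race_state_nonneg: "race_state j k m h \<ge> 0" by (simp add: race_state_def race_nonneg)

text \<open>Draws of other colours leave the state alone, and the odds between 0 and
  \<open>j\<close> depend only on the difference of their counts. Conditioning on the next relevant
  draw is then \<open>race_forward\<close>.\<close>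

lemma race_state_harmonic:
  assumes j: "1 \<le> j" "j < D"
  shows "(\<integral>\<^sup>+x. ennreal (race_state j k m (h @ [x])) \<partial>urn D True h) = ennreal (race_state j k m h)"
proof -
  have D: "D \<ge> 1" using j by simp
  consider "count_list h 0 \<ge> k" | "count_before_list h j k \<ge> m" | "count_list h 0 < k" "count_before_list h j k < m" by linarith
  then show ?thesis
  proof cases
    case 1
    then have "race_state j k m (h @ [x]) = race_state j k m h" for x by (simp add: race_state_def count_before_list_snoc min_def)
    then show ?thesis by simp
  next
    case 2
    then have "race_state j k m (h @ [x]) = 1" "race_state j k m h = 1" for x by (simp_all add: race_state_def count_before_list_snoc)
    then show ?thesis by simp
  next
    case 3
    define l where "l = count_list h 0"
    define r where "r = count_list h j"
    have r: "count_before_list h j k = r" using count_before_list_eq_count[OF 3(1)] by (simp add: r_def)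
    obtain i where i: "k - l = Suc i" using 3(1) unfolding l_def by (metis Suc_diff_Suc)
    obtain i' where i': "m - r = Suc i'" using 3(2) unfolding r by (metis Suc_diff_Suc)
    define z where "z = int l - int r"
    have minl: "min k l = l" "min k (Suc l) = Suc l" using 3(1) by (auto simp: l_def)
    have P: "race_state j k m h = race z (Suc i) (Suc i')"
      using i i' minl by (simp add: race_state_def l_def[symmetric] r z_def)
    have P0: "race_state j k m (h @ [0]) = race (z + 1) i (Suc i')"
    proof -
      have "k - Suc l = i" using i by simp
      moreover have "int (Suc l) - int r = z + 1" by (simp add: z_def)
      ultimately show ?thesis using i' minl j by (simp add: race_state_def count_before_list_snoc l_def[symmetric] r z_def algebra_simps)
    qed
    have Pj: "race_state j k m (h @ [j]) = race (z - 1) (Suc i) i'"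
    proof -
      have "m - Suc r = i'" using i' by simp
      moreover have "int l - int (Suc r) = z - 1" by (simp add: z_def)
      ultimately show ?thesis using i minl j 3(1) by (simp add: race_state_def count_before_list_snoc l_def[symmetric] r z_def algebra_simps)
    qed
    have Px: "race_state j k m (h @ [x]) = race_state j k m h" if "x \<noteq> 0" "x \<noteq> j" for x
      using that by (simp add: race_state_def count_before_list_snoc)
    let ?W = "\<Sum>i<D. urn_weight True h i"
    let ?p = "\<lambda>x. urn_weight True h x / ?W"
    have W: "?W > 0" by (rule urn_weight_sum_pos[OF D])
    have p: "pmf (urn D True h) x = (if x < D then ?p x else 0)" for x by (rule pmf_urn[OF D])
    have q: "?p 0 = step_down z * (?p 0 + ?p j)" "?p j = step_up z * (?p 0 + ?p j)"
    proof -
      have e0: "urn_weight True h 0 = exp (- \<beta> * (2 * real_of_int z + 1)) * urn_weight True h j"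
        unfolding urn_weight_def z_def l_def r_def using j by (simp add: algebra_simps flip: exp_add)
      have s: "urn_weight True h 0 + urn_weight True h j > 0" using urn_weight_pos by (simp add: add_pos_pos)
      have R: "step_up z = urn_weight True h j / (urn_weight True h 0 + urn_weight True h j)"
      proof -
        have "urn_weight True h 0 + urn_weight True h j = (1 + exp (- \<beta> * (2 * real_of_int z + 1))) * urn_weight True h j"
          unfolding e0 by (simp only: algebra_simps mult_1_left)
        then show ?thesis unfolding step_up_def using urn_weight_pos[of True h j] by simp
      qed
      then have L: "step_down z = urn_weight True h 0 / (urn_weight True h 0 + urn_weight True h j)"
        unfolding step_down_def using s by (simp add: field_simps)
      show "?p 0 = step_down z * (?p 0 + ?p j)" "?p j = step_up z * (?p 0 + ?p j)"
        unfolding L R add_divide_distrib[symmetric] using s by simp_all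
    qed
    have "measure_pmf.expectation (urn D True h) (\<lambda>x. race_state j k m (h @ [x])) = (\<Sum>x<D. race_state j k m (h @ [x]) * ?p x)"
      by (subst integral_measure_pmf_real[where A="{..<D}"]) (use set_pmf_urn[OF D] p in auto)
    also have "\<dots> = (\<Sum>x<D. race_state j k m h * ?p x
        + (if x = 0 then (race_state j k m (h @ [0]) - race_state j k m h) * ?p 0 else 0)
        + (if x = j then (race_state j k m (h @ [j]) - race_state j k m h) * ?p j else 0))"
      using j by (intro sum.cong) (auto simp: Px left_diff_distrib diff_divide_distrib)
    also have "\<dots> = race_state j k m h * (\<Sum>x<D. ?p x) + (race_state j k m (h @ [0]) - race_state j k m h) * ?p 0
        + (race_state j k m (h @ [j]) - race_state j k m h) * ?p j"
      using j by (simp add: sum.distrib sum_distrib_left sum.delta)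
    also have "(\<Sum>x<D. ?p x) = 1" using W by (simp add: sum_divide_distrib[symmetric])
    also have "race_state j k m h * 1 + (race_state j k m (h @ [0]) - race_state j k m h) * ?p 0 + (race_state j k m (h @ [j]) - race_state j k m h) * ?p j
        = race_state j k m h"
    proof -
      have f: "race_state j k m h = step_down z * race_state j k m (h @ [0]) + step_up z * race_state j k m (h @ [j])"
        unfolding P P0 Pj by (rule race_forward)
      have "(race_state j k m (h @ [0]) - race_state j k m h) * ?p 0 + (race_state j k m (h @ [j]) - race_state j k m h) * ?p j
        = (?p 0 + ?p j) * (step_down z * race_state j k m (h @ [0]) + step_up z * race_state j k m (h @ [j]) - (step_down z + step_up z) * race_state j k m h)"
      proof -
        define s where "s = ?p 0 + ?p j"
        have q': "?p 0 = step_down z * s" "?p j = step_up z * s" unfolding s_def by (rule q)+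
        have gen: "(a - f) * (l * s) + (b - f) * (r * s) = s * (l * a + r * b - (l + r) * f)" for a b f l r :: real
          by (simp add: algebra_simps)
        show ?thesis unfolding s_def[symmetric] unfolding q' by (rule gen)
      qed
      also have "\<dots> = 0" using f step_down_step_up[of z] by simp
      finally show ?thesis by simp
    qed
    finally have E: "measure_pmf.expectation (urn D True h) (\<lambda>x. race_state j k m (h @ [x])) = race_state j k m h" .
    have "(\<integral>\<^sup>+x. ennreal (race_state j k m (h @ [x])) \<partial>urn D True h) = ennreal (measure_pmf.expectation (urn D True h) (\<lambda>x. race_state j k m (h @ [x])))"
      by (rule nn_integral_eq_integral)
         (auto simp: race_state_def race_nonneg race_le_1 intro!: measure_pmf.integrable_const_bound[where B=1])
    then show ?thesis using E by simp
  qed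
qed

lemma measurable_count_before [measurable]:
  assumes "\<And>i. (\<lambda>w. s w i) \<in> measurable M (count_space UNIV)"
  shows "(\<lambda>w. count_before (s w) j k) \<in> measurable M (count_space UNIV)"
proof -
  note [measurable] = assms
  show ?thesis unfolding count_before_def
  proof (rule measurable_card)
    fix i
    have c: "(\<lambda>w. card {i'. i' < i \<and> s w i' = 0}) \<in> measurable M (count_space UNIV)"
      by (rule measurable_card) simp
    note [measurable] = c
    show "{w \<in> space M. i \<in> {i. s w i = j \<and> card {i'. i' < i \<and> s w i' = 0} < k}} \<in> sets M" by simp
  qed
qed

text \<open>\<open>race_state\<close> is a bounded martingale along the stack with initial value
  \<open>race 0 k m\<close>. From the \<open>k\<close>-th 0 onwards it equals the indicator of the
  event, so dominated convergence carries its mean to the probability.\<close>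

lemma count_before_tail:
  assumes j: "1 \<le> j" "j < D"
  shows "measure (field D True) {f. count_before (stack_seq f) j k \<ge> m} = race 0 k m"
proof -
  interpret prob_space "field D True" by (rule prob_space_field)
  let ?F = "field D True"
  have P0: "(\<integral>\<^sup>+f. ennreal (race_state j k m (stack_prefix f t)) \<partial>?F) = ennreal (race 0 k m)" for t
  proof (induction t)
    case 0
    show ?case using emeasure_space_1 by (simp add: race_state_def)
  next
    case (Suc t)
    have "(\<integral>\<^sup>+f. ennreal (race_state j k m (stack_prefix f (Suc t))) \<partial>?F) = (\<integral>\<^sup>+f. (\<integral>\<^sup>+x. ennreal (race_state j k m (stack_prefix f t @ [x])) \<partial>urn D True (stack_prefix f t)) \<partial>?F)"
      by (rule nn_integral_stack_prefix_Suc[where g="\<lambda>h. ennreal (race_state j k m h)"])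
    then show ?case using Suc by (simp only: race_state_harmonic[OF j])
  qed
  have mP: "(\<lambda>f. race_state j k m (stack_prefix f t)) \<in> borel_measurable ?F" for t
    by (rule measurable_compose[OF measurable_stack_prefix]) simp
  have P1: "expectation (\<lambda>f. race_state j k m (stack_prefix f t)) = race 0 k m" for t
    using mP race_state_nonneg race_nonneg by (subst integral_eq_nn_integral) (auto simp: P0)
  have lim: "AE f in ?F. (\<lambda>t. race_state j k m (stack_prefix f t)) \<longlonglongrightarrow> indicator {f. count_before (stack_seq f) j k \<ge> m} f"
  proof -
    have "AE f in ?F. good_seq D (stack_seq f)" by (rule AE_field_good) (use j in simp)
    then show ?thesis
    proof eventually_elim
      case (elim f)
      then have inf0: "infinite {i. stack_seq f i = 0}" using j by (auto simp: good_seq_def)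
      obtain t0 where t0: "\<And>i. card {i'. i' < i \<and> stack_seq f i' = 0} < k \<Longrightarrow> i < t0"
        using finite_before_kth[OF inf0] by blast
      have "race_state j k m (stack_prefix f t) = indicator {f. count_before (stack_seq f) j k \<ge> m} f" if t: "t \<ge> t0" for t
      proof -
        have "{i. i < t \<and> stack_seq f i = j \<and> card {i'. i' < i \<and> stack_seq f i' = 0} < k} = {i. stack_seq f i = j \<and> card {i'. i' < i \<and> stack_seq f i' = 0} < k}"
          using t0 t by fastforce
        then have N: "count_before_list (stack_prefix f t) j k = count_before (stack_seq f) j k" by (simp add: count_before_list_stack_prefix count_before_def)
        have "\<not> card {i'. i' < t \<and> stack_seq f i' = 0} < k" using t0[of t] t by auto
        then have c: "k - count_list (stack_prefix f t) 0 = 0" by (simp add: count_stack_prefix)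
        show ?thesis unfolding race_state_def N c by (cases "m - count_before (stack_seq f) j k") (auto simp: indicator_def)
      qed
      then have "\<forall>\<^sub>F t in sequentially. race_state j k m (stack_prefix f t) = indicator {f. count_before (stack_seq f) j k \<ge> m} f"
        by (auto simp: eventually_sequentially)
      then show ?case by (rule tendsto_eventually)
    qed
  qed
  have Nm: "(\<lambda>f. count_before (stack_seq f) j k) \<in> measurable ?F (count_space UNIV)"
    by (rule measurable_count_before) simp
  have Sm: "{f. count_before (stack_seq f) j k \<ge> m} \<in> sets ?F"
    using measurable_sets[OF Nm, of "{m..}"] by (simp add: vimage_def)
  have "(\<lambda>t. expectation (\<lambda>f. race_state j k m (stack_prefix f t))) \<longlonglongrightarrow> expectation (indicator {f. count_before (stack_seq f) j k \<ge> m})"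
    using lim mP Sm by (intro integral_dominated_convergence[where w="\<lambda>_. 1"])
      (auto simp: race_state_def race_nonneg race_le_1)
  then have "expectation (indicator {f. count_before (stack_seq f) j k \<ge> m}) = race 0 k m"
    unfolding P1 using LIMSEQ_unique tendsto_const by blast
  then show ?thesis by simp
qed

text \<open>Neither the number \<open>D\<close> of colours nor the choice of \<open>j\<close> enters
  the law. Hence the numbers of entries along every ray form the same Markov chain, whatever the
  degrees of the tree.\<close>

lemma distr_count_before:
  assumes j: "1 \<le> j" "j < D"
  shows "distr (field D True) (count_space UNIV) (\<lambda>f. count_before (stack_seq f) j k) = measure_pmf (kern k)"
proof (rule measure_eqI_countable[where A=UNIV])
  interpret prob_space "field D True" by (rule prob_space_field)
  let ?F = "field D True"
  have Nm: "(\<lambda>f. count_before (stack_seq f) j k) \<in> measurable ?F (count_space UNIV)"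
    by (rule measurable_count_before) simp
  fix m :: nat
  have Sm: "{f. count_before (stack_seq f) j k \<ge> m} \<in> sets ?F" for m
    using measurable_sets[OF Nm, of "{m..}"] by (simp add: vimage_def)
  have "emeasure (distr ?F (count_space UNIV) (\<lambda>f. count_before (stack_seq f) j k)) {m} = emeasure ?F {f. count_before (stack_seq f) j k = m}"
    by (subst emeasure_distr[OF Nm]) (auto simp: vimage_def)
  also have "{f. count_before (stack_seq f) j k = m} = {f. count_before (stack_seq f) j k \<ge> m} - {f. count_before (stack_seq f) j k \<ge> Suc m}" by auto
  also have "emeasure ?F \<dots> = ennreal (measure ?F {f. count_before (stack_seq f) j k \<ge> m} - measure ?F {f. count_before (stack_seq f) j k \<ge> Suc m})"
    unfolding emeasure_eq_measure by (subst finite_measure_Diff) (use Sm in auto)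
  also have "\<dots> = ennreal (kern_prob k m)" by (simp only: count_before_tail[OF j] kern_prob_def)
  finally show "emeasure (distr ?F (count_space UNIV) (\<lambda>f. count_before (stack_seq f) j k)) {m} = emeasure (measure_pmf (kern k)) {m}"
    by (simp add: emeasure_pmf_single pmf_kern)
qed auto

lemma nn_integral_count_before:
  fixes \<phi> :: "nat \<Rightarrow> ennreal"
  assumes "1 \<le> j" "j < D"
  shows "(\<integral>\<^sup>+f. \<phi> (count_before (stack_seq f) j k) \<partial>field D True) = (\<integral>\<^sup>+y. \<phi> y \<partial>kern k)"
proof -
  have Nm: "(\<lambda>f. count_before (stack_seq f) j k) \<in> measurable (field D True) (count_space UNIV)"
    by (rule measurable_count_before) simp
  have "(\<integral>\<^sup>+f. \<phi> (count_before (stack_seq f) j k) \<partial>field D True) = (\<integral>\<^sup>+y. \<phi> y \<partial>distr (field D True) (count_space UNIV) (\<lambda>f. count_before (stack_seq f) j k))"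
    by (rule nn_integral_distr[OF Nm, symmetric]) simp
  then show ?thesis by (simp only: distr_count_before[OF assms])
qed

end

section \<open>Trees, cutsets and flows\<close>

lemma sum_UN_le:
  fixes c :: "'b \<Rightarrow> real"
  assumes "finite I" "\<And>i. i \<in> I \<Longrightarrow> finite (A i)" "\<And>x. c x \<ge> 0"
  shows "sum c (\<Union>i\<in>I. A i) \<le> (\<Sum>i\<in>I. sum c (A i))"
  using assms(1,2)
proof (induction I)
  case (insert i I)
  have "sum c (A i \<union> (\<Union>i\<in>I. A i)) \<le> sum c (A i) + sum c (\<Union>i\<in>I. A i)"
    using insert assms(3) by (subst sum_Un) (auto intro!: sum_nonneg)
  then show ?case using insert by simp
qed simp

section \<open>Levels, parents and subtrees\<close>

context rooted_tree
begin

definition lev :: "'a \<Rightarrow> nat" where "lev x = graph_dist V E \<rho> x"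

lemma adj_in_V: "{x, y} \<in> E \<Longrightarrow> x \<in> V \<and> y \<in> V \<and> x \<noteq> y"
  using edgeD[of "{x, y}"] by (auto simp: doubleton_eq_iff)

lemma geodesic:
  assumes "x \<in> V"
  obtains p where "is_walk V E p" "hd p = \<rho>" "last p = x" "length p = Suc (lev x)"
proof -
  obtain p where p: "is_walk V E p" "hd p = \<rho>" "last p = x" using connected[OF root_in_V assms] by blast
  then have "length p = Suc (length p - 1)" by (cases p) (auto simp: is_walk_def)
  then have "\<exists>n p. is_walk V E p \<and> hd p = \<rho> \<and> last p = x \<and> length p = Suc n" using p by blast
  then have "\<exists>p. is_walk V E p \<and> hd p = \<rho> \<and> last p = x \<and> length p = Suc (lev x)"
    unfolding lev_def graph_dist_def by (rule LeastI_ex)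
  then show ?thesis using that by blast
qed

lemma lev_le: "is_walk V E p \<Longrightarrow> hd p = \<rho> \<Longrightarrow> last p = x \<Longrightarrow> length p = Suc n \<Longrightarrow> lev x \<le> n"
  unfolding lev_def graph_dist_def by (rule Least_le) blast

lemma lev_root [simp]: "lev \<rho> = 0"
proof -
  have "is_walk V E [\<rho>]" using root_in_V by (simp add: is_walk_def)
  then show ?thesis using lev_le[of "[\<rho>]" \<rho> 0] by simp
qed

lemma lev_eq_0: "x \<in> V \<Longrightarrow> lev x = 0 \<longleftrightarrow> x = \<rho>"
proof
  assume x: "x \<in> V" and 0: "lev x = 0"
  obtain p where p: "hd p = \<rho>" "last p = x" "length p = Suc (lev x)" using geodesic[OF x] by blast
  then obtain y where "p = [y]" using 0 by (auto simp: length_Suc_conv)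
  then show "x = \<rho>" using p by simp
qed simp

lemma walk_snoc: "is_walk V E p \<Longrightarrow> {last p, y} \<in> E \<Longrightarrow> is_walk V E (p @ [y])"
  using adj_in_V[of "last p" y] by (auto simp: is_walk_def successively_append_iff)

lemma lev_adj: "{x, y} \<in> E \<Longrightarrow> lev y \<le> Suc (lev x)"
proof -
  assume e: "{x, y} \<in> E"
  obtain p where p: "is_walk V E p" "hd p = \<rho>" "last p = x" "length p = Suc (lev x)"
    using geodesic[of x] adj_in_V[OF e] by blast
  have "is_walk V E (p @ [y])" using walk_snoc[OF p(1)] p(3) e by simp
  moreover have "hd (p @ [y]) = \<rho>" using p by (cases p) auto
  ultimately show ?thesis using lev_le[of "p @ [y]" y "Suc (lev x)"] p by simp
qed

text \<open>The level rises by at most 1 along an edge, and a walk that climbs from 0 to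
  \<open>lev x\<close> in \<open>lev x\<close> steps has no slack.\<close>

lemma geodesic_lev:
  assumes p: "is_walk V E p" "hd p = \<rho>" "last p = x" "length p = Suc (lev x)" and i: "i \<le> lev x"
  shows "lev (p ! i) = i"
proof -
  have step: "lev (p ! Suc i) \<le> Suc (lev (p ! i))" if "Suc i \<le> lev x" for i
    using p that by (intro lev_adj) (auto simp: is_walk_def successively_conv_nth)
  have up: "lev (p ! i) \<le> i" if "i \<le> lev x" for i
    using that
  proof (induction i)
    case 0
    then show ?case using p by (cases p) auto
  next
    case (Suc i)
    then show ?case using step[of i] by simp
  qed
  have down: "lev x \<le> lev (p ! (lev x - d)) + d" if "d \<le> lev x" for d
    using that
  proof (induction d)
    case 0
    have "p ! lev x = x" using p by (metis diff_Suc_1 last_conv_nth length_0_conv nat.distinct(1))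
    then show ?case by simp
  next
    case (Suc d)
    then have "Suc (lev x - Suc d) = lev x - d" by simp
    then have "lev (p ! (lev x - d)) \<le> Suc (lev (p ! (lev x - Suc d)))" using step[of "lev x - Suc d"] Suc.prems by simp
    then show ?case using Suc by simp
  qed
  show ?thesis using up[OF i] down[of "lev x - i"] i by simp
qed

text \<open>Loop erasure: the closed part between two visits of one vertex is cut out.\<close>

lemma walk_to_path:
  assumes "is_walk V E p"
  obtains q where "is_walk V E q" "distinct q" "hd q = hd p" "last q = last p" "set q \<subseteq> set p"
  using assms
proof (induction "length p" arbitrary: p thesis rule: less_induct)
  case less
  show ?case
  proof (cases "distinct p")
    case True
    then show ?thesis using less.prems by blast
  next
    case False
    then obtain xs ys zs y where p: "p = xs @ [y] @ ys @ [y] @ zs" using not_distinct_decomp by blast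
    let ?p = "xs @ [y] @ zs"
    have s: "successively (\<lambda>x y. {x, y} \<in> E) p" "set p \<subseteq> V" using less.prems by (auto simp: is_walk_def)
    then have "successively (\<lambda>x y. {x, y} \<in> E) ?p" unfolding p by (auto simp: successively_append_iff successively_Cons)
    then have w: "is_walk V E ?p" using s unfolding p is_walk_def by auto
    obtain q where "is_walk V E q" "distinct q" "hd q = hd ?p" "last q = last ?p" "set q \<subseteq> set ?p"
      using less.hyps[of ?p] w p by auto
    moreover have "hd ?p = hd p" "set ?p \<subseteq> set p" unfolding p by (cases xs; auto)+
    moreover have "last ?p = last p" unfolding p by (cases zs rule: rev_cases) auto
    ultimately show ?thesis by (intro less.prems(1)[of q]) (simp_all only: order_trans)
  qed
qed

text \<open>Otherwise the geodesics to \<open>y\<close> and \<open>z\<close>, joined at the root,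
  contain a path from \<open>z\<close> to \<open>y\<close> that avoids \<open>x\<close>, and
  \<open>x\<close> closes it to a cycle. Allowing neighbours on the same level has a purpose: since
  a lower neighbour exists off the root, edges inside a level are excluded too.\<close>

lemma unique_lower_neighbour:
  assumes y: "{x, y} \<in> E" "lev y \<le> lev x" and z: "{x, z} \<in> E" "lev z \<le> lev x"
  shows "y = z"
proof (rule ccontr)
  assume ne: "y \<noteq> z"
  have V: "x \<in> V" "y \<in> V" "z \<in> V" using adj_in_V y z by blast+
  \<comment> \<open>A geodesic meets level \<open>i\<close> only at its \<open>i\<close>-th vertex,
    so \<open>x\<close> could only be its endpoint \<open>u\<close>, but \<open>x\<close> is not
    adjacent to itself.\<close>
  have avoid: "x \<notin> set g" if g: "is_walk V E g" "hd g = \<rho>" "last g = u" "length g = Suc (lev u)" and u: "{x, u} \<in> E" "lev u \<le> lev x" for g u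
  proof
    assume "x \<in> set g"
    then obtain i where "i < length g" "g ! i = x" unfolding in_set_conv_nth by blast
    then have i: "i \<le> lev u" "g ! i = x" using g(4) by auto
    then have "lev x = i" using geodesic_lev[OF g i(1)] by simp
    then have "i = lev u" using i u by simp
    then have "x = u" using i g by (metis diff_Suc_1 last_conv_nth length_0_conv nat.distinct(1))
    then show False using adj_in_V[OF u(1)] by simp
  qed
  obtain gy where gy: "is_walk V E gy" "hd gy = \<rho>" "last gy = y" "length gy = Suc (lev y)" using geodesic[OF V(2)] by blast
  obtain gz where gz: "is_walk V E gz" "hd gz = \<rho>" "last gz = z" "length gz = Suc (lev z)" using geodesic[OF V(3)] by blast
  obtain gy' where gy': "gy = \<rho> # gy'" using gy by (cases gy) (auto simp: is_walk_def)
  define p where "p = rev gz @ gy'"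
  have rz: "successively (\<lambda>x y. {x, y} \<in> E) (rev gz)"
    using gz by (simp add: is_walk_def successively_rev insert_commute)
  have lz: "last (rev gz) = \<rho>" using gz by (simp add: last_rev)
  have gzne: "gz \<noteq> []" using gz by (auto simp: is_walk_def)
  have "successively (\<lambda>x y. {x, y} \<in> E) p"
    unfolding p_def successively_append_iff using rz lz gy gy' by (auto simp: is_walk_def successively_Cons)
  moreover have "set p \<subseteq> V" unfolding p_def using gy gz gy' by (auto simp: is_walk_def)
  ultimately have p: "is_walk V E p" unfolding is_walk_def using gzne by (auto simp: p_def)
  have hp: "hd p = z" unfolding p_def using gz gzne by (simp add: hd_append hd_rev)
  have lp: "last p = y"
  proof (cases "gy' = []")
    case True
    then have "y = \<rho>" using gy gy' by simp
    then show ?thesis unfolding p_def using True lz by simp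
  next
    case False
    then show ?thesis unfolding p_def using gy gy' by simp
  qed
  have xp: "x \<notin> set p" unfolding p_def using avoid[OF gy y] avoid[OF gz z] gy' by auto
  obtain q where q: "is_walk V E q" "distinct q" "hd q = hd p" "last q = last p" "set q \<subseteq> set p"
    using walk_to_path[OF p] by blast
  obtain a q' where qq: "q = a # q'" using q by (cases q) (auto simp: is_walk_def)
  have "q' \<noteq> []" using qq q hp lp ne by auto
  then have len: "3 \<le> length (x # q)" using qq by (cases q') auto
  have w: "is_walk V E (x # q)" using q(1) z(1) hp q(3) V(1) by (auto simp: is_walk_def successively_Cons)
  have "is_cycle V E (x # q)" unfolding is_cycle_def
    using w q xp len y(1) lp by (auto simp: qq insert_commute)
  then show False using no_cycle by blast
qed

text \<open>The root and everything outside \<open>V\<close> are sent to the root, so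
  \<open>par\<close> can be iterated freely; \<open>in_subtree\<close> relies on this.\<close>

definition par :: "'a \<Rightarrow> 'a" where
  "par x = (if x \<in> V \<and> x \<noteq> \<rho> then THE y. {x, y} \<in> E \<and> lev y < lev x else \<rho>)"

lemma par_root [simp]: "par \<rho> = \<rho>" by (simp add: par_def)

lemma par_unique: "{x, y} \<in> E \<Longrightarrow> lev y \<le> lev x \<Longrightarrow> par x = y"
  and par_props: "x \<in> V \<Longrightarrow> x \<noteq> \<rho> \<Longrightarrow> {x, par x} \<in> E \<and> Suc (lev (par x)) = lev x"
proof -
  have ex: "\<exists>y. {x, y} \<in> E \<and> Suc (lev y) = lev x" if x: "x \<in> V" "x \<noteq> \<rho>" for x
  proof -
    obtain p where p: "is_walk V E p" "hd p = \<rho>" "last p = x" "length p = Suc (lev x)" using geodesic[OF x(1)] by blast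
    obtain n where n: "lev x = Suc n" using lev_eq_0[OF x(1)] x(2) by (cases "lev x") auto
    have px: "p ! Suc n = x" using p n by (metis diff_Suc_1 last_conv_nth length_0_conv nat.distinct(1))
    have "{p ! n, p ! Suc n} \<in> E" using p n by (auto simp: is_walk_def successively_conv_nth)
    then have "{x, p ! n} \<in> E" using px by (simp add: insert_commute)
    moreover have "lev (p ! n) = n" by (rule geodesic_lev[OF p]) (simp add: n)
    ultimately show ?thesis using n by auto
  qed
  have props: "{x, par x} \<in> E \<and> lev (par x) < lev x" if x: "x \<in> V" "x \<noteq> \<rho>" for x
  proof -
    obtain y where y: "{x, y} \<in> E" "Suc (lev y) = lev x" using ex[OF x] by blast
    have "\<exists>!y. {x, y} \<in> E \<and> lev y < lev x"
      using y unique_lower_neighbour[of x] by (metis lessI less_imp_le)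
    from theI'[OF this] show ?thesis using x by (simp add: par_def)
  qed
  show "par x = y" if y: "{x, y} \<in> E" "lev y \<le> lev x"
  proof -
    have x: "x \<in> V" "y \<in> V" "x \<noteq> y" using adj_in_V[OF y(1)] by auto
    have "x \<noteq> \<rho>" using x y lev_eq_0[OF x(2)] by auto
    then show ?thesis using props[of x] unique_lower_neighbour[of x "par x" y] x y by simp
  qed
  show "{x, par x} \<in> E \<and> Suc (lev (par x)) = lev x" if x: "x \<in> V" "x \<noteq> \<rho>"
  proof -
    obtain y where y: "{x, y} \<in> E" "Suc (lev y) = lev x" using ex[OF x] by blast
    have "par x = y" using unique_lower_neighbour[of x "par x" y] props[OF x] y by simp
    then show ?thesis using y by simp
  qed
qed

lemma par_in_V [simp]: "par x \<in> V"
proof (cases "x \<in> V \<and> x \<noteq> \<rho>")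
  case True
  then show ?thesis using par_props[of x] adj_in_V[of x "par x"] by blast
next
  case False
  then have "par x = \<rho>" unfolding par_def by (rule if_not_P)
  then show ?thesis using root_in_V by simp
qed

definition ch :: "'a \<Rightarrow> 'a set" where "ch x = {y \<in> V. y \<noteq> \<rho> \<and> par y = x}"

lemma ch_iff: "y \<in> ch x \<longleftrightarrow> {x, y} \<in> E \<and> lev y = Suc (lev x)"
proof
  assume "y \<in> ch x"
  then show "{x, y} \<in> E \<and> lev y = Suc (lev x)" using par_props[of y] by (auto simp: ch_def insert_commute)
next
  assume "{x, y} \<in> E \<and> lev y = Suc (lev x)"
  then show "y \<in> ch x" using par_unique[of y x] adj_in_V[of x y] by (auto simp: ch_def insert_commute)
qed

lemma chD: "y \<in> ch x \<Longrightarrow> y \<in> V \<and> y \<noteq> \<rho> \<and> par y = x \<and> lev y = Suc (lev x) \<and> {x, y} \<in> E \<and> x \<in> V"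
proof -
  assume y: "y \<in> ch x"
  then have "y \<in> V \<and> y \<noteq> \<rho> \<and> par y = x" by (simp add: ch_def)
  moreover have "{x, y} \<in> E \<and> lev y = Suc (lev x)" using y by (simp only: ch_iff)
  ultimately show ?thesis using adj_in_V[of x y] by blast
qed

lemma ch_par: "y \<in> V \<Longrightarrow> y \<noteq> \<rho> \<Longrightarrow> y \<in> ch (par y)"
  by (simp add: ch_def)

lemma neighbours_eq: "x \<in> V \<Longrightarrow> neighbours E x = ch x \<union> (if x = \<rho> then {} else {par x})"
proof (intro equalityI subsetI)
  fix y assume x: "x \<in> V" and y: "y \<in> neighbours E x"
  then have e: "{x, y} \<in> E" by (simp add: neighbours_def)
  show "y \<in> ch x \<union> (if x = \<rho> then {} else {par x})"
  proof (cases "lev y \<le> lev x")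
    case True
    then have "par x = y" using par_unique e by blast
    moreover have "x \<noteq> \<rho>" using True e adj_in_V[OF e] lev_eq_0[of y] by auto
    ultimately show ?thesis by simp
  next
    case False
    then have "lev y = Suc (lev x)" using lev_adj[OF e] by simp
    then show ?thesis using e by (simp add: ch_iff)
  qed
next
  fix y assume "x \<in> V" "y \<in> ch x \<union> (if x = \<rho> then {} else {par x})"
  then show "y \<in> neighbours E x" using par_props[of x] by (auto simp: neighbours_def ch_iff split: if_splits)
qed

lemma par_notin_ch: "x \<in> V \<Longrightarrow> x \<noteq> \<rho> \<Longrightarrow> par x \<notin> ch x"
  using par_props[of x] by (auto simp: ch_iff)

lemma edge_parent_child:
  assumes "e \<in> E"
  obtains y where "y \<in> V" "y \<noteq> \<rho>" "e = {par y, y}"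
proof -
  obtain u v where uv: "e = {u, v}" "u \<in> V" "v \<in> V" using edgeD[OF assms] by blast
  then have e: "{u, v} \<in> E" using assms by simp
  show ?thesis
  proof (cases "lev v \<le> lev u")
    case True
    then have "par u = v" using par_unique e by blast
    moreover have "u \<noteq> \<rho>" using True e adj_in_V[OF e] lev_eq_0[of v] by auto
    ultimately show ?thesis using that[of u] uv by (simp add: insert_commute)
  next
    case False
    then have "par v = u" using par_unique[of v u] e by (simp add: insert_commute)
    moreover have "v \<noteq> \<rho>" using False by auto
    ultimately show ?thesis using that[of v] uv by (simp add: insert_commute)
  qed
qed

lemma edge_inj: "y \<in> V \<Longrightarrow> y \<noteq> \<rho> \<Longrightarrow> z \<in> V \<Longrightarrow> z \<noteq> \<rho> \<Longrightarrow> {par y, y} = {par z, z} \<Longrightarrow> y = z"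
  using par_props[of y] par_props[of z] by (auto simp: doubleton_eq_iff)

lemma edge_height_eq: "y \<in> V \<Longrightarrow> y \<noteq> \<rho> \<Longrightarrow> edge_height V E \<rho> {par y, y} = lev y"
  using par_props[of y] by (simp add: edge_height_def lev_def[symmetric])

definition in_subtree :: "'a \<Rightarrow> 'a \<Rightarrow> bool" where "in_subtree x z \<longleftrightarrow> (\<exists>j. (par ^^ j) z = x)"

lemma in_subtree_step: "in_subtree x z \<longleftrightarrow> x = z \<or> in_subtree x (par z)"
proof -
  have "(\<exists>j. (par ^^ j) z = x) \<longleftrightarrow> (par ^^ 0) z = x \<or> (\<exists>j. (par ^^ Suc j) z = x)"
    by (metis not0_implies_Suc)
  then show ?thesis unfolding in_subtree_def by (simp only: funpow_Suc_right o_apply funpow_0) blast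
qed

lemma in_subtree_root: "in_subtree x \<rho> \<longleftrightarrow> x = \<rho>"
proof -
  have "(par ^^ j) \<rho> = \<rho>" for j by (induction j) auto
  then show ?thesis by (auto simp: in_subtree_def)
qed

lemma lev_par_le: "x \<in> V \<Longrightarrow> lev (par x) \<le> lev x"
  using par_props[of x] by (cases "x = \<rho>") auto

lemma in_subtree_lev: "z \<in> V \<Longrightarrow> in_subtree x z \<Longrightarrow> lev x \<le> lev z \<and> x \<in> V"
proof -
  assume z: "z \<in> V" and "in_subtree x z"
  have "lev ((par ^^ j) z) \<le> lev z \<and> (par ^^ j) z \<in> V" for j
    using z by (induction j) (auto intro: order_trans[OF lev_par_le])
  then show ?thesis using \<open>in_subtree x z\<close> by (auto simp: in_subtree_def)
qed

lemma not_in_subtree_par: "z \<in> V \<Longrightarrow> z \<noteq> \<rho> \<Longrightarrow> \<not> in_subtree z (par z)"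
  using in_subtree_lev[of "par z" z] par_props[of z] by auto

lemma root_in_subtree: "z \<in> V \<Longrightarrow> in_subtree \<rho> z"
proof (induction "lev z" arbitrary: z)
  case 0
  then show ?case using lev_eq_0[of z] by (simp add: in_subtree_root)
next
  case (Suc n)
  then have "z \<noteq> \<rho>" by auto
  then have "n = lev (par z)" using Suc(2) par_props[OF Suc(3)] by simp
  from Suc(1)[OF this par_in_V] show ?case using in_subtree_step[of \<rho> z] by blast
qed

lemma in_subtree_child:
  assumes "z \<in> V" "in_subtree x z" "z \<noteq> x"
  obtains y where "y \<in> ch x" "in_subtree y z"
proof -
  have "\<exists>y. y \<in> ch x \<and> in_subtree y z" using assms
  proof (induction "lev z" arbitrary: z)
    case 0
    then show ?case using lev_eq_0[of z] by (simp add: in_subtree_root)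
  next
    case (Suc n)
    then have z: "z \<noteq> \<rho>" by auto
    have l: "n = lev (par z)" using Suc(2) par_props[OF Suc(3) z] by simp
    have i: "in_subtree x (par z)" using Suc(4,5) in_subtree_step[of x z] by blast
    show ?case
    proof (cases "par z = x")
      case True
      then show ?thesis using ch_par[OF Suc(3) z] in_subtree_step[of z z] by blast
    next
      case False
      then obtain y where "y \<in> ch x" "in_subtree y (par z)" using Suc(1)[OF l par_in_V i] by blast
      then show ?thesis using in_subtree_step[of y z] by blast
    qed
  qed
  then show ?thesis using that by blast
qed

text \<open>A step that does not lead to a child leads back to the parent, which is the vertex just
  left, and injectivity forbids that.\<close>

lemma ray_lev:
  assumes "is_ray E \<rho> v"
  shows "lev (v i) = i \<and> v (Suc i) \<in> ch (v i)"
proof -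
  have e: "{v i, v (Suc i)} \<in> E" for i using assms by (simp add: is_ray_def)
  have inj: "v i = v j \<longleftrightarrow> i = j" for i j using assms by (auto simp: is_ray_def inj_eq)
  show ?thesis
  proof (induction i)
    case 0
    have v0: "v 0 = \<rho>" using assms by (simp add: is_ray_def)
    have "v 1 \<in> neighbours E \<rho>" using e[of 0] v0 by (simp add: neighbours_def)
    then show ?case using v0 neighbours_eq[OF root_in_V] by simp
  next
    case (Suc i)
    have l: "lev (v (Suc i)) = Suc i" and p: "par (v (Suc i)) = v i" using Suc chD[of "v (Suc i)" "v i"] by auto
    have "v (Suc (Suc i)) \<in> neighbours E (v (Suc i))" using e[of "Suc i"] by (simp add: neighbours_def)
    moreover have "v (Suc (Suc i)) \<noteq> par (v (Suc i))" unfolding p using inj by simp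
    ultimately have "v (Suc (Suc i)) \<in> ch (v (Suc i))"
      using neighbours_eq[of "v (Suc i)"] adj_in_V[OF e[of i]] by (auto split: if_splits)
    then show ?case using l by simp
  qed
qed

definition level_set :: "nat \<Rightarrow> 'a set" where "level_set n = {x \<in> V. lev x = n}"

lemma level_set_0: "level_set 0 = {\<rho>}"
  using lev_eq_0 root_in_V by (auto simp: level_set_def)

lemma level_set_Suc: "level_set (Suc n) = (\<Union>x\<in>level_set n. ch x)"
proof (intro equalityI subsetI)
  fix y assume "y \<in> level_set (Suc n)"
  then have y: "y \<in> V" "lev y = Suc n" "y \<noteq> \<rho>" by (auto simp: level_set_def)
  then have "par y \<in> level_set n" using par_props[of y] by (simp add: level_set_def)
  then show "y \<in> (\<Union>x\<in>level_set n. ch x)" using ch_par[of y] y by blast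
next
  fix y assume "y \<in> (\<Union>x\<in>level_set n. ch x)"
  then show "y \<in> level_set (Suc n)" using chD by (fastforce simp: level_set_def)
qed

lemma ch_disjoint: "x \<noteq> x' \<Longrightarrow> ch x \<inter> ch x' = {}"
  by (auto simp: ch_def)

section \<open>Rays, cutsets and flows under local finiteness\<close>

context
  assumes lf: "locally_finite V E"
begin

lemma finite_neighbours: "x \<in> V \<Longrightarrow> finite (neighbours E x)"
  using lf by (simp add: locally_finite_def)

lemma finite_ch: "finite (ch x)"
proof (cases "x \<in> V")
  case True
  then show ?thesis using finite_neighbours[of x] by (simp add: neighbours_eq)
next
  case False
  then have "ch x = {}" using chD by blast
  then show ?thesis by simp
qed

lemma finite_level_set: "finite (level_set n)"
  by (induction n) (auto simp: level_set_0 level_set_Suc finite_ch)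

lemma countable_V: "countable V"
proof (rule countable_subset)
  show "V \<subseteq> (\<Union>n. level_set n)" by (auto simp: level_set_def)
  show "countable (\<Union>n. level_set n)" using finite_level_set by (simp add: countable_finite)
qed

text \<open>Koenig's lemma for the property of having infinitely many points of \<open>S\<close>
  below: by local finiteness some child inherits it.\<close>

lemma koenig_ray:
  assumes S: "S \<subseteq> V" "infinite S"
  obtains v where "is_ray E \<rho> v" "\<And>i. \<exists>z\<in>S. in_subtree (v i) z"
proof -
  define rich where "rich x \<longleftrightarrow> x \<in> V \<and> infinite {z \<in> S. in_subtree x z}" for x
  have r0: "rich \<rho>"
  proof -
    have "{z \<in> S. in_subtree \<rho> z} = S" using S root_in_subtree by auto
    then show ?thesis using S root_in_V by (simp add: rich_def)
  qed
  have step: "\<exists>y. y \<in> ch x \<and> rich y" if "rich x" for x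
  proof (rule ccontr)
    assume "\<not> ?thesis"
    then have "\<forall>y\<in>ch x. finite {z \<in> S. in_subtree y z}" using chD by (auto simp: rich_def)
    then have "finite (insert x (\<Union>y\<in>ch x. {z \<in> S. in_subtree y z}))" using finite_ch by auto
    moreover have "{z \<in> S. in_subtree x z} \<subseteq> insert x (\<Union>y\<in>ch x. {z \<in> S. in_subtree y z})"
      using in_subtree_child S(1) by blast
    ultimately show False using that finite_subset by (auto simp: rich_def)
  qed
  obtain v where v0: "v 0 = \<rho>" and v: "\<And>n. rich (v n)" "\<And>n. v (Suc n) \<in> ch (v n)"
    using dependent_nat_choice[of "\<lambda>n x. rich x \<and> (n = 0 \<longrightarrow> x = \<rho>)" "\<lambda>n x y. y \<in> ch x"] r0 step by blast
  have "lev (v i) = i" for i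
  proof (induction i)
    case (Suc i)
    then show ?case using chD[OF v(2)[of i]] by simp
  qed (simp add: v0)
  then have "inj v" by (metis injI)
  then have "is_ray E \<rho> v" unfolding is_ray_def using v0 chD[OF v(2)] by blast
  moreover have "\<exists>z\<in>S. in_subtree (v i) z" for i
    using v(1)[of i] by (auto simp: rich_def dest: infinite_imp_nonempty)
  ultimately show ?thesis using that by blast
qed

text \<open>Cutsets are minimal by definition, and a minimal separating set exists here because a
  finite set of edges has only finitely many subsets. From here on an edge is represented by its
  lower endpoint.\<close>

lemma cutset_within:
  assumes F: "finite F" "F \<subseteq> V - {\<rho>}" and ray: "\<And>v. is_ray E \<rho> v \<Longrightarrow> \<exists>i. v i \<in> F"
  obtains \<pi> where "\<pi> \<in> cutsets E \<rho>" "\<pi> \<subseteq> (\<lambda>y. {par y, y}) ` F"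
proof -
  let ?P = "(\<lambda>y. {par y, y}) ` F"
  have "?P \<subseteq> E" using F par_props by (auto simp: insert_commute)
  moreover have "\<exists>i. {v i, v (Suc i)} \<in> ?P" if v: "is_ray E \<rho> v" for v
  proof -
    obtain i where i: "v i \<in> F" using ray[OF v] by blast
    then obtain i' where i': "i = Suc i'" using F v by (cases i) (auto simp: is_ray_def)
    have "v (Suc i') \<in> ch (v i')" using ray_lev[OF v, of i'] by simp
    then have "par (v i) = v i'" using chD i' by simp
    then have "{v i', v (Suc i')} = (\<lambda>y. {par y, y}) (v i)" using i' by simp
    then have "{v i', v (Suc i')} \<in> ?P" using i by (rule image_eqI)
    then show ?thesis by (rule exI)
  qed
  ultimately have "separates_root E \<rho> ?P" by (simp add: separates_root_def)
  define CU where "CU = {\<pi>. \<pi> \<subseteq> ?P \<and> separates_root E \<rho> \<pi>}"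
  have "?P \<in> CU" using \<open>separates_root E \<rho> ?P\<close> by (simp add: CU_def)
  moreover have "finite CU" using F by (simp add: CU_def)
  ultimately obtain \<pi> where \<pi>: "\<pi> \<in> CU" "\<And>b. b \<in> CU \<Longrightarrow> b \<subseteq> \<pi> \<Longrightarrow> \<pi> = b"
    using finite_has_minimal[of CU] by (metis empty_iff)
  have "separates_root E \<rho> \<pi>" "\<pi> \<subseteq> ?P" using \<pi>(1) by (auto simp: CU_def)
  moreover have "\<not> separates_root E \<rho> \<pi>'" if "\<pi>' \<subset> \<pi>" for \<pi>'
  proof
    assume "separates_root E \<rho> \<pi>'"
    then have "\<pi>' \<in> CU" using that \<open>\<pi> \<subseteq> ?P\<close> by (auto simp: CU_def)
    then show False using \<pi>(2)[of \<pi>'] that by auto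
  qed
  ultimately show ?thesis using that[of \<pi>] by (simp add: cutsets_def)
qed

text \<open>The maximal flow from \<open>x\<close> through \<open>r\<close> further generations, by the min-cut recursion.\<close>

primrec subtree_cap :: "('a \<Rightarrow> real) \<Rightarrow> nat \<Rightarrow> 'a \<Rightarrow> real" where
  "subtree_cap c 0 x = c x"
| "subtree_cap c (Suc r) x = min (c x) (\<Sum>y\<in>ch x. subtree_cap c r y)"

lemma subtree_cap_le: "subtree_cap c r x \<le> c x"
  by (cases r) auto

lemma subtree_cap_nonneg: "(\<And>x. c x \<ge> 0) \<Longrightarrow> subtree_cap c r x \<ge> 0"
  by (induction r arbitrary: x) (auto intro: sum_nonneg)

text \<open>The term that attains the minimum in \<open>subtree_cap\<close> tells the cut:
  \<open>{x}\<close> for \<open>c x\<close>, the union of the cuts of the children for the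
  sum.\<close>

lemma subtree_cap_cut:
  assumes c: "\<And>x. c x \<ge> 0" and x: "x \<in> V" "x \<noteq> \<rho>"
  shows "\<exists>F. finite F \<and> F \<subseteq> V - {\<rho>} \<and> sum c F \<le> subtree_cap c r x \<and> (\<forall>v i. is_ray E \<rho> v \<and> v i = x \<longrightarrow> (\<exists>i. v i \<in> F))"
  using x
proof (induction r arbitrary: x)
  case 0
  then show ?case by (intro exI[of _ "{x}"]) auto
next
  case (Suc r)
  show ?case
  proof (cases "c x \<le> (\<Sum>y\<in>ch x. subtree_cap c r y)")
    case True
    then show ?thesis using Suc.prems by (intro exI[of _ "{x}"]) auto
  next
    case False
    have *: "\<forall>y\<in>ch x. \<exists>F. finite F \<and> F \<subseteq> V - {\<rho>} \<and> sum c F \<le> subtree_cap c r y \<and> (\<forall>v i. is_ray E \<rho> v \<and> v i = y \<longrightarrow> (\<exists>i. v i \<in> F))"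
    proof
      fix y assume "y \<in> ch x"
      from chD[OF this] show "\<exists>F. finite F \<and> F \<subseteq> V - {\<rho>} \<and> sum c F \<le> subtree_cap c r y \<and> (\<forall>v i. is_ray E \<rho> v \<and> v i = y \<longrightarrow> (\<exists>i. v i \<in> F))"
        by (intro Suc.IH) simp_all
    qed
    from bchoice[OF *] obtain F where F: "\<forall>y\<in>ch x. finite (F y) \<and> F y \<subseteq> V - {\<rho>} \<and> sum c (F y) \<le> subtree_cap c r y \<and> (\<forall>v i. is_ray E \<rho> v \<and> v i = y \<longrightarrow> (\<exists>i. v i \<in> F y))" ..
    have "sum c (\<Union>y\<in>ch x. F y) \<le> (\<Sum>y\<in>ch x. sum c (F y))"
      using F c finite_ch by (intro sum_UN_le) simp_all
    also have "\<dots> \<le> (\<Sum>y\<in>ch x. subtree_cap c r y)" using F by (intro sum_mono) simp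
    also have "\<dots> = subtree_cap c (Suc r) x" using False by simp
    finally have s: "sum c (\<Union>y\<in>ch x. F y) \<le> subtree_cap c (Suc r) x" .
    have ray: "\<exists>i. v i \<in> (\<Union>y\<in>ch x. F y)" if v: "is_ray E \<rho> v" "v i = x" for v i
    proof -
      have c: "v (Suc i) \<in> ch x" using ray_lev[OF v(1), of i] v(2) by simp
      have "\<forall>w i'. is_ray E \<rho> w \<and> w i' = v (Suc i) \<longrightarrow> (\<exists>i'. w i' \<in> F (v (Suc i)))"
        using bspec[OF F c] by (elim conjE)
      then obtain i' where "v i' \<in> F (v (Suc i))" using v(1) by blast
      with c show ?thesis by (intro exI[of _ i'] UN_I)
    qed
    have "finite (\<Union>y\<in>ch x. F y)" by (rule finite_UN_I[OF finite_ch]) (use F in simp)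
    moreover have "(\<Union>y\<in>ch x. F y) \<subseteq> V - {\<rho>}" by (rule UN_least) (use F in simp)
    moreover have "\<forall>v i. is_ray E \<rho> v \<and> v i = x \<longrightarrow> (\<exists>i. v i \<in> (\<Union>y\<in>ch x. F y))"
      by (intro allI impI, elim conjE) (rule ray)
    ultimately show ?thesis using s by (intro exI[of _ "\<Union>y\<in>ch x. F y"] conjI)
  qed
qed

text \<open>The sum starts at the children because the root has no edge above it; its own capacity
  would be \<open>0 powr (- \<gamma>) = 0\<close>. The cuts below the children together contain a
  cutset, whose weight is at least \<open>\<delta>\<close>.\<close>

lemma subtree_cap_total:
  assumes \<gamma>: "\<gamma> > 0" and \<delta>: "\<delta> > 0"
    and inf: "ennreal \<delta> \<le> (INF \<pi>\<in>cutsets E \<rho>. \<Sum>\<^sub>\<infinity>e\<in>\<pi>. ennreal (real (edge_height V E \<rho> e) powr (- \<gamma>)))"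
  shows "\<delta> \<le> (\<Sum>y\<in>ch \<rho>. subtree_cap (\<lambda>x. real (lev x) powr (- \<gamma>)) r y)"
proof -
  let ?c = "\<lambda>x. real (lev x) powr (- \<gamma>)"
  have *: "\<forall>y\<in>ch \<rho>. \<exists>F. finite F \<and> F \<subseteq> V - {\<rho>} \<and> sum ?c F \<le> subtree_cap ?c r y \<and> (\<forall>v i. is_ray E \<rho> v \<and> v i = y \<longrightarrow> (\<exists>i. v i \<in> F))"
  proof
    fix y assume "y \<in> ch \<rho>"
    from chD[OF this] show "\<exists>F. finite F \<and> F \<subseteq> V - {\<rho>} \<and> sum ?c F \<le> subtree_cap ?c r y \<and> (\<forall>v i. is_ray E \<rho> v \<and> v i = y \<longrightarrow> (\<exists>i. v i \<in> F))"
      by (intro subtree_cap_cut) simp_all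
  qed
  from bchoice[OF *] obtain F where F: "\<forall>y\<in>ch \<rho>. finite (F y) \<and> F y \<subseteq> V - {\<rho>} \<and> sum ?c (F y) \<le> subtree_cap ?c r y \<and> (\<forall>v i. is_ray E \<rho> v \<and> v i = y \<longrightarrow> (\<exists>i. v i \<in> F y))" ..
  let ?F = "\<Union>y\<in>ch \<rho>. F y"
  have s: "sum ?c ?F \<le> (\<Sum>y\<in>ch \<rho>. subtree_cap ?c r y)"
  proof -
    have "sum ?c ?F \<le> (\<Sum>y\<in>ch \<rho>. sum ?c (F y))"
      using F finite_ch by (intro sum_UN_le) simp_all
    also have "\<dots> \<le> (\<Sum>y\<in>ch \<rho>. subtree_cap ?c r y)" using F by (intro sum_mono) simp
    finally show ?thesis .
  qed
  have fin: "finite ?F" "?F \<subseteq> V - {\<rho>}"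
  proof -
    show "finite ?F" by (rule finite_UN_I[OF finite_ch]) (use F in simp)
    show "?F \<subseteq> V - {\<rho>}" by (rule UN_least) (use F in simp)
  qed
  have ray: "\<exists>i. v i \<in> ?F" if v: "is_ray E \<rho> v" for v
  proof -
    have c: "v (Suc 0) \<in> ch \<rho>" using ray_lev[OF v, of 0] v by (simp add: is_ray_def)
    have "\<forall>w i'. is_ray E \<rho> w \<and> w i' = v (Suc 0) \<longrightarrow> (\<exists>i'. w i' \<in> F (v (Suc 0)))"
      using bspec[OF F c] by (elim conjE)
    then obtain i' where "v i' \<in> F (v (Suc 0))" using v by blast
    with c show ?thesis by (intro exI[of _ i'] UN_I)
  qed
  obtain \<pi> where \<pi>: "\<pi> \<in> cutsets E \<rho>" "\<pi> \<subseteq> (\<lambda>y. {par y, y}) ` ?F"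
    using cutset_within[OF fin ray] by blast
  have inj: "inj_on (\<lambda>y. {par y, y}) ?F"
  proof (rule inj_onI)
    fix y z assume "y \<in> ?F" "z \<in> ?F" and e: "{par y, y} = {par z, z}"
    then have "y \<in> V" "y \<noteq> \<rho>" "z \<in> V" "z \<noteq> \<rho>" using fin(2) by blast+
    then show "y = z" using e by (rule edge_inj)
  qed
  let ?w = "\<lambda>e. real (edge_height V E \<rho> e) powr (- \<gamma>)"
  have "ennreal \<delta> \<le> (\<Sum>\<^sub>\<infinity>e\<in>\<pi>. ennreal (?w e))"
    by (rule order_trans[OF inf INF_lower[OF \<pi>(1)]])
  also have "\<dots> = (\<Sum>e\<in>\<pi>. ennreal (?w e))" by (rule infsum_finite) (rule finite_subset[OF \<pi>(2) finite_imageI[OF fin(1)]])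
  also have "\<dots> = ennreal (\<Sum>e\<in>\<pi>. ?w e)" by (rule sum_ennreal) simp
  also have "(\<Sum>e\<in>\<pi>. ?w e) \<le> (\<Sum>e\<in>(\<lambda>y. {par y, y}) ` ?F. ?w e)" by (rule sum_mono2[OF finite_imageI[OF fin(1)] \<pi>(2)]) simp
  also have "\<dots> = (\<Sum>y\<in>?F. ?w {par y, y})"
    by (simp add: sum.reindex[OF inj])
  also have "\<dots> = sum ?c ?F"
  proof (rule sum.cong[OF refl])
    fix y assume "y \<in> ?F"
    then have "y \<in> V" "y \<noteq> \<rho>" using fin(2) by blast+
    then show "?w {par y, y} = ?c y" by (simp add: edge_height_eq)
  qed
  also have "\<dots> \<le> (\<Sum>y\<in>ch \<rho>. subtree_cap ?c r y)" by (rule s)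
  finally have "ennreal \<delta> \<le> ennreal (\<Sum>y\<in>ch \<rho>. subtree_cap ?c r y)" by (simp add: ennreal_leI)
  then show ?thesis by (subst (asm) ennreal_le_iff) (auto intro!: sum_nonneg subtree_cap_nonneg)
qed

text \<open>The flow divides at each vertex in proportion to the capacities \<open>cp\<close> of the
  children, and \<open>cp x \<le> S x\<close> keeps it below \<open>cp x / S \<rho>\<close>. It is
  built only down to a prescribed level; the estimates that use it are uniform in \<open>N\<close>,
  which takes the place of a compactness argument.\<close>

lemma flow_exists:
  assumes \<gamma>: "\<gamma> > 0" and \<delta>: "\<delta> > 0"
    and inf: "ennreal \<delta> \<le> (INF \<pi>\<in>cutsets E \<rho>. \<Sum>\<^sub>\<infinity>e\<in>\<pi>. ennreal (real (edge_height V E \<rho> e) powr (- \<gamma>)))"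
  obtains \<theta> :: "'a \<Rightarrow> real" where "\<And>x. \<theta> x \<ge> 0" "(\<Sum>y\<in>ch \<rho>. \<theta> y) = 1"
    "\<And>x. x \<in> V \<Longrightarrow> x \<noteq> \<rho> \<Longrightarrow> lev x \<le> N \<Longrightarrow> (\<Sum>y\<in>ch x. \<theta> y) = \<theta> x"
    "\<And>x. x \<in> V \<Longrightarrow> x \<noteq> \<rho> \<Longrightarrow> lev x \<le> Suc N \<Longrightarrow> \<theta> x \<le> real (lev x) powr (- \<gamma>) / \<delta>"
proof -
  let ?c = "\<lambda>x. real (lev x) powr (- \<gamma>)"
  define cp where "cp x = subtree_cap ?c (Suc N - lev x) x" for x
  have cp0: "cp x \<ge> 0" for x unfolding cp_def by (rule subtree_cap_nonneg) simp
  define S where "S x = (\<Sum>y\<in>ch x. cp y)" for x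
  have S0: "S x \<ge> 0" for x unfolding S_def using cp0 by (rule sum_nonneg)
  have cpS: "cp x \<le> S x" if "x \<in> V" "lev x \<le> N" for x
  proof -
    have e: "Suc N - lev x = Suc (N - lev x)" using that by simp
    have "cp x \<le> (\<Sum>y\<in>ch x. subtree_cap ?c (N - lev x) y)" unfolding cp_def e by simp
    also have "\<dots> = S x" unfolding S_def cp_def using chD by (intro sum.cong) auto
    finally show ?thesis .
  qed
  have tot: "S \<rho> \<ge> \<delta>"
  proof -
    have "S \<rho> = (\<Sum>y\<in>ch \<rho>. subtree_cap ?c N y)" unfolding S_def cp_def using chD by (intro sum.cong) auto
    then show ?thesis using subtree_cap_total[OF \<gamma> \<delta> inf] by simp
  qed
  define th where "th = rec_nat (\<lambda>x::'a. 1::real) (\<lambda>n f x. f (par x) * cp x / S (par x))"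
  have th: "th 0 x = 1" "th (Suc n) x = th n (par x) * cp x / S (par x)" for n x by (simp_all add: th_def)
  define \<theta> where "\<theta> x = th (lev x) x" for x
  have \<theta>0: "\<theta> \<rho> = 1" by (simp add: \<theta>_def th)
  have \<theta>ch: "\<theta> y = \<theta> x * cp y / S x" if "y \<in> ch x" for x y
    using chD[OF that] by (simp add: \<theta>_def th)
  have nonneg: "\<theta> x \<ge> 0" for x
  proof -
    have "th n x \<ge> 0" for n x by (induction n arbitrary: x) (auto simp: th cp0 S0)
    then show ?thesis by (simp add: \<theta>_def)
  qed
  have sumS: "(\<Sum>y\<in>ch x. \<theta> y) = \<theta> x" if "S x \<noteq> 0" for x
  proof -
    have "(\<Sum>y\<in>ch x. \<theta> y) = (\<Sum>y\<in>ch x. \<theta> x * cp y / S x)" using \<theta>ch by (intro sum.cong) auto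
    also have "\<dots> = \<theta> x * S x / S x" by (simp add: S_def sum_distrib_left sum_divide_distrib)
    finally show ?thesis using that by simp
  qed
  have le: "\<theta> x \<le> cp x / S \<rho>" if "x \<in> V" "x \<noteq> \<rho>" "lev x \<le> Suc N" for x
    using that
  proof (induction "lev x" arbitrary: x)
    case 0
    then show ?case using lev_eq_0[of x] by simp
  next
    case (Suc n)
    have x: "x \<in> ch (par x)" using ch_par Suc by blast
    show ?case
    proof (cases "par x = \<rho>")
      case True
      then show ?thesis using \<theta>ch[OF x] \<theta>0 by simp
    next
      case False
      have l: "lev (par x) = n" "n \<le> N" using Suc chD[OF x] by auto
      have ih: "\<theta> (par x) \<le> cp (par x) / S \<rho>" using Suc(1)[of "par x"] l False by simp
      also have "\<dots> \<le> S (par x) / S \<rho>" using cpS[of "par x"] l S0 by (intro divide_right_mono) auto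
      finally have i: "\<theta> (par x) \<le> S (par x) / S \<rho>" .
      have "\<theta> x = \<theta> (par x) * (cp x / S (par x))" using \<theta>ch[OF x] by simp
      also have "\<dots> \<le> S (par x) / S \<rho> * (cp x / S (par x))" using i cp0 S0 by (intro mult_right_mono) auto
      also have "\<dots> \<le> cp x / S \<rho>" using cp0[of x] S0[of \<rho>] by (cases "S (par x) = 0") auto
      finally show ?thesis .
    qed
  qed
  show ?thesis
  proof (rule that[of \<theta>])
    show "(\<Sum>y\<in>ch \<rho>. \<theta> y) = 1" using sumS[of \<rho>] tot \<delta> \<theta>0 by simp
    show "(\<Sum>y\<in>ch x. \<theta> y) = \<theta> x" if x: "x \<in> V" "x \<noteq> \<rho>" "lev x \<le> N" for x
    \<comment> \<open>If \<open>S x = 0\<close>, division by 0 sends nothing to the children, but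
      then nothing arrives either, since \<open>cp x \<le> S x\<close>.\<close>
    proof (cases "S x = 0")
      case True
      then have "cp x = 0" using cpS[of x] cp0[of x] x by simp
      then have "\<theta> x = 0" using le[of x] nonneg[of x] x by simp
      moreover have "(\<Sum>y\<in>ch x. \<theta> y) = 0" using \<theta>ch True by (intro sum.neutral) auto
      ultimately show ?thesis by simp
    qed (rule sumS)
    show "\<theta> x \<le> real (lev x) powr (- \<gamma>) / \<delta>" if x: "x \<in> V" "x \<noteq> \<rho>" "lev x \<le> Suc N" for x
    proof -
      have "\<theta> x \<le> cp x / S \<rho>" by (rule le[OF x])
      also have "\<dots> \<le> ?c x / \<delta>" using subtree_cap_le[of ?c _ x] cp0[of x] tot \<delta> by (intro frac_le) (auto simp: cp_def)
      finally show ?thesis .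
    qed
  qed (rule nonneg)
qed

end

text \<open>A positive \<open>\<gamma>\<close> strictly between the branching-ruin number and 1/2 is
  outside the set whose supremum is taken, so its infimum over cutsets vanishes.\<close>

lemma branching_ruin_less:
  assumes "branching_ruin V E \<rho> < 1 / 2"
  obtains \<gamma> where "0 < \<gamma>" "\<gamma> < 1 / 2"
    "\<And>\<epsilon>. \<epsilon> > 0 \<Longrightarrow> \<exists>\<pi>\<in>cutsets E \<rho>. (\<Sum>\<^sub>\<infinity>e\<in>\<pi>. ennreal (real (edge_height V E \<rho> e) powr (- \<gamma>))) < \<epsilon>"
proof -
  have h: "(1 / 2 :: ennreal) = ennreal (1 / 2)" by (simp add: ennreal_divide_numeral[symmetric] divide_ennreal_def)
  obtain b where b: "branching_ruin V E \<rho> < b" "b < ennreal (1 / 2)" using dense assms unfolding h by blast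
  then obtain \<gamma> where g: "b = ennreal \<gamma>" "\<gamma> \<ge> 0" by (cases b) auto
  have g0: "\<gamma> > 0" using b g by (metis ennreal_0 less_eq_real_def not_less_zero)
  have g1: "\<gamma> < 1 / 2" using b(2) ennreal_less_iff[OF g(2)] unfolding g(1) by blast
  have "\<not> (INF \<pi>\<in>cutsets E \<rho>. \<Sum>\<^sub>\<infinity>e\<in>\<pi>. ennreal (real (edge_height V E \<rho> e) powr (- \<gamma>))) > 0"
  proof
    assume "(INF \<pi>\<in>cutsets E \<rho>. \<Sum>\<^sub>\<infinity>e\<in>\<pi>. ennreal (real (edge_height V E \<rho> e) powr (- \<gamma>))) > 0"
    then have "ennreal \<gamma> \<le> branching_ruin V E \<rho>" unfolding branching_ruin_def using g0 by (intro Sup_upper) blast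
    then show False using b g by simp
  qed
  then have z: "(INF \<pi>\<in>cutsets E \<rho>. \<Sum>\<^sub>\<infinity>e\<in>\<pi>. ennreal (real (edge_height V E \<rho> e) powr (- \<gamma>))) = 0" by simp
  have "\<exists>\<pi>\<in>cutsets E \<rho>. (\<Sum>\<^sub>\<infinity>e\<in>\<pi>. ennreal (real (edge_height V E \<rho> e) powr (- \<gamma>))) < \<epsilon>" if "\<epsilon> > 0" for \<epsilon>
    using that z by (subst INF_less_iff[symmetric]) simp
  then show ?thesis using that g0 g1 by blast
qed

lemma branching_ruin_greater:
  assumes "branching_ruin V E \<rho> > 1 / 2"
  obtains \<gamma> \<delta> where "\<gamma> > 1 / 2" "\<delta> > 0"
    "ennreal \<delta> \<le> (INF \<pi>\<in>cutsets E \<rho>. \<Sum>\<^sub>\<infinity>e\<in>\<pi>. ennreal (real (edge_height V E \<rho> e) powr (- \<gamma>)))"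
proof -
  have h: "(1 / 2 :: ennreal) = ennreal (1 / 2)" by (simp add: ennreal_divide_numeral[symmetric] divide_ennreal_def)
  obtain \<gamma> where g: "ennreal (1 / 2) < ennreal \<gamma>" "\<gamma> > 0"
    "(INF \<pi>\<in>cutsets E \<rho>. \<Sum>\<^sub>\<infinity>e\<in>\<pi>. ennreal (real (edge_height V E \<rho> e) powr (- \<gamma>))) > 0"
    using assms unfolding h branching_ruin_def less_Sup_iff by blast
  obtain d where d: "0 < d" "d < (INF \<pi>\<in>cutsets E \<rho>. \<Sum>\<^sub>\<infinity>e\<in>\<pi>. ennreal (real (edge_height V E \<rho> e) powr (- \<gamma>)))"
    using dense[OF g(3)] by blast
  then obtain \<delta> where dd: "d = ennreal \<delta>" "\<delta> \<ge> 0" by (cases d) (auto simp: top_unique)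
  have "\<delta> > 0" using d dd by (metis ennreal_0 less_eq_real_def less_irrefl)
  moreover have "\<gamma> > 1 / 2" using g(1) ennreal_less_iff[of "1 / 2" \<gamma>] by simp
  ultimately show ?thesis using that d dd by (simp add: less_imp_le)
qed

end

section \<open>The walk and its stacks\<close>

text \<open>The part of the stack of \<open>x\<close> that \<open>p\<close> has consumed; a visit of
  \<open>x\<close> at the very end of \<open>p\<close> has consumed nothing yet.\<close>

definition exits :: "'a list \<Rightarrow> 'a \<Rightarrow> 'a list" where
  "exits p x = map (\<lambda>k. p ! Suc k) (filter (\<lambda>k. p ! k = x) [0..<length p - 1])"

lemma set_exits_subset: "set (exits p x) \<subseteq> set p"
  by (auto simp: exits_def)

lemma exits_single [simp]: "exits [z] x = []"
  by (simp add: exits_def)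

lemma exits_snoc: "p \<noteq> [] \<Longrightarrow> exits (p @ [y]) x = exits p x @ (if last p = x then [y] else [])"
proof -
  assume p: "p \<noteq> []"
  then have l: "length (p @ [y]) - 1 = Suc (length p - 1)" by (cases p) auto
  have 1: "filter (\<lambda>k. (p @ [y]) ! k = x) [0..<length p - 1] = filter (\<lambda>k. p ! k = x) [0..<length p - 1]"
    by (intro filter_cong) (auto simp: nth_append)
  have 2: "map (\<lambda>k. (p @ [y]) ! Suc k) (filter (\<lambda>k. p ! k = x) [0..<length p - 1]) = exits p x"
    unfolding exits_def by (intro map_cong) (auto simp: nth_append)
  have 3: "(p @ [y]) ! (length p - 1) = last p" "(p @ [y]) ! Suc (length p - 1) = y"
    using p by (auto simp: nth_append last_conv_nth)
  have "exits (p @ [y]) x = map (\<lambda>k. (p @ [y]) ! Suc k) (filter (\<lambda>k. (p @ [y]) ! k = x) ([0..<length p - 1] @ [length p - 1]))"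
    unfolding exits_def l by simp
  also have "\<dots> = exits p x @ (if last p = x then [y] else [])"
    unfolding filter_append map_append 1 2 using 3 by auto
  finally show ?thesis .
qed

lemma count_exits_snoc:
  "p \<noteq> [] \<Longrightarrow> count_list (exits (p @ [y]) x) z = count_list (exits p x) z + of_bool (last p = x \<and> y = z)"
  by (cases "last p = x") (simp_all add: exits_snoc)

definition traversals :: "'a list \<Rightarrow> 'a \<Rightarrow> 'a \<Rightarrow> nat" where
  "traversals p x y = (\<Sum>k<length p - 1. of_bool ({p ! k, p ! Suc k} = {x, y}))"

lemma traversals_snoc: "p \<noteq> [] \<Longrightarrow> traversals (p @ [z]) x y = traversals p x y + of_bool ({last p, z} = {x, y})"
proof -
  assume p: "p \<noteq> []"
  then have l: "length (p @ [z]) - 1 = Suc (length p - 1)" by (cases p) auto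
  have "(\<Sum>k<length p - 1. of_bool ({(p @ [z]) ! k, (p @ [z]) ! Suc k} = {x, y})) = (traversals p x y :: nat)"
    unfolding traversals_def
  proof (rule sum.cong[OF refl])
    fix k assume "k \<in> {..<length p - 1}"
    then have "(p @ [z]) ! k = p ! k" "(p @ [z]) ! Suc k = p ! Suc k" by (auto simp: nth_append)
    then show "of_bool ({(p @ [z]) ! k, (p @ [z]) ! Suc k} = {x, y}) = (of_bool ({p ! k, p ! Suc k} = {x, y}) :: nat)" by (simp only:)
  qed
  moreover have "(p @ [z]) ! (length p - 1) = last p" "(p @ [z]) ! Suc (length p - 1) = z"
    using p by (auto simp: nth_append last_conv_nth)
  ultimately show ?thesis unfolding traversals_def[of "p @ [z]"] l by simp
qed

lemma traversals_eq_exits: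
  assumes "x \<noteq> y"
  shows "p \<noteq> [] \<Longrightarrow> traversals p x y = count_list (exits p x) y + count_list (exits p y) x"
proof (induction p rule: rev_induct)
  case (snoc z p)
  show ?case
  proof (cases "p = []")
    case True
    then show ?thesis by (simp add: traversals_def)
  next
    case False
    have d: "({last p, z} = {x, y}) \<longleftrightarrow> (last p = x \<and> z = y) \<or> (last p = y \<and> z = x)"
      by (rule doubleton_eq_iff)
    show ?thesis unfolding traversals_snoc[OF False] count_exits_snoc[OF False] d
      using snoc.IH[OF False] assms by (cases "last p = x"; cases "last p = y") simp_all
  qed
qed simp

section \<open>Paths on the tree and their urns\<close>

locale walk_tree = rooted_tree V E \<rho> + repulsion \<beta>
  for V :: "'a set" and E :: "'a set set" and \<rho> :: 'a and \<beta> :: real +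
  assumes lf: "locally_finite V E" and infV: "infinite V"
begin

text \<open>Stacks are indexed by the whole type, so a vertex outside \<open>V\<close> has an urn as
  well; the value 1 keeps it nonempty.\<close>

definition deg :: "'a \<Rightarrow> nat" where
  "deg x = (if x \<in> V then card (neighbours E x) else 1)"

lemma neighbours_nonempty: "x \<in> V \<Longrightarrow> neighbours E x \<noteq> {}"
proof (cases "x = \<rho>")
  case True
  assume x: "x \<in> V"
  show ?thesis
  proof
    assume "neighbours E x = {}"
    then have c: "ch \<rho> = {}" using neighbours_eq[OF root_in_V] True by simp
    have "z = \<rho>" if z: "z \<in> V" for z
    proof (rule ccontr)
      assume "z \<noteq> \<rho>"
      then show False using in_subtree_child[OF z root_in_subtree[OF z]] c by blast
    qed
    then have "V \<subseteq> {\<rho>}" by blast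
    then show False using infV finite_subset by blast
  qed
next
  case False
  assume "x \<in> V"
  then show ?thesis using neighbours_eq[of x] False by simp
qed

lemma deg_ge_1: "deg x \<ge> 1"
proof (cases "x \<in> V")
  case True
  then have "card (neighbours E x) > 0" using neighbours_nonempty finite_neighbours[OF lf] by (simp add: card_gt_0_iff)
  then show ?thesis using True by (simp add: deg_def)
qed (simp add: deg_def)

text \<open>Colour 0 must be the parent, as in \<open>urn_weight\<close>. Out of range the value is
  the root, so that the walk read off arbitrary stacks stays in \<open>V\<close>.\<close>

definition nbr :: "'a \<Rightarrow> nat \<Rightarrow> 'a" where
  "nbr x = (if x \<in> V then SOME f. bij_betw f {..<deg x} (neighbours E x) \<and> (x \<noteq> \<rho> \<longrightarrow> f 0 = par x) \<and> (\<forall>j\<ge>deg x. f j = \<rho>)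
     else (\<lambda>_. \<rho>))"

lemma nbr_props:
  assumes x: "x \<in> V"
  shows "bij_betw (nbr x) {..<deg x} (neighbours E x)" "x \<noteq> \<rho> \<Longrightarrow> nbr x 0 = par x" "j \<ge> deg x \<Longrightarrow> nbr x j = \<rho>"
proof -
  let ?P = "\<lambda>f. bij_betw f {..<deg x} (neighbours E x) \<and> (x \<noteq> \<rho> \<longrightarrow> f 0 = par x) \<and> (\<forall>j\<ge>deg x. f j = \<rho>)"
  have "\<exists>f. ?P f"
  proof -
    have fin: "finite (neighbours E x)" by (rule finite_neighbours[OF lf x])
    then obtain f where f: "bij_betw f {0..<card (neighbours E x)} (neighbours E x)"
      using ex_bij_betw_nat_finite by blast
    then have f: "bij_betw f {..<deg x} (neighbours E x)" using x by (simp add: deg_def atLeast0LessThan)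
    obtain g where g: "bij_betw g {..<deg x} (neighbours E x)" "x \<noteq> \<rho> \<longrightarrow> g 0 = par x"
    proof (cases "x = \<rho>")
      case True
      then show ?thesis using that[OF f] by simp
    next
      case False
      then have "par x \<in> neighbours E x" using neighbours_eq[OF x] by simp
      then have "par x \<in> f ` {..<deg x}" using f by (simp add: bij_betw_def)
      then obtain i where i: "i < deg x" "f i = par x" by (metis imageE lessThan_iff)
      \<comment> \<open>Exchanging the colours 0 and \<open>i\<close> gives colour 0 to the
        parent.\<close>
      have "bij_betw (f \<circ> Transposition.transpose 0 i) {..<deg x} (neighbours E x)"
        using i deg_ge_1[of x] by (intro bij_betw_trans[OF permutes_imp_bij[OF permutes_swap_id] f]) auto
      then show ?thesis using that[of "f \<circ> Transposition.transpose 0 i"] i by simp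
    qed
    have "bij_betw (\<lambda>j. if j < deg x then g j else \<rho>) {..<deg x} (neighbours E x)"
      using g(1) by (subst bij_betw_cong[where g=g]) auto
    then have "?P (\<lambda>j. if j < deg x then g j else \<rho>)" using g(2) deg_ge_1[of x] by auto
    then show ?thesis by blast
  qed
  then have "?P (SOME f. ?P f)" by (rule someI_ex)
  then have P: "?P (nbr x)" using x by (simp add: nbr_def)
  then show "bij_betw (nbr x) {..<deg x} (neighbours E x)" "x \<noteq> \<rho> \<Longrightarrow> nbr x 0 = par x" "j \<ge> deg x \<Longrightarrow> nbr x j = \<rho>" by auto
qed

lemma nbr_in_V: "nbr x j \<in> V"
proof (cases "x \<in> V")
  case True
  show ?thesis
  proof (cases "j < deg x")
    case j: True
    then have "nbr x j \<in> neighbours E x" using nbr_props(1)[OF True] by (auto simp: bij_betw_def)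
    then show ?thesis using adj_in_V by (auto simp: neighbours_def)
  next
    case False
    then show ?thesis using nbr_props(3)[OF True] root_in_V by simp
  qed
qed (simp add: nbr_def root_in_V)

lemma nbr_neighbour: "x \<in> V \<Longrightarrow> j < deg x \<Longrightarrow> nbr x j \<in> neighbours E x"
  using nbr_props(1)[of x] by (auto simp: bij_betw_def)

lemma nbr_inj: "x \<in> V \<Longrightarrow> i < deg x \<Longrightarrow> j < deg x \<Longrightarrow> nbr x i = nbr x j \<longleftrightarrow> i = j"
  using nbr_props(1)[of x] by (auto simp: bij_betw_def inj_on_def)

definition nbr_index :: "'a \<Rightarrow> 'a \<Rightarrow> nat" where "nbr_index x y = inv_into {..<deg x} (nbr x) y"

lemma nbr_index: "x \<in> V \<Longrightarrow> y \<in> neighbours E x \<Longrightarrow> nbr_index x y < deg x \<and> nbr x (nbr_index x y) = y"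
  using nbr_props(1)[of x] f_inv_into_f[of y "nbr x" "{..<deg x}"] inv_into_into[of y "nbr x" "{..<deg x}"]
  unfolding bij_betw_def nbr_index_def by simp

lemma nbr_index_nbr: "x \<in> V \<Longrightarrow> j < deg x \<Longrightarrow> nbr_index x (nbr x j) = j"
  using nbr_props(1)[of x] unfolding bij_betw_def nbr_index_def by simp

lemma nbr_index_par: "x \<in> V \<Longrightarrow> x \<noteq> \<rho> \<Longrightarrow> nbr_index x (par x) = 0"
  using nbr_index_nbr[of x 0] nbr_props(2)[of x] deg_ge_1[of x] by simp

lemma nbr_index_child: "y \<in> ch x \<Longrightarrow> x \<noteq> \<rho> \<Longrightarrow> 1 \<le> nbr_index x y \<and> nbr_index x y < deg x"
proof -
  assume y: "y \<in> ch x" and x: "x \<noteq> \<rho>"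
  have xV: "x \<in> V" using chD[OF y] by simp
  have n: "y \<in> neighbours E x" using y neighbours_eq[OF xV] by simp
  have "nbr_index x y \<noteq> 0"
  proof
    assume "nbr_index x y = 0"
    then have "y = par x" using nbr_index[OF xV n] nbr_props(2)[OF xV x] by simp
    then show False using y par_notin_ch[OF xV x] by simp
  qed
  then show ?thesis using nbr_index[OF xV n] by simp
qed

definition root_path :: "'a list \<Rightarrow> bool" where
  "root_path p \<longleftrightarrow> p \<noteq> [] \<and> hd p = \<rho> \<and> successively (\<lambda>x y. {x, y} \<in> E) p"

lemma root_path_single: "root_path [z] \<longleftrightarrow> z = \<rho>" by (simp add: root_path_def)

lemma root_path_snoc: "p \<noteq> [] \<Longrightarrow> root_path (p @ [y]) \<longleftrightarrow> root_path p \<and> {last p, y} \<in> E"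
  by (auto simp: root_path_def successively_append_iff)

lemma root_path_induct [consumes 1, case_names root step]:
  assumes "root_path p" and "P [\<rho>]" and "\<And>p y. root_path p \<Longrightarrow> P p \<Longrightarrow> {last p, y} \<in> E \<Longrightarrow> P (p @ [y])"
  shows "P p"
  using assms(1)
proof (induction p rule: rev_induct)
  case Nil
  then show ?case by (simp add: root_path_def)
next
  case (snoc y p)
  then show ?case using assms(2,3) by (cases "p = []") (auto simp: root_path_single root_path_snoc)
qed

lemma root_path_ne: "root_path p \<Longrightarrow> p \<noteq> []" by (simp add: root_path_def)

lemma root_path_last_in_V: "root_path p \<Longrightarrow> last p \<in> V"
  by (induction p rule: root_path_induct) (use root_in_V adj_in_V in auto)

definition entries :: "'a list \<Rightarrow> 'a \<Rightarrow> nat" where "entries p x = count_list (exits p (par x)) x"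
definition returns :: "'a list \<Rightarrow> 'a \<Rightarrow> nat" where "returns p x = count_list (exits p x) (par x)"

lemma step_cases:
  assumes "{z, y} \<in> E"
  obtains (down) "y \<in> ch z" | (up) "z \<noteq> \<rho>" "y = par z" "z \<in> V"
proof -
  have z: "z \<in> V" using adj_in_V[OF assms] by simp
  have "y \<in> neighbours E z" using assms by (simp add: neighbours_def)
  then have "y \<in> ch z \<or> (z \<noteq> \<rho> \<and> y = par z)" using neighbours_eq[OF z] by (auto split: if_splits)
  then show ?thesis using that z by blast
qed

text \<open>The edge above \<open>x\<close> is the only passage into or out of the subtree of
  \<open>x\<close>, so entries and returns alternate, beginning with an entry.\<close>

lemma balance:
  assumes "root_path p" and x: "x \<in> V" "x \<noteq> \<rho>"
  shows "entries p x = returns p x + of_bool (in_subtree x (last p))"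
  using assms(1)
proof (induction p rule: root_path_induct)
  case root
  then show ?case using x by (simp add: entries_def returns_def in_subtree_root)
next
  case (step p y)
  let ?z = "last p"
  have ne: "p \<noteq> []" using root_path_ne[OF step.hyps(1)] .
  have U: "entries (p @ [y]) x = entries p x + of_bool (?z = par x \<and> y = x)"
    unfolding entries_def count_exits_snoc[OF ne] by simp
  have D: "returns (p @ [y]) x = returns p x + of_bool (?z = x \<and> y = par x)"
    unfolding returns_def count_exits_snoc[OF ne] by simp
  show ?case using step.hyps(2)
  proof (cases rule: step_cases)
    case down
    note c = chD[OF down]
    have u: "(?z = par x \<and> y = x) \<longleftrightarrow> x = y" using c by metis
    have d: "\<not> (?z = x \<and> y = par x)"
    proof
      assume "?z = x \<and> y = par x"
      then have "par x \<in> ch x" using down by simp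
      then show False using par_notin_ch[OF x] by simp
    qed
    have i: "in_subtree x y \<longleftrightarrow> x = y \<or> in_subtree x ?z" using in_subtree_step[of x y] c by simp
    have ex: "\<not> (x = y \<and> in_subtree x ?z)" using not_in_subtree_par[of y] c by metis
    show ?thesis unfolding U D u using step.IH d i ex by auto
  next
    case up
    have u: "\<not> (?z = par x \<and> y = x)"
    proof
      assume a: "?z = par x \<and> y = x"
      then have "par ?z = x" using up(2) by metis
      then have "Suc (lev x) = lev ?z" using par_props[OF up(3) up(1)] by metis
      moreover have "Suc (lev ?z) = lev x" using par_props[OF x] a by simp
      ultimately show False by simp
    qed
    have d: "(?z = x \<and> y = par x) \<longleftrightarrow> x = ?z" using up(2) by metis
    have i: "in_subtree x ?z \<longleftrightarrow> x = ?z \<or> in_subtree x y" using in_subtree_step[of x ?z] up(2) by simp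
    have ex: "\<not> (x = ?z \<and> in_subtree x y)" using not_in_subtree_par[OF up(3) up(1)] up(2) by metis
    show ?thesis unfolding U D d using step.IH u i ex by auto
  qed
qed

lemma traversals_child:
  assumes p: "root_path p" and y: "y \<in> ch (last p)"
  shows "traversals p (last p) y = 2 * count_list (exits p (last p)) y"
proof -
  note c = chD[OF y]
  have "\<not> in_subtree y (last p)" using not_in_subtree_par[of y] c by simp
  then have "entries p y = returns p y" using balance[OF p, of y] c by simp
  moreover have "traversals p (last p) y = entries p y + returns p y"
    unfolding entries_def returns_def using c adj_in_V[of "last p" y] by (simp add: traversals_eq_exits[OF _ root_path_ne[OF p]])
  ultimately show ?thesis using c by (simp add: entries_def)
qed

lemma traversals_parent:
  assumes p: "root_path p" and x: "last p \<noteq> \<rho>"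
  shows "traversals p (last p) (par (last p)) = 2 * count_list (exits p (last p)) (par (last p)) + 1"
proof -
  let ?x = "last p"
  have xV: "?x \<in> V" by (rule root_path_last_in_V[OF p])
  have "in_subtree ?x ?x" using in_subtree_step by blast
  then have "entries p ?x = returns p ?x + 1" using balance[OF p xV x] by simp
  moreover have "traversals p ?x (par ?x) = returns p ?x + entries p ?x"
    unfolding entries_def returns_def using par_props[OF xV x] adj_in_V[of ?x "par ?x"]
    by (simp add: traversals_eq_exits[OF _ root_path_ne[OF p]])
  ultimately show ?thesis by (simp add: returns_def)
qed

lemma exits_neighbours: "root_path p \<Longrightarrow> set (exits p x) \<subseteq> neighbours E x"
proof (induction p rule: root_path_induct)
  case (step p y)
  show ?case
  proof (cases "last p = x")
    case True
    then have "y \<in> neighbours E x" using step.hyps(2) by (simp add: neighbours_def)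
    then show ?thesis using step.IH True by (simp add: exits_snoc[OF root_path_ne[OF step.hyps(1)]])
  next
    case False
    then show ?thesis using step.IH by (simp add: exits_snoc[OF root_path_ne[OF step.hyps(1)]])
  qed
qed simp

definition step_prob :: "'a list \<Rightarrow> 'a \<Rightarrow> real" where
  "step_prob p y = indicator (neighbours E (last p)) y * tsaw_weight \<beta> (traversals p (last p) y) /
     (\<Sum>z\<in>neighbours E (last p). tsaw_weight \<beta> (traversals p (last p) z))"

text \<open>Here the walk separates into urns: by \<open>balance\<close> the crossings of the edges
  at the current vertex, including those made from their other ends, are determined by the exits
  from this vertex alone.\<close>

lemma weight_eq_urn_weight:
  assumes p: "root_path p" and y: "y \<in> neighbours E (last p)"
  shows "tsaw_weight \<beta> (traversals p (last p) y) = urn_weight (last p \<noteq> \<rho>) (map (nbr_index (last p)) (exits p (last p))) (nbr_index (last p) y)"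
proof -
  let ?x = "last p"
  have xV: "?x \<in> V" by (rule root_path_last_in_V[OF p])
  have inj: "inj_on (nbr_index ?x) (neighbours E ?x)" using nbr_index[OF xV] by (metis inj_onI)
  have "count_list (map (nbr_index ?x) (exits p ?x)) (nbr_index ?x y) = count_list (exits p ?x) y"
  proof (cases "y \<in> set (exits p ?x)")
    case True
    then show ?thesis using count_list_inj_map[OF inj_on_subset[OF inj exits_neighbours[OF p]]] by simp
  next
    case False
    then have "nbr_index ?x y \<notin> set (map (nbr_index ?x) (exits p ?x))"
      using inj y exits_neighbours[OF p, of ?x] by (auto simp: inj_on_def)
    then show ?thesis using False by (simp add: count_list_0_iff del: set_map)
  qed
  moreover have "traversals p ?x y = 2 * count_list (exits p ?x) y + of_bool (?x \<noteq> \<rho> \<and> nbr_index ?x y = 0)"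
  proof (cases "y \<in> ch ?x")
    case True
    have "\<not> (?x \<noteq> \<rho> \<and> nbr_index ?x y = 0)"
    proof
      assume "?x \<noteq> \<rho> \<and> nbr_index ?x y = 0"
      then show False using nbr_index_child[OF True] by simp
    qed
    then show ?thesis using traversals_child[OF p True] by simp
  next
    case False
    then have "?x \<noteq> \<rho>" "y = par ?x" using y neighbours_eq[OF xV] by (auto split: if_splits)
    then show ?thesis using traversals_parent[OF p] nbr_index_par[OF xV] by simp
  qed
  ultimately show ?thesis by (simp add: tsaw_weight_def urn_weight_def)
qed

lemma step_prob_eq_urn:
  assumes p: "root_path p" and y: "y \<in> neighbours E (last p)"
  shows "step_prob p y = pmf (urn (deg (last p)) (last p \<noteq> \<rho>) (map (nbr_index (last p)) (exits p (last p)))) (nbr_index (last p) y)"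
proof -
  let ?x = "last p" and ?h = "map (nbr_index (last p)) (exits p (last p))"
  have xV: "?x \<in> V" by (rule root_path_last_in_V[OF p])
  have "(\<Sum>z\<in>neighbours E ?x. tsaw_weight \<beta> (traversals p ?x z)) = (\<Sum>z\<in>neighbours E ?x. urn_weight (?x \<noteq> \<rho>) ?h (nbr_index ?x z))"
    by (intro sum.cong refl weight_eq_urn_weight p)
  also have "\<dots> = (\<Sum>i<deg ?x. urn_weight (?x \<noteq> \<rho>) ?h i)"
    using sum.reindex_bij_betw[OF nbr_props(1)[OF xV], of "\<lambda>z. urn_weight (?x \<noteq> \<rho>) ?h (nbr_index ?x z)"] by (simp add: nbr_index_nbr[OF xV])
  finally show ?thesis unfolding step_prob_def pmf_urn[OF deg_ge_1] using weight_eq_urn_weight[OF p y] y nbr_index[OF xV y] by simp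
qed

section \<open>The walk read off independent stacks\<close>

definition Om :: "('a \<Rightarrow> nat list \<Rightarrow> nat) measure" where
  "Om = PiM UNIV (\<lambda>x. field (deg x) (x \<noteq> \<rho>))"

lemma prob_space_Om: "prob_space Om"
  unfolding Om_def by (intro prob_space_PiM prob_space_field)

sublocale Om: prob_space Om by (rule prob_space_Om)

lemma space_Om [simp]: "space Om = UNIV"
  by (auto simp: Om_def space_PiM)

lemma nn_integral_Om_resample:
  assumes "G \<in> borel_measurable Om"
  shows "(\<integral>\<^sup>+w. G w \<partial>Om) = (\<integral>\<^sup>+w. (\<integral>\<^sup>+f. G (w(x := f)) \<partial>field (deg x) (x \<noteq> \<rho>)) \<partial>Om)"
  using assms unfolding Om_def by (intro nn_integral_PiM_resample prob_space_field)

lemma measurable_Om_component [measurable]: "(\<lambda>w. w x) \<in> measurable Om (field (deg x) (x \<noteq> \<rho>))"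
  unfolding Om_def by (rule measurable_component_singleton) simp

lemma measurable_stack [measurable]: "(\<lambda>w. stack_seq (w x) t) \<in> measurable Om (count_space UNIV)"
  by (rule measurable_compose[OF measurable_Om_component measurable_stack_seq])

definition good :: "('a \<Rightarrow> nat list \<Rightarrow> nat) \<Rightarrow> bool" where
  "good w \<longleftrightarrow> (\<forall>x\<in>V. good_seq (deg x) (stack_seq (w x)))"

lemma AE_good: "AE w in Om. good w"
  unfolding good_def
proof (subst AE_ball_countable[OF countable_V[OF lf]], intro ballI)
  fix x assume "x \<in> V"
  show "AE w in Om. good_seq (deg x) (stack_seq (w x))"
    unfolding Om_def by (rule AE_PiM_component) (auto intro: prob_space_field AE_field_good deg_ge_1)
qed

primrec hist :: "('a \<Rightarrow> nat list \<Rightarrow> nat) \<Rightarrow> nat \<Rightarrow> 'a list" where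
  "hist w 0 = [\<rho>]"
| "hist w (Suc n) = hist w n @ [nbr (last (hist w n)) (stack_seq (w (last (hist w n))) (length (exits (hist w n) (last (hist w n)))))]"

lemma hist_ne [simp]: "hist w n \<noteq> []" by (cases n) auto

lemma length_hist [simp]: "length (hist w n) = Suc n" by (induction n) auto

lemma exits_hist: "exits (hist w n) x = map (nbr x) (stack_prefix (w x) (length (exits (hist w n) x)))"
proof (induction n)
  case (Suc n)
  let ?p = "hist w n"
  show ?case
  proof (cases "last ?p = x")
    case True
    have "exits (hist w (Suc n)) x = exits ?p x @ [nbr x (stack_seq (w x) (length (exits ?p x)))]"
      using True by (simp add: exits_snoc)
    then show ?thesis using Suc by (simp add: stack_seq_def)
  next
    case False
    have "exits (hist w (Suc n)) x = exits ?p x" using False by (simp add: exits_snoc)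
    then show ?thesis using Suc by simp
  qed
qed simp

lemma hist_in_V: "set (hist w n) \<subseteq> V"
  by (induction n) (auto simp: root_in_V nbr_in_V)

lemma root_path_hist: "good w \<Longrightarrow> root_path (hist w n)"
proof (induction n)
  case 0
  then show ?case by (simp add: root_path_single)
next
  case (Suc n)
  let ?x = "last (hist w n)"
  have x: "?x \<in> V" using hist_in_V[of w n] last_in_set[of "hist w n"] by auto
  have "stack_seq (w ?x) (length (exits (hist w n) ?x)) < deg ?x" using Suc.prems x by (auto simp: good_def good_seq_def)
  from nbr_neighbour[OF x this] have "{?x, nbr ?x (stack_seq (w ?x) (length (exits (hist w n) ?x)))} \<in> E" by (simp add: neighbours_def)
  then show ?case using Suc by (simp add: root_path_snoc)
qed

text \<open>A walk that has followed \<open>p\<close> has consulted only the first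
  \<open>length (exits p x)\<close> draws of each stack.\<close>

lemma hist_cong:
  "hist w n = p \<Longrightarrow> (\<And>x t. t < length (exits p x) \<Longrightarrow> stack_seq (w' x) t = stack_seq (w x) t) \<Longrightarrow> hist w' n = p"
proof (induction n arbitrary: p)
  case (Suc n)
  let ?q = "hist w n"
  have p: "p = ?q @ [nbr (last ?q) (stack_seq (w (last ?q)) (length (exits ?q (last ?q))))]" using Suc.prems(1) by simp
  have le: "length (exits ?q x) \<le> length (exits p x)" for x unfolding p by (simp add: exits_snoc)
  have lt: "length (exits ?q (last ?q)) < length (exits p (last ?q))" unfolding p by (simp add: exits_snoc)
  have "hist w' n = ?q"
  proof (rule Suc.IH[OF refl])
    fix x t assume "t < length (exits ?q x)"
    then show "stack_seq (w' x) t = stack_seq (w x) t" using Suc.prems(2)[of t x] le[of x] by simp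
  qed
  moreover have "stack_seq (w' (last ?q)) (length (exits ?q (last ?q))) = stack_seq (w (last ?q)) (length (exits ?q (last ?q)))"
    by (rule Suc.prems(2)[OF lt])
  ultimately show ?case using p by simp
qed simp

lemma hist_upd:
  assumes "length h = length (exits p x)"
  shows "hist (w(x := (w x)(h := v))) n = p \<longleftrightarrow> hist w n = p"
proof -
  have s: "stack_seq ((w(x := (w x)(h := v))) y) t = stack_seq (w y) t" if "t < length (exits p y)" for y t
    using that assms by (auto simp: stack_seq_upd)
  show ?thesis
  proof
    assume "hist (w(x := (w x)(h := v))) n = p"
    then show "hist w n = p" by (rule hist_cong) (rule s[symmetric])
  next
    assume "hist w n = p"
    then show "hist (w(x := (w x)(h := v))) n = p" by (rule hist_cong) (rule s)
  qed
qed

lemma hist_event [measurable]: "{w. hist w n = p} \<in> sets Om"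
proof (induction n arbitrary: p)
  case 0
  show ?case by (cases "p = [\<rho>]") (use sets.top[of Om] in auto)
next
  case (Suc n)
  show ?case
  proof (cases p rule: rev_cases)
    case Nil
    then have "{w. hist w (Suc n) = p} = {}" by auto
    then show ?thesis by simp
  next
    case (snoc q y)
    let ?x = "last q" and ?i = "length (exits q (last q))"
    have "{w. hist w (Suc n) = p} = {w. hist w n = q} \<inter> {w \<in> space Om. nbr ?x (stack_seq (w ?x) ?i) = y}"
      unfolding snoc by auto
    moreover have "{w \<in> space Om. nbr ?x (stack_seq (w ?x) ?i) = y} \<in> sets Om"
    proof -
      have "(\<lambda>w. stack_seq (w ?x) ?i) -` {j. nbr ?x j = y} \<inter> space Om \<in> sets Om"
        by (rule measurable_sets[OF measurable_stack]) simp
      then show ?thesis by (simp add: vimage_def)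
    qed
    ultimately show ?thesis using Suc.IH[of q] by auto
  qed
qed

text \<open>The next exit is a single coordinate of a single stack, the one at the history
  \<open>?h\<close>, and by \<open>hist_upd\<close> the event \<open>hist w n = p\<close> does not
  depend on it. Resampling the stack and then the coordinate replaces it by a fresh draw from the
  urn, whose law is that of the step.\<close>

lemma hist_step_prob:
  assumes p: "root_path p" and y: "y \<in> neighbours E (last p)"
  shows "emeasure Om {w. hist w (Suc n) = p @ [y]} = emeasure Om {w. hist w n = p} * ennreal (step_prob p y)"
proof -
  let ?x = "last p"
  let ?h = "map (nbr_index ?x) (exits p ?x)"
  let ?U = "urn (deg ?x) (?x \<noteq> \<rho>) ?h"
  have xV: "?x \<in> V" by (rule root_path_last_in_V[OF p])
  have len: "length ?h = length (exits p ?x)" by simp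
  define G where "G w = indicator {w. hist w n = p} w * (indicator {j. nbr ?x j = y} (w ?x ?h) :: ennreal)" for w
  have coord: "(\<lambda>w. w ?x ?h) \<in> measurable Om (count_space UNIV)"
    by (rule measurable_compose[OF measurable_Om_component measurable_field_component])
  have i1: "(\<lambda>w. indicator {w. hist w n = p} w :: ennreal) \<in> borel_measurable Om"
    using hist_event by simp
  have i2: "(\<lambda>w. indicator {j. nbr ?x j = y} (w ?x ?h) :: ennreal) \<in> borel_measurable Om"
    by (rule measurable_compose[OF coord]) simp
  note [measurable] = i1 i2
  have Gm: "G \<in> borel_measurable Om" unfolding G_def by measurable
  \<comment> \<open>On good stacks all colours are in range, so \<open>nbr_index\<close> recovers
    the consumed draws from the vertices, and the prefix of the stack is \<open>?h\<close>.\<close>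
  have "AE w in Om. indicator {w. hist w (Suc n) = p @ [y]} w = G w"
    using AE_good
  proof eventually_elim
    case (elim w)
    show ?case
    proof (cases "hist w n = p")
      case True
      let ?i = "length (exits p ?x)"
      have "exits p ?x = map (nbr ?x) (stack_prefix (w ?x) ?i)" using exits_hist[of w n ?x] True by simp
      then have "?h = map (nbr_index ?x) (map (nbr ?x) (stack_prefix (w ?x) ?i))" by simp
      also have "\<dots> = map (\<lambda>j. j) (stack_prefix (w ?x) ?i)"
        unfolding map_map
      proof (rule map_cong[OF refl])
        fix j assume "j \<in> set (stack_prefix (w ?x) ?i)"
        then have "j < deg ?x" using elim xV by (auto simp: stack_prefix_eq_map good_def good_seq_def)
        then show "(nbr_index ?x \<circ> nbr ?x) j = j" by (simp add: nbr_index_nbr[OF xV])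
      qed
      finally have "?h = stack_prefix (w ?x) ?i" by simp
      then have "stack_seq (w ?x) ?i = w ?x ?h" by (simp add: stack_seq_def)
      then show ?thesis using True by (simp add: G_def indicator_def)
    next
      case False
      then show ?thesis by (simp add: G_def indicator_def)
    qed
  qed
  then have "(\<integral>\<^sup>+w. indicator {w. hist w (Suc n) = p @ [y]} w \<partial>Om) = (\<integral>\<^sup>+w. G w \<partial>Om)"
    by (rule nn_integral_cong_AE)
  then have "emeasure Om {w. hist w (Suc n) = p @ [y]} = (\<integral>\<^sup>+w. G w \<partial>Om)"
    by (simp only: nn_integral_indicator[OF hist_event])
  also have "\<dots> = (\<integral>\<^sup>+w. (\<integral>\<^sup>+f. G (w(?x := f)) \<partial>field (deg ?x) (?x \<noteq> \<rho>)) \<partial>Om)"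
    by (rule nn_integral_Om_resample[OF Gm])
  also have "\<dots> = (\<integral>\<^sup>+w. (\<integral>\<^sup>+f. indicator {w. hist w n = p} (w(?x := f)) * ennreal (step_prob p y) \<partial>field (deg ?x) (?x \<noteq> \<rho>)) \<partial>Om)"
  proof (rule nn_integral_cong)
    fix w
    have upd: "(\<lambda>f. w(?x := f)) \<in> measurable (field (deg ?x) (?x \<noteq> \<rho>)) Om"
      unfolding Om_def by (rule measurable_fun_upd[where J=UNIV]) (auto simp: space_PiM)
    have m: "(\<lambda>f. G (w(?x := f))) \<in> borel_measurable (field (deg ?x) (?x \<noteq> \<rho>))"
      by (rule measurable_compose[OF upd Gm])
    have "(\<integral>\<^sup>+f. G (w(?x := f)) \<partial>field (deg ?x) (?x \<noteq> \<rho>))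
        = (\<integral>\<^sup>+f. (\<integral>\<^sup>+v. G (w(?x := f(?h := v))) \<partial>?U) \<partial>field (deg ?x) (?x \<noteq> \<rho>))"
      unfolding field_def
      by (rule nn_integral_PiM_resample) (use m in \<open>auto simp: field_def intro: measure_pmf.prob_space_axioms\<close>)
    also have "\<dots> = (\<integral>\<^sup>+f. (\<integral>\<^sup>+v. indicator {w. hist w n = p} (w(?x := f)) * indicator {j. nbr ?x j = y} v \<partial>?U) \<partial>field (deg ?x) (?x \<noteq> \<rho>))"
    proof (intro nn_integral_cong)
      fix f v
      have "hist ((w(?x := f))(?x := ((w(?x := f)) ?x)(?h := v))) n = p \<longleftrightarrow> hist (w(?x := f)) n = p"
        by (rule hist_upd[OF len])
      then show "G (w(?x := f(?h := v))) = indicator {w. hist w n = p} (w(?x := f)) * indicator {j. nbr ?x j = y} v"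
        by (simp add: G_def indicator_def)
    qed
    also have "\<dots> = (\<integral>\<^sup>+f. indicator {w. hist w n = p} (w(?x := f)) * emeasure ?U {j. nbr ?x j = y} \<partial>field (deg ?x) (?x \<noteq> \<rho>))"
      by (simp add: nn_integral_cmult)
    also have "emeasure ?U {j. nbr ?x j = y} = ennreal (step_prob p y)"
    proof -
      have "emeasure ?U {j. nbr ?x j = y} = emeasure ?U {nbr_index ?x y}"
      proof (rule emeasure_eq_AE)
        show "AE j in ?U. j \<in> {j. nbr ?x j = y} \<longleftrightarrow> j \<in> {nbr_index ?x y}"
          unfolding AE_measure_pmf_iff
        proof
          fix j assume "j \<in> set_pmf ?U"
          then have "j < deg ?x" using set_pmf_urn[OF deg_ge_1] by blast
          then show "j \<in> {j. nbr ?x j = y} \<longleftrightarrow> j \<in> {nbr_index ?x y}" using nbr_index[OF xV y] nbr_inj[OF xV, of j "nbr_index ?x y"] by auto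
        qed
      qed auto
      then show ?thesis by (simp add: emeasure_pmf_single step_prob_eq_urn[OF p y])
    qed
    finally show "(\<integral>\<^sup>+f. G (w(?x := f)) \<partial>field (deg ?x) (?x \<noteq> \<rho>)) =
      (\<integral>\<^sup>+f. indicator {w. hist w n = p} (w(?x := f)) * ennreal (step_prob p y) \<partial>field (deg ?x) (?x \<noteq> \<rho>))" .
  qed
  also have "\<dots> = (\<integral>\<^sup>+w. indicator {w. hist w n = p} w * ennreal (step_prob p y) \<partial>Om)"
  proof -
    have "(\<lambda>w. indicator {w. hist w n = p} w * ennreal (step_prob p y)) \<in> borel_measurable Om" by measurable
    from nn_integral_Om_resample[OF this, of ?x] show ?thesis by simp
  qed
  also have "\<dots> = emeasure Om {w. hist w n = p} * ennreal (step_prob p y)"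
    by (simp add: nn_integral_multc)
  finally show ?thesis .
qed

lemma hist_not_root_path: "\<not> root_path p \<Longrightarrow> emeasure Om {w. hist w n = p} = 0"
proof -
  assume p: "\<not> root_path p"
  have "AE w in Om. w \<notin> {w. hist w n = p}" using AE_good by eventually_elim (use p root_path_hist in auto)
  then show ?thesis by (subst (asm) AE_iff_measurable[OF hist_event]) auto
qed

text \<open>
  \<open>Y k w x\<close> is the number of entries into \<open>x\<close> from its parent when every child of the root has been
  entered \<open>k\<close> times and the walk is back at the root; it is meaningless for \<open>x = \<rho>\<close>.
\<close>

primrec Yl :: "nat \<Rightarrow> ('a \<Rightarrow> nat list \<Rightarrow> nat) \<Rightarrow> nat \<Rightarrow> 'a \<Rightarrow> nat" where
  "Yl k w 0 x = k"
| "Yl k w (Suc n) x = count_before (stack_seq (w (par x))) (nbr_index (par x) x) (Yl k w n (par x))"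

definition Y :: "nat \<Rightarrow> ('a \<Rightarrow> nat list \<Rightarrow> nat) \<Rightarrow> 'a \<Rightarrow> nat" where
  "Y k w x = Yl k w (lev x - 1) x"

lemma Y_root_child: "c \<in> ch \<rho> \<Longrightarrow> Y k w c = k"
  using chD[of c \<rho>] by (simp add: Y_def)

lemma Y_child: "c \<in> ch x \<Longrightarrow> x \<noteq> \<rho> \<Longrightarrow> Y k w c = count_before (stack_seq (w x)) (nbr_index x c) (Y k w x)"
proof -
  assume c: "c \<in> ch x" and x: "x \<noteq> \<rho>"
  have cc: "par c = x" "lev c = Suc (lev x)" "x \<in> V" using chD[OF c] by auto
  obtain n where n: "lev x = Suc n" using lev_eq_0[OF cc(3)] x by (cases "lev x") auto
  then show ?thesis by (simp add: Y_def cc)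
qed

text \<open>The induction begins at the children of the root, because \<open>Y\<close> has no
  meaning at the root itself.\<close>

lemma child_induct [consumes 2, case_names root_child child]:
  assumes x: "x \<in> V" "x \<noteq> \<rho>"
    and r: "\<And>c. c \<in> ch \<rho> \<Longrightarrow> P c"
    and s: "\<And>x c. x \<in> V \<Longrightarrow> x \<noteq> \<rho> \<Longrightarrow> c \<in> ch x \<Longrightarrow> P x \<Longrightarrow> P c"
  shows "P x"
  using x
proof (induction "lev x" arbitrary: x)
  case 0
  then show ?case using lev_eq_0[of x] by simp
next
  case (Suc n)
  have c: "x \<in> ch (par x)" using ch_par[OF Suc.prems] .
  show ?case
  proof (cases "par x = \<rho>")
    case True
    then show ?thesis using c r by simp
  next
    case False
    have "n = lev (par x)" using Suc.hyps(2) chD[OF c] by simp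
    from Suc.hyps(1)[OF this par_in_V False] show ?thesis using s[OF par_in_V False c] by simp
  qed
qed

lemma count_exits_hist:
  assumes g: "good w" and x: "x \<in> V" and j: "j < deg x"
  shows "count_list (exits (hist w n) x) (nbr x j) = count_list (stack_prefix (w x) (length (exits (hist w n) x))) j"
proof -
  let ?l = "stack_prefix (w x) (length (exits (hist w n) x))"
  have sub: "set ?l \<subseteq> {..<deg x}" using g x by (auto simp: stack_prefix_eq_map good_def good_seq_def)
  have inj: "inj_on (nbr x) {..<deg x}" using nbr_props(1)[OF x] by (simp add: bij_betw_def)
  have "count_list (map (nbr x) ?l) (nbr x j) = count_list ?l j"
  proof (cases "j \<in> set ?l")
    case True
    then show ?thesis using count_list_inj_map[OF inj_on_subset[OF inj sub]] by simp
  next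
    case False
    have "nbr x j \<notin> nbr x ` set ?l"
    proof
      assume "nbr x j \<in> nbr x ` set ?l"
      then obtain i where i: "i \<in> set ?l" "nbr x j = nbr x i" by blast
      then have "i < deg x" using sub by blast
      then show False using nbr_inj[OF x j, of i] i False by simp
    qed
    then show ?thesis using False by (simp add: count_list_0_iff)
  qed
  then show ?thesis using exits_hist[of w n x] by simp
qed

lemma returns_hist: "good w \<Longrightarrow> x \<in> V \<Longrightarrow> x \<noteq> \<rho> \<Longrightarrow>
    returns (hist w n) x = count_list (stack_prefix (w x) (length (exits (hist w n) x))) 0"
  using count_exits_hist[of w x 0 n] deg_ge_1[of x] nbr_props(2)[of x] by (simp add: returns_def)

lemma entries_hist: "good w \<Longrightarrow> c \<in> ch x \<Longrightarrow>
    entries (hist w n) c = count_list (stack_prefix (w x) (length (exits (hist w n) x))) (nbr_index x c)"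
proof -
  assume g: "good w" and c: "c \<in> ch x"
  have x: "x \<in> V" "par c = x" using chD[OF c] by auto
  have "c \<in> neighbours E x" using c neighbours_eq[OF x(1)] by simp
  from nbr_index[OF x(1) this] count_exits_hist[OF g x(1), of "nbr_index x c" n] show ?thesis by (simp add: entries_def x)
qed

text \<open>At the moment of an exit the walk stands at \<open>x\<close>; by \<open>balance\<close>
  it has then gone up from \<open>x\<close> once less than it has come in.\<close>

lemma zeros_before_exit:
  assumes g: "good w" and x: "x \<in> V" "x \<noteq> \<rho>"
  shows "i < length (exits (hist w n) x) \<Longrightarrow> count_list (stack_prefix (w x) i) 0 < entries (hist w n) x"
proof (induction n)
  case (Suc n)
  let ?p = "hist w n"
  obtain y where p: "hist w (Suc n) = ?p @ [y]" by simp
  have le: "entries ?p x \<le> entries (hist w (Suc n)) x" unfolding p entries_def by (simp add: count_exits_snoc)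
  show ?case
  proof (cases "i < length (exits ?p x)")
    case True
    then show ?thesis using Suc.IH le by simp
  next
    case False
    have z: "last ?p = x"
    proof (rule ccontr)
      assume "last ?p \<noteq> x"
      then have "exits (hist w (Suc n)) x = exits ?p x" unfolding p by (simp add: exits_snoc)
      then show False using Suc.prems False by simp
    qed
    then have i: "i = length (exits ?p x)" using Suc.prems False unfolding p by (simp add: exits_snoc)
    have "in_subtree x (last ?p)" using z in_subtree_step by blast
    then have "entries ?p x = returns ?p x + 1" using balance[OF root_path_hist[OF g] x] by simp
    then show ?thesis using returns_hist[OF g x, of n] i le by simp
  qed
qed simp

text \<open>Going down the tree, all exits from \<open>x\<close> so far have fewer zeros before them
  than there were entries into \<open>x\<close>, and by induction these number at most
  \<open>Y M w x\<close>. Together with \<open>Y_le_entries\<close> this takes the place of an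
  identity: the children of the root are not entered equally often, and their counts are enclosed
  between constant ones.\<close>

lemma entries_le_Y:
  assumes g: "good w" and M: "length (exits (hist w n) \<rho>) \<le> M" and x: "x \<in> V" "x \<noteq> \<rho>"
  shows "entries (hist w n) x \<le> Y M w x"
  using x
proof (induction rule: child_induct)
  case (root_child c)
  have "entries (hist w n) c \<le> length (exits (hist w n) \<rho>)"
    using chD[OF root_child] by (simp add: entries_def count_le_length)
  then show ?case using M Y_root_child[OF root_child] by simp
next
  case (child x c)
  let ?T = "length (exits (hist w n) x)" and ?s = "stack_seq (w x)" and ?j = "nbr_index x c"
  have "infinite {i. ?s i = 0}" using g child.hyps(1) deg_ge_1[of x] by (auto simp: good_def good_seq_def)
  then obtain t where t: "\<And>i. card {i'. i' < i \<and> ?s i' = 0} < Y M w x \<Longrightarrow> i < t"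
    using finite_before_kth[of ?s "Y M w x"] by blast
  have fin: "finite {i. ?s i = ?j \<and> card {i'. i' < i \<and> ?s i' = 0} < Y M w x}"
    by (rule finite_subset[of _ "{..<t}"]) (use t in auto)
  have "{i. i < ?T \<and> ?s i = ?j} \<subseteq> {i. ?s i = ?j \<and> card {i'. i' < i \<and> ?s i' = 0} < Y M w x}"
  proof
    fix i assume i: "i \<in> {i. i < ?T \<and> ?s i = ?j}"
    then have "count_list (stack_prefix (w x) i) 0 < entries (hist w n) x"
      using zeros_before_exit[OF g child.hyps(1,2), of i n] by simp
    then show "i \<in> {i. ?s i = ?j \<and> card {i'. i' < i \<and> ?s i' = 0} < Y M w x}"
      using i child.IH by (simp add: count_stack_prefix)
  qed
  then have "card {i. i < ?T \<and> ?s i = ?j} \<le> count_before ?s ?j (Y M w x)" unfolding count_before_def by (rule card_mono[OF fin])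
  then show ?case using entries_hist[OF g child.hyps(3), of n] Y_child[OF child.hyps(3,2)] by (simp add: count_stack_prefix)
qed

text \<open>With the walk back at the root, every other vertex has been left upwards as often as it
  was entered. So at least \<open>Y k w x\<close> zeros of its stack are consumed, and with them all
  draws that precede.\<close>

lemma Y_le_entries:
  assumes g: "good w" and l: "last (hist w n) = \<rho>" and k: "\<And>c. c \<in> ch \<rho> \<Longrightarrow> k \<le> entries (hist w n) c"
    and x: "x \<in> V" "x \<noteq> \<rho>"
  shows "Y k w x \<le> entries (hist w n) x"
  using x
proof (induction rule: child_induct)
  case (root_child c)
  then show ?case using k Y_root_child by simp
next
  case (child x c)
  let ?T = "length (exits (hist w n) x)" and ?s = "stack_seq (w x)" and ?j = "nbr_index x c"
  have "entries (hist w n) x = returns (hist w n) x"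
    using balance[OF root_path_hist[OF g] child.hyps(1,2), of n] l child.hyps(2) by (simp add: in_subtree_root)
  then have z: "Y k w x \<le> card {i. i < ?T \<and> ?s i = 0}"
    using child.IH returns_hist[OF g child.hyps(1,2), of n] by (simp add: count_stack_prefix)
  have "{i. ?s i = ?j \<and> card {i'. i' < i \<and> ?s i' = 0} < Y k w x} \<subseteq> {i. i < ?T \<and> ?s i = ?j}"
  proof
    fix i assume i: "i \<in> {i. ?s i = ?j \<and> card {i'. i' < i \<and> ?s i' = 0} < Y k w x}"
    have "i < ?T"
    proof (rule ccontr)
      assume "\<not> i < ?T"
      then have "card {i. i < ?T \<and> ?s i = 0} \<le> card {i'. i' < i \<and> ?s i' = 0}" by (intro card_mono) auto
      then show False using i z by simp
    qed
    then show "i \<in> {i. i < ?T \<and> ?s i = ?j}" using i by simp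
  qed
  then have "count_before ?s ?j (Y k w x) \<le> card {i. i < ?T \<and> ?s i = ?j}" unfolding count_before_def by (intro card_mono) auto
  then show ?case using entries_hist[OF g child.hyps(3), of n] Y_child[OF child.hyps(3,2)] by (simp add: count_stack_prefix)
qed

end

section \<open>Identification with the given process\<close>

locale tsaw_walk = tsaw M V E \<rho> \<beta> X + walk_tree V E \<rho> \<beta>
  for M :: "'w measure" and V :: "'a set" and E and \<rho> and \<beta> and X :: "nat \<Rightarrow> 'w \<Rightarrow> 'a"
begin

definition histM :: "nat \<Rightarrow> 'w \<Rightarrow> 'a list" where
  "histM n \<omega> = map (\<lambda>k. X k \<omega>) [0..<Suc n]"

lemma histM_Suc: "histM (Suc n) \<omega> = histM n \<omega> @ [X (Suc n) \<omega>]"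
  by (simp add: histM_def)

lemma length_histM [simp]: "length (histM n \<omega>) = Suc n" by (simp add: histM_def)

lemma last_histM [simp]: "last (histM n \<omega>) = X n \<omega>" by (simp add: histM_def)

lemma edge_count_histM: "edge_count X n x y \<omega> = traversals (histM n \<omega>) x y"
  unfolding edge_count_def traversals_def by (intro sum.cong) (auto simp: histM_def simp del: upt_Suc)

lemma X_in_V: "\<omega> \<in> space M \<Longrightarrow> X n \<omega> \<in> V"
  using measurable_space[OF measurable_X] by simp

lemma histM_in_V: "\<omega> \<in> space M \<Longrightarrow> set (histM n \<omega>) \<subseteq> V"
  by (auto simp: histM_def X_in_V simp del: upt_Suc)

lemma histM_generated:
  assumes p: "set p \<subseteq> V" "length p = Suc n"
  shows "{\<omega> \<in> space M. histM n \<omega> = p} \<in> sets (generated_upto M V X n)"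
proof -
  let ?G = "generated_upto M V X n"
  have sp: "space ?G = space M" using subalgebra_generated_upto[of n] by (simp add: subalgebra_def)
  have each: "{\<omega> \<in> space M. X k \<omega> = p ! k} \<in> sets ?G" if "k \<le> n" for k
  proof -
    have "{\<omega> \<in> space M. X k \<omega> = p ! k} = X k -` {p ! k} \<inter> space M" by auto
    also have "\<dots> \<in> sets ?G"
    proof -
      have sub: "{X k -` A \<inter> space M | k A. k \<le> n \<and> A \<subseteq> V} \<subseteq> Pow (space M)" by auto
      have "p ! k \<in> V" using p that by (simp add: subset_code(1))
      then have "X k -` {p ! k} \<inter> space M \<in> {X k -` A \<inter> space M | k A. k \<le> n \<and> A \<subseteq> V}" using that by blast
      then show ?thesis unfolding generated_upto_def sets_measure_of[OF sub] by (rule sigma_sets.Basic)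
    qed
    finally show ?thesis .
  qed
  have "{\<omega> \<in> space M. histM n \<omega> = p} = (\<Inter>k\<in>{..n}. {\<omega> \<in> space M. X k \<omega> = p ! k})"
    using p by (auto simp: histM_def list_eq_iff_nth_eq less_Suc_eq_le simp del: upt_Suc)
  also have "\<dots> \<in> sets ?G" using each by (intro sets.finite_INT) auto
  finally show ?thesis .
qed

lemma histM_event: "{\<omega> \<in> space M. histM n \<omega> = p} \<in> sets M"
proof (cases "set p \<subseteq> V \<and> length p = Suc n")
  case True
  then show ?thesis using histM_generated[of p n] subalgebra_generated_upto[of n] by (auto simp: subalgebra_def)
next
  case False
  then have e: "{\<omega> \<in> space M. histM n \<omega> = p} = {}" using histM_in_V by fastforce
  show ?thesis by (simp only: e sets.empty_sets)
qed

text \<open>The defining conditional probability is integrated over the event that the history is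
  \<open>p\<close>, on which the right-hand side of \<open>transition\<close> is the constant
  \<open>step_prob p y\<close>.\<close>

lemma histM_step_prob:
  assumes p: "set p \<subseteq> V" "length p = Suc n" and y: "y \<in> V"
  shows "emeasure M {\<omega> \<in> space M. histM (Suc n) \<omega> = p @ [y]} = emeasure M {\<omega> \<in> space M. histM n \<omega> = p} * ennreal (step_prob p y)"
proof -
  let ?F = "generated_upto M V X n" and ?x = "last p"
  let ?A = "{\<omega> \<in> space M. histM n \<omega> = p}" and ?B = "{\<omega> \<in> space M. X (Suc n) \<omega> = y}"
  interpret F: finite_measure_subalgebra M ?F
    by unfold_locales (rule subalgebra_generated_upto)
  have x: "?x \<in> V" using p by (cases p rule: rev_cases) auto
  have A: "?A \<in> sets ?F" by (rule histM_generated[OF p])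
  have AM: "?A \<in> sets M" by (rule histM_event)
  have B: "?B \<in> sets M"
    using measurable_sets[OF measurable_X[of "Suc n"], of "{y}"] y by (simp add: vimage_def Int_def conj_commute)
  have "{\<omega> \<in> space M. histM (Suc n) \<omega> = p @ [y]} = ?A \<inter> ?B" by (auto simp: histM_Suc)
  then have "measure M {\<omega> \<in> space M. histM (Suc n) \<omega> = p @ [y]} = (\<integral>\<omega>\<in>?A. indicator ?B \<omega> \<partial>M)"
    using AM B by (simp add: set_lebesgue_integral_def indicator_inter_arith[symmetric])
  also have "\<dots> = (\<integral>\<omega>\<in>?A. real_cond_exp M ?F (indicator ?B) \<omega> \<partial>M)"
    by (rule F.real_cond_exp_intA[OF _ A]) (use B in \<open>simp add: less_top[symmetric]\<close>)
  also have "\<dots> = (\<integral>\<omega>\<in>?A. step_prob p y \<partial>M)"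
    unfolding set_lebesgue_integral_def
  proof (rule integral_cong_AE)
    show "AE \<omega> in M. indicator ?A \<omega> *\<^sub>R real_cond_exp M ?F (indicator ?B) \<omega> = indicator ?A \<omega> *\<^sub>R step_prob p y"
      using transition[OF x y, of n] AE_space
    proof eventually_elim
      case (elim \<omega>)
      show ?case
      proof (cases "\<omega> \<in> ?A")
        case True
        then have h: "histM n \<omega> = p" by simp
        then have "X n \<omega> = ?x" using last_histM[of n \<omega>] by simp
        then show ?thesis using elim(1) True unfolding edge_count_histM h step_prob_def by simp
      qed simp
    qed
  qed (use AM in auto)
  also have "\<dots> = measure M ?A * step_prob p y" using AM by (simp add: set_lebesgue_integral_def)
  finally have m: "measure M {\<omega> \<in> space M. histM (Suc n) \<omega> = p @ [y]} = measure M ?A * step_prob p y" .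
  have "step_prob p y \<ge> 0" unfolding step_prob_def by (intro divide_nonneg_nonneg mult_nonneg_nonneg sum_nonneg) (auto simp: tsaw_weight_def)
  then show ?thesis unfolding emeasure_eq_measure m by (simp add: ennreal_mult)
qed

lemma hist_law: "set p \<subseteq> V \<Longrightarrow> emeasure M {\<omega> \<in> space M. histM n \<omega> = p} = emeasure Om {w. hist w n = p}"
proof (induction n arbitrary: p)
  case 0
  have h: "histM 0 \<omega> = [X 0 \<omega>]" for \<omega> by (simp add: histM_def)
  show ?case
  proof (cases "p = [\<rho>]")
    case True
    have "emeasure M {\<omega> \<in> space M. histM 0 \<omega> = p} = emeasure M (space M)"
      using start histM_event[of 0 p] by (intro emeasure_eq_AE) (auto simp: h True)
    moreover have "{w. hist w 0 = p} = space Om" using True by simp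
    ultimately show ?thesis using emeasure_space_1 Om.emeasure_space_1 by metis
  next
    case False
    have "AE \<omega> in M. \<omega> \<notin> {\<omega> \<in> space M. histM 0 \<omega> = p}"
      using start by eventually_elim (use False in \<open>auto simp: h\<close>)
    then have "emeasure M {\<omega> \<in> space M. histM 0 \<omega> = p} = 0"
      by (subst (asm) AE_iff_measurable[OF histM_event[of 0 p]]) auto
    moreover have "{w. hist w 0 = p} = {}" using False by auto
    ultimately show ?thesis by simp
  qed
next
  case (Suc n)
  show ?case
  proof (cases "length p = Suc (Suc n)")
    case False
    then have e: "{\<omega> \<in> space M. histM (Suc n) \<omega> = p} = {}" "{w. hist w (Suc n) = p} = {}"
      by (auto dest: arg_cong[where f=length] simp del: hist.simps)
    show ?thesis by (simp only: e emeasure_empty)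
  next
    case True
    then obtain q y where p: "p = q @ [y]" "length q = Suc n" by (cases p rule: rev_cases) auto
    have q: "set q \<subseteq> V" "y \<in> V" using Suc.prems p by auto
    have qne: "q \<noteq> []" using p by auto
    have IH: "emeasure M {\<omega> \<in> space M. histM n \<omega> = q} = emeasure Om {w. hist w n = q}" by (rule Suc.IH[OF q(1)])
    have L: "emeasure M {\<omega> \<in> space M. histM (Suc n) \<omega> = p} = emeasure Om {w. hist w n = q} * ennreal (step_prob q y)"
      unfolding p(1) histM_step_prob[OF q(1) p(2) q(2)] IH ..
    show ?thesis
    proof (cases "root_path p")
      case True
      then have "root_path q" "y \<in> neighbours E (last q)" using root_path_snoc[OF qne, of y] p by (auto simp: neighbours_def)
      then show ?thesis using L hist_step_prob[of q y n] p by simp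
    next
      case False
      have R: "emeasure Om {w. hist w (Suc n) = p} = 0" by (rule hist_not_root_path[OF False])
      show ?thesis
      proof (cases "root_path q")
        case True
        then have "y \<notin> neighbours E (last q)" using False root_path_snoc[OF qne, of y] p by (auto simp: neighbours_def)
        then show ?thesis using L R by (simp add: step_prob_def)
      next
        case False
        then show ?thesis using L R hist_not_root_path[OF False, of n] by simp
      qed
    qed
  qed
qed

text \<open>There are only countably many lists over \<open>V\<close>, so equality on single lists
  extends to every predicate.\<close>

lemma hist_law_pred: "emeasure M {\<omega> \<in> space M. Q (histM n \<omega>)} = emeasure Om {w. Q (hist w n)}"
  and hist_pred_sets: "{\<omega> \<in> space M. Q (histM n \<omega>)} \<in> sets M" "{w. Q (hist w n)} \<in> sets Om"
proof -
  let ?L = "lists V"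
  have cL: "countable ?L" using countable_V[OF lf] by (rule countable_lists)
  have mM: "histM n \<in> measurable M (count_space ?L)"
  proof (subst measurable_count_space_eq_countable[OF cL], intro conjI ballI)
    show "histM n \<in> space M \<rightarrow> ?L" using histM_in_V by (auto simp: lists_eq_set)
    show "histM n -` {p} \<inter> space M \<in> sets M" for p
      using histM_event[of n p] by (simp add: vimage_def Int_def conj_commute)
  qed
  have mO: "(\<lambda>w. hist w n) \<in> measurable Om (count_space ?L)"
  proof (subst measurable_count_space_eq_countable[OF cL], intro conjI ballI)
    show "(\<lambda>w. hist w n) \<in> space Om \<rightarrow> ?L" using hist_in_V by (auto simp: lists_eq_set)
    show "(\<lambda>w. hist w n) -` {p} \<inter> space Om \<in> sets Om" for p
      using hist_event[of n p] by (simp add: vimage_def)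
  qed
  have eq: "distr M (count_space ?L) (histM n) = distr Om (count_space ?L) (\<lambda>w. hist w n)"
  proof (rule measure_eqI_countable[OF _ _ cL])
    fix p assume "p \<in> ?L"
    then have pV: "set p \<subseteq> V" by (simp add: lists_eq_set)
    show "emeasure (distr M (count_space ?L) (histM n)) {p} = emeasure (distr Om (count_space ?L) (\<lambda>w. hist w n)) {p}"
      using \<open>p \<in> ?L\<close> hist_law[OF pV, of n]
      by (simp add: emeasure_distr[OF mM] emeasure_distr[OF mO] vimage_def Int_def conj_commute)
  qed auto
  let ?S = "{p \<in> ?L. Q p}"
  have eM: "histM n -` ?S \<inter> space M = {\<omega> \<in> space M. Q (histM n \<omega>)}" using histM_in_V by (auto simp: lists_eq_set)
  have eO: "(\<lambda>w. hist w n) -` ?S \<inter> space Om = {w. Q (hist w n)}" using hist_in_V by (auto simp: lists_eq_set)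
  have S: "?S \<in> sets (count_space ?L)" by auto
  show "{\<omega> \<in> space M. Q (histM n \<omega>)} \<in> sets M" using measurable_sets[OF mM S] eM by simp
  show "{w. Q (hist w n)} \<in> sets Om" using measurable_sets[OF mO S] eO by simp
  show "emeasure M {\<omega> \<in> space M. Q (histM n \<omega>)} = emeasure Om {w. Q (hist w n)}"
    using arg_cong[OF eq, of "\<lambda>M. emeasure M ?S"] emeasure_distr[OF mM S] emeasure_distr[OF mO S] eM eO by simp
qed

text \<open>The two processes share the laws of their finite histories. A property that persists is
  an increasing limit of such events, and continuity of measures transfers its probability.\<close>

lemma transfer_eventually:
  assumes mono: "\<And>p y. p \<noteq> [] \<Longrightarrow> Q p \<Longrightarrow> Q (p @ [y])"
  shows "emeasure M {\<omega> \<in> space M. \<exists>n. Q (histM n \<omega>)} = emeasure Om {w. \<exists>n. Q (hist w n)}"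
proof -
  have iM: "incseq (\<lambda>n. {\<omega> \<in> space M. Q (histM n \<omega>)})"
  proof (rule incseq_SucI, safe)
    fix n \<omega> assume "Q (histM n \<omega>)"
    then show "Q (histM (Suc n) \<omega>)" unfolding histM_Suc by (intro mono) (auto simp: histM_def)
  qed
  have iO: "incseq (\<lambda>n. {w. Q (hist w n)})"
  proof (rule incseq_SucI, safe)
    fix n w assume "Q (hist w n)"
    then show "Q (hist w (Suc n))" unfolding hist.simps by (intro mono) auto
  qed
  have "emeasure M {\<omega> \<in> space M. \<exists>n. Q (histM n \<omega>)} = emeasure M (\<Union>n. {\<omega> \<in> space M. Q (histM n \<omega>)})"
    by (rule arg_cong[where f="emeasure M"]) auto
  also have "\<dots> = (SUP n. emeasure M {\<omega> \<in> space M. Q (histM n \<omega>)})"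
    using hist_pred_sets(1) iM by (intro SUP_emeasure_incseq[symmetric]) auto
  also have "\<dots> = (SUP n. emeasure Om {w. Q (hist w n)})" by (simp only: hist_law_pred)
  also have "\<dots> = emeasure Om (\<Union>n. {w. Q (hist w n)})"
    using hist_pred_sets(2) iO by (intro SUP_emeasure_incseq) auto
  also have "(\<Union>n. {w. Q (hist w n)}) = {w. \<exists>n. Q (hist w n)}" by auto
  finally show ?thesis .
qed

end

section \<open>The tree-indexed chain and its second moment\<close>

context walk_tree
begin

lemma measurable_Yl: "(\<lambda>w. Yl k w n x) \<in> measurable Om (count_space UNIV)"
proof (induction n arbitrary: x)
  case (Suc n)
  have "(\<lambda>w. (\<lambda>k' w. count_before (stack_seq (w (par x))) (nbr_index (par x) x) k') (Yl k w n (par x)) w) \<in> measurable Om (count_space UNIV)"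
    by (rule measurable_compose_countable[OF _ Suc]) (rule measurable_count_before, rule measurable_stack)
  then show ?case by simp
qed simp

lemma measurable_Y: "(\<lambda>w. Y k w x) \<in> measurable Om (count_space UNIV)"
  unfolding Y_def by (rule measurable_Yl)

lemma measurable_Y_fun: "(\<lambda>w. \<phi> (Y k w x) :: ennreal) \<in> borel_measurable Om"
  by (rule measurable_compose[OF measurable_Y]) simp

text \<open>\<open>Y k w x\<close> reads only stacks of proper ancestors of \<open>x\<close>, which
  have smaller level.\<close>

lemma Y_upd:
  assumes x: "x \<in> V" "x \<noteq> \<rho>"
  shows "lev x \<le> lev z \<Longrightarrow> Y k (w(z := f)) x = Y k w x"
  using x
proof (induction rule: child_induct)
  case (root_child c)
  then show ?case by (simp add: Y_root_child)
next
  case (child x c)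
  have l: "lev c = Suc (lev x)" using chD[OF child.hyps(3)] by simp
  then have "x \<noteq> z" using child.prems by auto
  then show ?case using child.IH child.prems l by (simp add: Y_child[OF child.hyps(3,2)])
qed

text \<open>Conditioning on all stacks except that of \<open>x\<close>; \<open>F\<close> collects
  whatever the other stacks contribute.\<close>

lemma Y_resample:
  assumes c: "c \<in> ch x" and x: "x \<noteq> \<rho>"
    and F: "F \<in> borel_measurable Om" "\<And>w f. F (w(x := f)) = F w"
  shows "(\<integral>\<^sup>+w. F w * \<phi> (Y k w c) \<partial>Om) = (\<integral>\<^sup>+w. F w * (\<integral>\<^sup>+y. \<phi> y \<partial>kern (Y k w x)) \<partial>Om)"
proof -
  have xV: "x \<in> V" using chD[OF c] by simp
  have j: "1 \<le> nbr_index x c" "nbr_index x c < deg x" using nbr_index_child[OF c x] by auto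
  note [measurable] = F(1) measurable_Y_fun[of \<phi> k c]
  have "(\<lambda>w. F w * \<phi> (Y k w c)) \<in> borel_measurable Om" by measurable
  then have "(\<integral>\<^sup>+w. F w * \<phi> (Y k w c) \<partial>Om) = (\<integral>\<^sup>+w. (\<integral>\<^sup>+f. F (w(x := f)) * \<phi> (Y k (w(x := f)) c) \<partial>field (deg x) (x \<noteq> \<rho>)) \<partial>Om)"
    by (rule nn_integral_Om_resample)
  also have "\<dots> = (\<integral>\<^sup>+w. F w * (\<integral>\<^sup>+y. \<phi> y \<partial>kern (Y k w x)) \<partial>Om)"
  proof (rule nn_integral_cong)
    fix w
    have N: "(\<lambda>f. count_before (stack_seq f) (nbr_index x c) (Y k w x)) \<in> measurable (field (deg x) True) (count_space UNIV)"
      by (rule measurable_count_before) simp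
    have m: "(\<lambda>f. \<phi> (count_before (stack_seq f) (nbr_index x c) (Y k w x))) \<in> borel_measurable (field (deg x) True)"
      by (rule measurable_compose[OF N]) simp
    have "(\<integral>\<^sup>+f. F (w(x := f)) * \<phi> (Y k (w(x := f)) c) \<partial>field (deg x) (x \<noteq> \<rho>))
      = (\<integral>\<^sup>+f. F w * \<phi> (count_before (stack_seq f) (nbr_index x c) (Y k w x)) \<partial>field (deg x) True)"
      using x by (simp add: F(2) Y_child[OF c x] Y_upd[OF xV x])
    also have "\<dots> = F w * (\<integral>\<^sup>+f. \<phi> (count_before (stack_seq f) (nbr_index x c) (Y k w x)) \<partial>field (deg x) True)"
      by (rule nn_integral_cmult[OF m])
    also have "(\<integral>\<^sup>+f. \<phi> (count_before (stack_seq f) (nbr_index x c) (Y k w x)) \<partial>field (deg x) True) = (\<integral>\<^sup>+y. \<phi> y \<partial>kern (Y k w x))"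
      by (rule nn_integral_count_before[OF j])
    finally show "(\<integral>\<^sup>+f. F (w(x := f)) * \<phi> (Y k (w(x := f)) c) \<partial>field (deg x) (x \<noteq> \<rho>)) = F w * (\<integral>\<^sup>+y. \<phi> y \<partial>kern (Y k w x))" .
  qed
  finally show ?thesis .
qed

text \<open>The chain has made \<open>lev x - 1\<close> steps, as it starts with the value
  \<open>k\<close> at the children of the root.\<close>

lemma Y_law:
  assumes x: "x \<in> V" "x \<noteq> \<rho>"
  shows "(\<integral>\<^sup>+w. \<phi> (Y k w x) \<partial>Om) = (\<integral>\<^sup>+y. \<phi> y \<partial>chain k (lev x - 1))"
  using x
proof (induction arbitrary: \<phi> rule: child_induct)
  case (root_child c)
  then show ?case using chD[OF root_child] Om.emeasure_space_1 by (simp add: Y_root_child)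
next
  case (child x c)
  obtain n where n: "lev x = Suc n" using lev_eq_0[OF child.hyps(1)] child.hyps(2) by (cases "lev x") auto
  have l: "lev c - 1 = Suc (lev x - 1)" using chD[OF child.hyps(3)] n by simp
  have "(\<integral>\<^sup>+w. 1 * \<phi> (Y k w c) \<partial>Om) = (\<integral>\<^sup>+w. 1 * (\<integral>\<^sup>+y. \<phi> y \<partial>kern (Y k w x)) \<partial>Om)"
    by (rule Y_resample[OF child.hyps(3,2)]) auto
  then have "(\<integral>\<^sup>+w. \<phi> (Y k w c) \<partial>Om) = (\<integral>\<^sup>+w. (\<integral>\<^sup>+y. \<phi> y \<partial>kern (Y k w x)) \<partial>Om)" by simp
  also have "\<dots> = (\<integral>\<^sup>+z. (\<integral>\<^sup>+y. \<phi> y \<partial>kern z) \<partial>chain k (lev x - 1))" by (rule child.IH)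
  finally show ?case unfolding l by simp
qed

lemma Y_event: "{w. Y k w x \<in> A} \<in> sets Om"
  using measurable_sets[OF measurable_Y, of A] by (simp add: vimage_def)

lemma Y_survival:
  assumes a: "0 < a" "a < 1"
  obtains K where "K > 0" "\<And>k x. k \<ge> 1 \<Longrightarrow> x \<in> V \<Longrightarrow> x \<noteq> \<rho> \<Longrightarrow>
     emeasure Om {w. Y k w x \<ge> 1} \<le> ennreal (K * real k * real (lev x) powr (- (1 - a) / 2))"
proof -
  obtain C where C: "C > 0"
    "\<And>k n. n \<ge> 1 \<Longrightarrow> measure_pmf.prob (chain k n) {1..} \<le> C * real k * real n powr (- (1 - a) / 2)"
    using survival_bound[OF a] by blast
  define s where "s = (1 - a) / 2"
  have s: "0 < s" "s < 1" using a by (auto simp: s_def)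
  have e: "- (1 - a) / 2 = - s" by (simp only: s_def minus_divide_left)
  \<comment> \<open>Passing from \<open>lev x - 1\<close> back to \<open>lev x\<close> costs at most
    the factor \<open>2 powr s \<le> 2\<close>. The summand 1 serves level 1, where the chain has
    made no step.\<close>
  have "emeasure Om {w. Y k w x \<ge> 1} \<le> ennreal ((2 * C + 1) * real k * real (lev x) powr (- (1 - a) / 2))"
    if k: "k \<ge> 1" and x: "x \<in> V" "x \<noteq> \<rho>" for k x
  proof -
    have l: "lev x \<ge> 1" using lev_eq_0[OF x(1)] x(2) by (cases "lev x") auto
    have "emeasure Om {w. Y k w x \<ge> 1} = (\<integral>\<^sup>+w. indicator {w. Y k w x \<in> {1..}} w \<partial>Om)"
      using Y_event[of k x "{1..}"] by simp
    also have "\<dots> = (\<integral>\<^sup>+w. indicator {1..} (Y k w x) \<partial>Om)" by (intro nn_integral_cong) (auto simp: indicator_def)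
    also have "\<dots> = (\<integral>\<^sup>+y. indicator {1..} y \<partial>chain k (lev x - 1))" by (rule Y_law[OF x])
    also have "\<dots> = ennreal (measure_pmf.prob (chain k (lev x - 1)) {1..})"
      by (simp add: measure_pmf.emeasure_eq_measure)
    also have "\<dots> \<le> ennreal ((2 * C + 1) * real k * real (lev x) powr (- s))"
    proof (rule ennreal_leI)
      show "measure_pmf.prob (chain k (lev x - 1)) {1..} \<le> (2 * C + 1) * real k * real (lev x) powr (- s)"
      proof (cases "lev x = 1")
        case True
        have "1 * 1 \<le> (2 * C + 1) * real k" using C(1) k by (intro mult_mono) auto
        then have "1 \<le> (2 * C + 1) * real k * real (lev x) powr (- s)" using True by simp
        then show ?thesis by (rule order_trans[OF measure_pmf.prob_le_1])
      next
        case False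
        then have l2: "lev x - 1 \<ge> 1" using l by simp
        have "real (lev x - 1) powr (- s) \<le> (real (lev x) / 2) powr (- s)"
          using l2 s by (intro powr_mono2') auto
        also have "\<dots> = real (lev x) powr (- s) * 2 powr s" using l by (simp add: powr_divide powr_minus divide_simps)
        also have "\<dots> \<le> real (lev x) powr (- s) * 2"
        proof (intro mult_left_mono)
          have "(2::real) powr s \<le> 2 powr 1" using s by (intro powr_mono) auto
          then show "(2::real) powr s \<le> 2" by simp
        qed simp
        finally have p: "real (lev x - 1) powr (- s) \<le> real (lev x) powr (- s) * 2" .
        have "measure_pmf.prob (chain k (lev x - 1)) {1..} \<le> C * real k * real (lev x - 1) powr (- s)"
          using C(2)[OF l2, of k] unfolding e .
        also have "\<dots> \<le> C * real k * (real (lev x) powr (- s) * 2)" using p C(1) by (intro mult_left_mono) auto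
        also have "\<dots> = (2 * C) * real k * real (lev x) powr (- s)" by simp
        also have "\<dots> \<le> (2 * C + 1) * real k * real (lev x) powr (- s)" by (intro mult_right_mono) auto
        finally show ?thesis .
      qed
    qed
    finally show ?thesis unfolding e .
  qed
  then show ?thesis using that[of "2 * C + 1"] C(1) by simp
qed

lemma ennreal_amgm: "ennreal a * ennreal b \<le> (ennreal (a ^ 2) + ennreal (b ^ 2)) / 2" if "a \<ge> 0" "b \<ge> 0"
proof -
  have "a * b \<le> (a ^ 2 + b ^ 2) / 2" using sum_squares_bound[of a b] by simp
  then have "ennreal (a * b) \<le> ennreal ((a ^ 2 + b ^ 2) / 2)" by (rule ennreal_leI)
  then show ?thesis using that by (simp add: ennreal_mult ennreal_plus[symmetric] divide_ennreal[symmetric] del: ennreal_plus)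
qed

definition corr :: "(nat \<Rightarrow> real) \<Rightarrow> nat \<Rightarrow> 'a \<Rightarrow> 'a \<Rightarrow> ennreal" where
  "corr h k x x' = (\<integral>\<^sup>+w. ennreal (h (Y k w x)) * ennreal (h (Y k w x')) \<partial>Om)"

text \<open>Children of different parents read different stacks, which are resampled in turn; equal
  levels ensure that neither stack affects the other factor. Siblings read the same stack and are
  dependent, so their product is bounded by the mean of the squares. This costs the increment of the
  second moment, but only when the common parent has been entered.\<close>

lemma corr_step:
  assumes h: "\<And>m. h m \<ge> 0" and super: "\<And>k. (\<integral>\<^sup>+m. ennreal (h m) \<partial>kern k) \<le> ennreal (h k)"
    and C: "C \<ge> 0" and stack_seq: "\<And>k. (\<integral>\<^sup>+m. ennreal (h m ^ 2) \<partial>kern k) \<le> ennreal (h k ^ 2 + C * of_bool (k \<ge> 1))"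
    and x: "x \<in> V" "x \<noteq> \<rho>" "x' \<in> V" "x' \<noteq> \<rho>" "lev x = lev x'" and c: "c \<in> ch x" and d: "d \<in> ch x'"
  shows "corr h k c d \<le> corr h k x x' + of_bool (x = x') * (ennreal C * emeasure Om {w. Y k w x \<ge> 1})"
proof (cases "x = x'")
  case False
  note cc = chD[OF c] and dd = chD[OF d]
  have Fd: "ennreal (h (Y k (w(x := f)) d)) = ennreal (h (Y k w d))" for w f
    using False x by (simp add: Y_child[OF d x(4)] Y_upd[OF x(3,4)])
  have Fx: "ennreal (h (Y k (w(x' := f)) x)) = ennreal (h (Y k w x))" for w f
    using x by (simp add: Y_upd[OF x(1,2)])
  have "corr h k c d = (\<integral>\<^sup>+w. ennreal (h (Y k w d)) * ennreal (h (Y k w c)) \<partial>Om)" by (simp add: corr_def mult.commute)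
  also have "\<dots> = (\<integral>\<^sup>+w. ennreal (h (Y k w d)) * (\<integral>\<^sup>+y. ennreal (h y) \<partial>kern (Y k w x)) \<partial>Om)"
    by (rule Y_resample[OF c x(2) measurable_Y_fun[of "\<lambda>y. ennreal (h y)"] Fd, where \<phi>="\<lambda>y. ennreal (h y)"])
  also have "\<dots> \<le> (\<integral>\<^sup>+w. ennreal (h (Y k w d)) * ennreal (h (Y k w x)) \<partial>Om)"
    by (intro nn_integral_mono mult_left_mono super) simp
  also have "\<dots> = (\<integral>\<^sup>+w. ennreal (h (Y k w x)) * ennreal (h (Y k w d)) \<partial>Om)" by (simp add: mult.commute)
  also have "\<dots> = (\<integral>\<^sup>+w. ennreal (h (Y k w x)) * (\<integral>\<^sup>+y. ennreal (h y) \<partial>kern (Y k w x')) \<partial>Om)"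
    by (rule Y_resample[OF d x(4) measurable_Y_fun[of "\<lambda>y. ennreal (h y)"] Fx, where \<phi>="\<lambda>y. ennreal (h y)"])
  also have "\<dots> \<le> corr h k x x'" unfolding corr_def by (intro nn_integral_mono mult_left_mono super) simp
  finally show ?thesis using False by simp
next
  case True
  have one: "(\<integral>\<^sup>+w. ennreal (h (Y k w c) ^ 2) \<partial>Om) \<le> corr h k x x + ennreal C * emeasure Om {w. Y k w x \<ge> 1}" if c: "c \<in> ch x" for c
  proof -
    have "(\<integral>\<^sup>+w. 1 * ennreal (h (Y k w c) ^ 2) \<partial>Om) = (\<integral>\<^sup>+w. 1 * (\<integral>\<^sup>+y. ennreal (h y ^ 2) \<partial>kern (Y k w x)) \<partial>Om)"
      by (rule Y_resample[OF c x(2), where \<phi>="\<lambda>y. ennreal (h y ^ 2)"]) auto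
    then have "(\<integral>\<^sup>+w. ennreal (h (Y k w c) ^ 2) \<partial>Om) = (\<integral>\<^sup>+w. (\<integral>\<^sup>+y. ennreal (h y ^ 2) \<partial>kern (Y k w x)) \<partial>Om)" by simp
    also have "\<dots> \<le> (\<integral>\<^sup>+w. ennreal (h (Y k w x) ^ 2 + C * of_bool (Y k w x \<ge> 1)) \<partial>Om)"
      by (rule nn_integral_mono) (rule stack_seq)
    also have "\<dots> = (\<integral>\<^sup>+w. ennreal (h (Y k w x)) * ennreal (h (Y k w x)) + ennreal C * indicator {w. Y k w x \<in> {1..}} w \<partial>Om)"
    proof (intro nn_integral_cong)
      fix w
      have "ennreal (C * of_bool (Y k w x \<ge> 1)) = ennreal C * indicator {w. Y k w x \<in> {1..}} w"
        by (simp add: indicator_def)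
      moreover have "ennreal (h (Y k w x) ^ 2) = ennreal (h (Y k w x)) * ennreal (h (Y k w x))"
        using h by (simp add: power2_eq_square ennreal_mult)
      ultimately show "ennreal (h (Y k w x) ^ 2 + C * of_bool (Y k w x \<ge> 1)) = ennreal (h (Y k w x)) * ennreal (h (Y k w x)) + ennreal C * indicator {w. Y k w x \<in> {1..}} w"
        using C by (subst ennreal_plus) auto
    qed
    also have "\<dots> = corr h k x x + ennreal C * emeasure Om {w. Y k w x \<ge> 1}"
    proof -
      have m: "(\<lambda>w. ennreal (h (Y k w x)) * ennreal (h (Y k w x))) \<in> borel_measurable Om"
        using measurable_Y_fun[of "\<lambda>y. ennreal (h y) * ennreal (h y)"] .
      show ?thesis unfolding corr_def
        using Y_event[of k x "{1..}"] m by (subst nn_integral_add) (auto simp: nn_integral_cmult_indicator)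
    qed
    finally show ?thesis .
  qed
  let ?v = "corr h k x x + ennreal C * emeasure Om {w. Y k w x \<ge> 1}"
  have d': "d \<in> ch x" using d True by simp
  have "corr h k c d \<le> (\<integral>\<^sup>+w. (ennreal (h (Y k w c) ^ 2) + ennreal (h (Y k w d) ^ 2)) / 2 \<partial>Om)"
    unfolding corr_def by (intro nn_integral_mono ennreal_amgm h)
  also have "\<dots> = ((\<integral>\<^sup>+w. ennreal (h (Y k w c) ^ 2) \<partial>Om) + (\<integral>\<^sup>+w. ennreal (h (Y k w d) ^ 2) \<partial>Om)) / 2"
  proof -
    note m = measurable_Y_fun[of "\<lambda>y. ennreal (h y ^ 2)" k c] measurable_Y_fun[of "\<lambda>y. ennreal (h y ^ 2)" k d]
    note [measurable] = m
    have "(\<lambda>w. ennreal (h (Y k w c) ^ 2) + ennreal (h (Y k w d) ^ 2)) \<in> borel_measurable Om" by measurable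
    then show ?thesis by (simp only: nn_integral_divide nn_integral_add[OF m])
  qed
  also have "\<dots> \<le> (?v + ?v) / 2" by (intro divide_right_mono_ennreal add_mono one c d')
  also have "\<dots> = ?v"
  proof -
    have "(v + v) / 2 = v" for v :: ennreal
    proof -
      have "v + v = 2 * v" by (simp add: mult_2)
      then show ?thesis using ennreal_mult_divide_eq[of 2 v] by (simp add: mult.commute)
    qed
    then show ?thesis .
  qed
  finally show ?thesis using True by simp
qed

definition flow_sum :: "('a \<Rightarrow> real) \<Rightarrow> (nat \<Rightarrow> real) \<Rightarrow> nat \<Rightarrow> nat \<Rightarrow> ('a \<Rightarrow> nat list \<Rightarrow> nat) \<Rightarrow> ennreal" where
  "flow_sum \<theta> h k n w = (\<Sum>x\<in>level_set (Suc n). ennreal (\<theta> x) * ennreal (h (Y k w x)))"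

lemma level_set_SucD: "x \<in> level_set (Suc n) \<Longrightarrow> x \<in> V \<and> x \<noteq> \<rho> \<and> lev x = Suc n"
  by (auto simp: level_set_def)

lemma measurable_flow_sum: "flow_sum \<theta> h k n \<in> borel_measurable Om"
proof -
  have "(\<lambda>w. ennreal (\<theta> x) * ennreal (h (Y k w x))) \<in> borel_measurable Om" for x
    using measurable_Y_fun[of "\<lambda>y. ennreal (\<theta> x) * ennreal (h y)"] .
  then show ?thesis unfolding flow_sum_def[abs_def] by measurable
qed

lemma flow_sum_square:
  "(\<integral>\<^sup>+w. flow_sum \<theta> h k n w ^ 2 \<partial>Om) = (\<Sum>x\<in>level_set (Suc n). \<Sum>x'\<in>level_set (Suc n). ennreal (\<theta> x) * ennreal (\<theta> x') * corr h k x x')"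
proof -
  have m: "(\<lambda>w. ennreal (h (Y k w x)) * ennreal (h (Y k w x'))) \<in> borel_measurable Om" for x x'
  proof -
    note [measurable] = measurable_Y_fun[of "\<lambda>y. ennreal (h y)" k x] measurable_Y_fun[of "\<lambda>y. ennreal (h y)" k x']
    show ?thesis by measurable
  qed
  then have m': "(\<lambda>w. ennreal (\<theta> x) * ennreal (\<theta> x') * (ennreal (h (Y k w x)) * ennreal (h (Y k w x')))) \<in> borel_measurable Om" for x x'
    by (rule borel_measurable_times_ennreal[OF borel_measurable_const])
  have "(\<integral>\<^sup>+w. flow_sum \<theta> h k n w ^ 2 \<partial>Om) = (\<integral>\<^sup>+w. (\<Sum>x\<in>level_set (Suc n). \<Sum>x'\<in>level_set (Suc n). ennreal (\<theta> x) * ennreal (\<theta> x') * (ennreal (h (Y k w x)) * ennreal (h (Y k w x')))) \<partial>Om)"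
    by (intro nn_integral_cong) (simp add: flow_sum_def power2_eq_square sum_product mult_ac)
  also have "\<dots> = (\<Sum>x\<in>level_set (Suc n). \<Sum>x'\<in>level_set (Suc n). ennreal (\<theta> x) * ennreal (\<theta> x') * corr h k x x')"
    unfolding corr_def using m m' by (subst nn_integral_sum) (auto simp: nn_integral_sum nn_integral_cmult)
  finally show ?thesis .
qed

lemma sum_level_set_Suc:
  fixes F :: "'a \<Rightarrow> 'b :: comm_monoid_add"
  shows "(\<Sum>c\<in>level_set (Suc n). F c) = (\<Sum>x\<in>level_set n. \<Sum>c\<in>ch x. F c)"
  unfolding level_set_Suc by (rule sum.UNION_disjoint) (auto simp: finite_level_set[OF lf] finite_ch[OF lf] dest: ch_disjoint)

text \<open>Conservation of the flow collapses the sum over pairs of children to a sum over pairs of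
  parents, and the diagonal is left as the growth term.\<close>

lemma second_moment_growth:
  assumes h: "\<And>m. h m \<ge> 0" and super: "\<And>k. (\<integral>\<^sup>+m. ennreal (h m) \<partial>kern k) \<le> ennreal (h k)"
    and C: "C \<ge> 0" and stack_seq: "\<And>k. (\<integral>\<^sup>+m. ennreal (h m ^ 2) \<partial>kern k) \<le> ennreal (h k ^ 2 + C * of_bool (k \<ge> 1))"
    and \<theta>: "\<And>x. \<theta> x \<ge> 0" and flow: "\<And>x. x \<in> level_set (Suc n) \<Longrightarrow> (\<Sum>y\<in>ch x. \<theta> y) = \<theta> x"
  shows "(\<integral>\<^sup>+w. flow_sum \<theta> h k (Suc n) w ^ 2 \<partial>Om) \<le> (\<integral>\<^sup>+w. flow_sum \<theta> h k n w ^ 2 \<partial>Om)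
     + ennreal C * (\<Sum>x\<in>level_set (Suc n). ennreal (\<theta> x) * ennreal (\<theta> x) * emeasure Om {w. Y k w x \<ge> 1})"
proof -
  let ?L = "level_set (Suc n)"
  let ?P = "\<lambda>x. emeasure Om {w. Y k w x \<ge> 1}"
  have fl: "(\<Sum>c\<in>ch x. ennreal (\<theta> c)) = ennreal (\<theta> x)" if "x \<in> ?L" for x
    using flow[OF that] \<theta> by (simp add: sum_ennreal)
  have "(\<integral>\<^sup>+w. flow_sum \<theta> h k (Suc n) w ^ 2 \<partial>Om)
     = (\<Sum>x\<in>?L. \<Sum>c\<in>ch x. \<Sum>x'\<in>?L. \<Sum>d\<in>ch x'. ennreal (\<theta> c) * ennreal (\<theta> d) * corr h k c d)"
    unfolding flow_sum_square sum_level_set_Suc[of _ "Suc n"] ..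
  also have "\<dots> \<le> (\<Sum>x\<in>?L. \<Sum>c\<in>ch x. \<Sum>x'\<in>?L. \<Sum>d\<in>ch x'. ennreal (\<theta> c) * ennreal (\<theta> d) * (corr h k x x' + of_bool (x = x') * (ennreal C * ?P x)))"
  proof (intro sum_mono mult_left_mono)
    fix x c x' d assume "x \<in> ?L" "c \<in> ch x" "x' \<in> ?L" "d \<in> ch x'"
    then show "corr h k c d \<le> corr h k x x' + of_bool (x = x') * (ennreal C * ?P x)"
      using level_set_SucD[of x n] level_set_SucD[of x' n] by (intro corr_step[OF h super C stack_seq]) auto
  qed simp
  also have "\<dots> = (\<Sum>x\<in>?L. \<Sum>x'\<in>?L. ennreal (\<theta> x) * ennreal (\<theta> x') * (corr h k x x' + of_bool (x = x') * (ennreal C * ?P x)))"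
  proof (rule sum.cong[OF refl])
    fix x assume x: "x \<in> ?L"
    let ?e = "\<lambda>x'. corr h k x x' + of_bool (x = x') * (ennreal C * ?P x)"
    have "(\<Sum>c\<in>ch x. \<Sum>x'\<in>?L. \<Sum>d\<in>ch x'. ennreal (\<theta> c) * ennreal (\<theta> d) * ?e x')
       = (\<Sum>x'\<in>?L. \<Sum>c\<in>ch x. \<Sum>d\<in>ch x'. ennreal (\<theta> c) * ennreal (\<theta> d) * ?e x')"
      by (rule sum.swap)
    also have "\<dots> = (\<Sum>x'\<in>?L. ennreal (\<theta> x) * ennreal (\<theta> x') * ?e x')"
    proof (rule sum.cong[OF refl])
      fix x' assume x': "x' \<in> ?L"
      have "(\<Sum>c\<in>ch x. \<Sum>d\<in>ch x'. ennreal (\<theta> c) * ennreal (\<theta> d) * ?e x')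
        = (\<Sum>c\<in>ch x. ennreal (\<theta> c)) * (\<Sum>d\<in>ch x'. ennreal (\<theta> d)) * ?e x'"
        by (subst sum_product) (simp only: sum_distrib_right)
      then show "(\<Sum>c\<in>ch x. \<Sum>d\<in>ch x'. ennreal (\<theta> c) * ennreal (\<theta> d) * ?e x') = ennreal (\<theta> x) * ennreal (\<theta> x') * ?e x'"
        by (simp only: fl[OF x] fl[OF x'])
    qed
    finally show "(\<Sum>c\<in>ch x. \<Sum>x'\<in>?L. \<Sum>d\<in>ch x'. ennreal (\<theta> c) * ennreal (\<theta> d) * ?e x') = (\<Sum>x'\<in>?L. ennreal (\<theta> x) * ennreal (\<theta> x') * ?e x')" .
  qed
  also have "\<dots> = (\<Sum>x\<in>?L. \<Sum>x'\<in>?L. ennreal (\<theta> x) * ennreal (\<theta> x') * corr h k x x')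
     + (\<Sum>x\<in>?L. \<Sum>x'\<in>?L. if x = x' then ennreal (\<theta> x) * ennreal (\<theta> x) * (ennreal C * ?P x) else 0)"
    unfolding sum.distrib[symmetric] by (intro sum.cong refl) (auto simp: distrib_left)
  also have "(\<Sum>x\<in>?L. \<Sum>x'\<in>?L. if x = x' then ennreal (\<theta> x) * ennreal (\<theta> x) * (ennreal C * ?P x) else 0)
     = ennreal C * (\<Sum>x\<in>?L. ennreal (\<theta> x) * ennreal (\<theta> x) * ?P x)"
    unfolding sum_distrib_left by (intro sum.cong refl) (simp add: finite_level_set[OF lf] mult_ac)
  finally show ?thesis by (simp only: flow_sum_square)
qed

end

section \<open>Recurrence and transience\<close>

text \<open>Countable subadditivity for unconditional sums, the form in which the weight of a cutset
  is given.\<close>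

lemma emeasure_UN_le_infsum:
  fixes c :: "'i \<Rightarrow> ennreal"
  assumes I: "countable I" and A: "\<And>i. i \<in> I \<Longrightarrow> A i \<in> sets M"
    and le: "\<And>i. i \<in> I \<Longrightarrow> emeasure M (A i) \<le> K * c i"
  shows "emeasure M (\<Union>i\<in>I. A i) \<le> K * infsum c I"
proof (cases "I = {}")
  case False
  define f where "f = from_nat_into I"
  have f: "range f = I" using False I unfolding f_def by (rule range_from_nat_into)
  have fI: "f n \<in> I" for n using f by blast
  define B where "B n = (\<Union>i\<in>f ` {..n}. A i)" for n
  have B: "B n \<in> sets M" for n unfolding B_def using A fI by (intro sets.finite_UN) auto
  have inc: "incseq B" unfolding B_def by (intro monoI UN_mono image_mono) auto
  have "(\<Union>i\<in>I. A i) = (\<Union>n. B n)" unfolding B_def f[symmetric] by blast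
  moreover have "range B \<subseteq> sets M" using B by blast
  ultimately have "emeasure M (\<Union>i\<in>I. A i) = (SUP n. emeasure M (B n))"
    using SUP_emeasure_incseq[OF _ inc, of M] by simp
  also have "\<dots> \<le> K * infsum c I"
  proof (rule SUP_least)
    fix n
    have "emeasure M (B n) \<le> (\<Sum>i\<in>f ` {..n}. emeasure M (A i))"
      unfolding B_def using A fI by (intro emeasure_subadditive_finite) auto
    also have "\<dots> \<le> (\<Sum>i\<in>f ` {..n}. K * c i)" using le fI by (intro sum_mono) auto
    also have "\<dots> = K * (\<Sum>i\<in>f ` {..n}. c i)" by (simp add: sum_distrib_left)
    also have "\<dots> \<le> K * infsum c I"
    proof (rule mult_left_mono)
      have "(\<Sum>i\<in>f ` {..n}. c i) = infsum c (f ` {..n})" by simp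
      also have "\<dots> \<le> infsum c I"
        by (rule infsum_mono_neutral) (use fI in \<open>auto intro: nonneg_summable_on_complete\<close>)
      finally show "(\<Sum>i\<in>f ` {..n}. c i) \<le> infsum c I" .
    qed simp
    finally show "emeasure M (B n) \<le> K * infsum c I" .
  qed
  finally show ?thesis .
qed simp

lemma arrivals_le: "p \<noteq> [] \<Longrightarrow> count_list (exits p x) y \<le> length (exits p y) + of_bool (last p = y)"
proof (induction p rule: rev_induct)
  case (snoc z p)
  show ?case
  proof (cases "p = []")
    case False
    have l: "length (exits (p @ [z]) y) = length (exits p y) + of_bool (last p = y)"
      using False by (simp add: exits_snoc)
    show ?thesis unfolding l count_exits_snoc[OF False] using snoc.IH[OF False] by auto
  qed simp
qed simp

lemma visits_exits: "p \<noteq> [] \<Longrightarrow> count_list p x = length (exits p x) + of_bool (last p = x)"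
proof (induction p rule: rev_induct)
  case (snoc z p)
  show ?case
  proof (cases "p = []")
    case False
    have l: "length (exits (p @ [z]) x) = length (exits p x) + of_bool (last p = x)"
      using False by (simp add: exits_snoc)
    show ?thesis unfolding l using snoc.IH[OF False] by simp
  qed simp
qed simp

section \<open>Infinitely many visits and extinction of the chain\<close>

context walk_tree
begin

text \<open>Infinitely many visits, expressed through finite histories so that it can be carried
  over to the given process.\<close>

definition unbdd :: "('a \<Rightarrow> nat list \<Rightarrow> nat) \<Rightarrow> 'a \<Rightarrow> bool" where
  "unbdd w x \<longleftrightarrow> (\<forall>m. \<exists>n. count_list (hist w n) x \<ge> m)"

lemma unbdd_exits: "unbdd w x \<longleftrightarrow> (\<forall>m. \<exists>n. length (exits (hist w n) x) \<ge> m)"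
proof
  assume u: "unbdd w x"
  show "\<forall>m. \<exists>n. length (exits (hist w n) x) \<ge> m"
  proof
    fix m
    obtain n where "count_list (hist w n) x \<ge> Suc m" using u unfolding unbdd_def by blast
    then have "length (exits (hist w n) x) \<ge> m" using visits_exits[of "hist w n" x] by (cases "last (hist w n) = x") auto
    then show "\<exists>n. length (exits (hist w n) x) \<ge> m" by blast
  qed
next
  assume u: "\<forall>m. \<exists>n. length (exits (hist w n) x) \<ge> m"
  show "unbdd w x" unfolding unbdd_def
  proof
    fix m
    obtain n where "length (exits (hist w n) x) \<ge> m" using u by blast
    then have "count_list (hist w n) x \<ge> m" using visits_exits[of "hist w n" x] by simp
    then show "\<exists>n. count_list (hist w n) x \<ge> m" by blast
  qed
qed

lemma unbdd_traversals:
  assumes g: "good w" and u: "unbdd w x" and x: "x \<in> V" and y: "y \<in> neighbours E x"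
  shows "\<exists>n. count_list (exits (hist w n) x) y \<ge> m"
proof -
  have j: "nbr_index x y < deg x" "nbr x (nbr_index x y) = y" using nbr_index[OF x y] by auto
  have "infinite {i. stack_seq (w x) i = nbr_index x y}" using g x j by (auto simp: good_def good_seq_def)
  then obtain t where t: "card {i. i < t \<and> stack_seq (w x) i = nbr_index x y} \<ge> m" using infinite_count by blast
  obtain n where n: "length (exits (hist w n) x) \<ge> t" using u unfolding unbdd_exits by blast
  have "count_list (exits (hist w n) x) (nbr x (nbr_index x y)) = card {i. i < length (exits (hist w n) x) \<and> stack_seq (w x) i = nbr_index x y}"
    unfolding count_exits_hist[OF g x j(1)] count_stack_prefix ..
  also have "\<dots> \<ge> card {i. i < t \<and> stack_seq (w x) i = nbr_index x y}" using n by (intro card_mono) auto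
  finally show ?thesis using t j by (intro exI[of _ n]) simp
qed

lemma unbdd_neighbour:
  assumes g: "good w" and u: "unbdd w x" and x: "x \<in> V" and y: "y \<in> neighbours E x"
  shows "unbdd w y"
  unfolding unbdd_exits
proof
  fix m
  obtain n where "count_list (exits (hist w n) x) y \<ge> Suc m" using unbdd_traversals[OF assms] by blast
  then have "length (exits (hist w n) y) \<ge> m" using arrivals_le[of "hist w n" x y] by (cases "last (hist w n) = y") auto
  then show "\<exists>n. length (exits (hist w n) y) \<ge> m" by blast
qed

text \<open>A vertex visited infinitely often consumes its whole stack, and on good stacks every
  neighbour occurs there infinitely often. The property spreads up to the root and from there down
  to \<open>y\<close>.\<close>

lemma unbdd_all:
  assumes g: "good w" and u: "unbdd w x" and x: "x \<in> V" and y: "y \<in> V"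
  shows "unbdd w y"
proof -
  have root: "unbdd w \<rho>"
    using u x
  proof (induction "lev x" arbitrary: x)
    case 0
    then show ?case using lev_eq_0[of x] by simp
  next
    case (Suc n)
    have z: "x \<noteq> \<rho>" using Suc.hyps(2) by auto
    have "par x \<in> neighbours E x" using neighbours_eq[OF Suc.prems(2)] z by simp
    then have "unbdd w (par x)" using unbdd_neighbour[OF g Suc.prems(1,2)] by simp
    moreover have "n = lev (par x)" using Suc.hyps(2) par_props[OF Suc.prems(2) z] by simp
    ultimately show ?case using Suc.hyps(1)[of "par x"] by simp
  qed
  show ?thesis
  proof (cases "y = \<rho>")
    case False
    show ?thesis using y False
    proof (induction rule: child_induct)
      case (root_child c)
      then have "c \<in> neighbours E \<rho>" using neighbours_eq[OF root_in_V] by simp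
      then show ?case using unbdd_neighbour[OF g root root_in_V] by simp
    next
      case (child x c)
      then have "c \<in> neighbours E x" using neighbours_eq[OF child.hyps(1)] by simp
      then show ?case using unbdd_neighbour[OF g child.IH child.hyps(1)] by simp
    qed
  qed (simp add: root)
qed

lemma hist_prefix: "z \<in> set (hist w n) \<Longrightarrow> \<exists>m\<le>n. last (hist w m) = z"
proof (induction n)
  case (Suc n)
  show ?case
  proof (cases "z \<in> set (hist w n)")
    case True
    then obtain m where "m \<le> n" "last (hist w m) = z" using Suc.IH by blast
    then show ?thesis by (intro exI[of _ m]) simp
  next
    case False
    then have "z = last (hist w (Suc n))" using Suc.prems by simp
    then show ?thesis by blast
  qed
qed simp

lemma count_hist_mono: "m \<le> n \<Longrightarrow> count_list (hist w m) x \<le> count_list (hist w n) x"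
  by (induction n) (auto simp: le_Suc_eq)

lemma exits_hist_mono: "m \<le> n \<Longrightarrow> count_list (exits (hist w m) x) y \<le> count_list (exits (hist w n) x) y"
  by (induction n) (auto simp: le_Suc_eq count_exits_snoc)

lemma finite_range_unbdd:
  assumes "finite (\<Union>n. set (hist w n))"
  shows "\<exists>x\<in>V. unbdd w x"
proof (rule ccontr)
  let ?S = "\<Union>n. set (hist w n)"
  assume "\<not> ?thesis"
  moreover have S: "?S \<subseteq> V" using hist_in_V by blast
  ultimately have "\<forall>x\<in>?S. \<exists>m. \<forall>n. count_list (hist w n) x < m" unfolding unbdd_def by (meson not_le subsetD)
  from bchoice[OF this] obtain b where b: "\<forall>x\<in>?S. \<forall>n. count_list (hist w n) x < b x" ..
  \<comment> \<open>The history at time \<open>B\<close> has \<open>Suc B\<close> entries, one more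
    than the bounds \<open>b\<close> admit in total.\<close>
  define B where "B = sum b ?S"
  have sub: "set (hist w B) \<subseteq> ?S" by blast
  have "Suc B = sum (count_list (hist w B)) ?S"
    using sum_count_set[OF sub assms] by simp
  also have "\<dots> \<le> sum b ?S"
  proof (rule sum_mono)
    fix x assume "x \<in> ?S"
    from bspec[OF b this] have "count_list (hist w B) x < b x" by blast
    then show "count_list (hist w B) x \<le> b x" by simp
  qed
  also have "\<dots> = B" by (simp only: B_def)
  finally show False by simp
qed

text \<open>If the root is left boundedly often, no vertex is visited infinitely often. Hence
  infinitely many vertices are visited, and Koenig's lemma gives a ray along which every subtree is
  visited. This ray crosses \<open>\<pi>\<close>, so the lower end of the crossed edge was
  entered.\<close>

lemma transient_crosses:
  assumes g: "good w" and M: "\<And>n. length (exits (hist w n) \<rho>) \<le> M" and \<pi>: "separates_root E \<rho> \<pi>"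
  shows "\<exists>y. y \<in> V \<and> y \<noteq> \<rho> \<and> {par y, y} \<in> \<pi> \<and> Y M w y \<ge> 1"
proof -
  let ?S = "\<Union>n. set (hist w n)"
  have nu: "\<not> unbdd w x" if "x \<in> V" for x
  proof
    assume "unbdd w x"
    then have "unbdd w \<rho>" using unbdd_all[OF g _ that root_in_V] by blast
    then obtain n where "length (exits (hist w n) \<rho>) \<ge> Suc M" unfolding unbdd_exits by blast
    then show False using M[of n] by simp
  qed
  then have "infinite ?S" using finite_range_unbdd[of w] by blast
  moreover have "?S \<subseteq> V" using hist_in_V by blast
  ultimately obtain v where v: "is_ray E \<rho> v" "\<And>i. \<exists>z\<in>?S. in_subtree (v i) z" using koenig_ray[OF lf] by metis
  obtain i where i: "{v i, v (Suc i)} \<in> \<pi>" using \<pi> v(1) unfolding separates_root_def by blast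
  let ?y = "v (Suc i)"
  have c: "?y \<in> ch (v i)" using ray_lev[OF v(1), of i] by simp
  note y = chD[OF c]
  obtain z n where "z \<in> set (hist w n)" "in_subtree ?y z" using v(2)[of "Suc i"] by blast
  then obtain m where m: "last (hist w m) = z" using hist_prefix[of z w n] by blast
  then have "entries (hist w m) ?y \<ge> 1" using balance[OF root_path_hist[OF g], of ?y m] y \<open>in_subtree ?y z\<close> by simp
  also have "entries (hist w m) ?y \<le> Y M w ?y" using y by (intro entries_le_Y[OF g M]) auto
  finally show ?thesis using i y by (intro exI[of _ ?y]) simp
qed

lemma Y_zero_child: "c \<in> ch x \<Longrightarrow> x \<noteq> \<rho> \<Longrightarrow> Y k w x = 0 \<Longrightarrow> Y k w c = 0"
  by (simp add: Y_child count_before_def)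

lemma lev_hist: "good w \<Longrightarrow> lev (last (hist w n)) \<le> n"
proof (induction n)
  case (Suc n)
  have "root_path (hist w n @ [last (hist w (Suc n))])" using root_path_hist[OF Suc.prems, of "Suc n"] by simp
  then have "{last (hist w n), last (hist w (Suc n))} \<in> E" by (simp only: root_path_snoc[OF hist_ne])
  from lev_adj[OF this] Suc.IH[OF Suc.prems] show ?case by simp
qed simp

lemma entries_zero: "good w \<Longrightarrow> lev x > n \<Longrightarrow> entries (hist w n) x = 0"
proof -
  assume g: "good w" and l: "lev x > n"
  have "x \<notin> set (hist w n)"
  proof
    assume "x \<in> set (hist w n)"
    then obtain m where "m \<le> n" "last (hist w m) = x" using hist_prefix by blast
    then show False using lev_hist[OF g, of m] l by simp
  qed
  then have "x \<notin> set (exits (hist w n) (par x))" using set_exits_subset[of "hist w n" "par x"] by blast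
  then show ?thesis by (simp add: entries_def)
qed

lemma returns_after:
  assumes u: "unbdd w \<rho>"
  shows "\<exists>n\<ge>n0. last (hist w n) = \<rho>"
proof (rule ccontr)
  assume no: "\<not> ?thesis"
  have "count_list (hist w (n0 + d)) \<rho> = count_list (hist w n0) \<rho>" for d
  proof (induction d)
    case (Suc d)
    have "last (hist w (Suc (n0 + d))) \<noteq> \<rho>"
    proof
      assume "last (hist w (Suc (n0 + d))) = \<rho>"
      then show False using no by (metis le_add1 le_SucI)
    qed
    then have "count_list (hist w (Suc (n0 + d))) \<rho> = count_list (hist w (n0 + d)) \<rho>" by simp
    then show ?case using Suc by simp
  qed simp
  moreover obtain n where n: "count_list (hist w n) \<rho> \<ge> Suc (count_list (hist w n0) \<rho>)"
    using u unfolding unbdd_def by blast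
  moreover have "count_list (hist w n) \<rho> \<le> count_list (hist w (n0 + n)) \<rho>" by (rule count_hist_mono) simp
  ultimately show False by simp
qed

text \<open>Wait until every child of the root has been entered \<open>k\<close> times and the walk
  is at the root, at time \<open>n\<close> say. Then \<open>Y_le_entries\<close> applies, and in
  \<open>n\<close> steps no vertex of level \<open>Suc n\<close> was reached.\<close>

lemma unbdd_extinct:
  assumes g: "good w" and u: "unbdd w \<rho>"
  shows "\<exists>N. \<forall>x\<in>level_set (Suc N). Y k w x = 0"
proof -
  have "\<forall>c\<in>ch \<rho>. \<exists>n. k \<le> entries (hist w n) c"
  proof
    fix c assume c: "c \<in> ch \<rho>"
    then have "c \<in> neighbours E \<rho>" using neighbours_eq[OF root_in_V] by simp
    from unbdd_traversals[OF g u root_in_V this, of k] show "\<exists>n. k \<le> entries (hist w n) c"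
      using chD[OF c] by (simp add: entries_def)
  qed
  from bchoice[OF this] obtain nf where nf: "\<forall>c\<in>ch \<rho>. k \<le> entries (hist w (nf c)) c" ..
  define n0 where "n0 = Max (insert 0 (nf ` ch \<rho>))"
  have n0: "nf c \<le> n0" if "c \<in> ch \<rho>" for c
    unfolding n0_def using that finite_ch[OF lf] by (intro Max_ge) auto
  obtain n where n: "n \<ge> n0" "last (hist w n) = \<rho>" using returns_after[OF u] by blast
  have k: "k \<le> entries (hist w n) c" if c: "c \<in> ch \<rho>" for c
  proof -
    have "entries (hist w (nf c)) c \<le> entries (hist w n) c"
      unfolding entries_def using n0[OF c] n(1) by (intro exits_hist_mono) simp
    then show ?thesis using bspec[OF nf c] by simp
  qed
  have "Y k w x = 0" if "x \<in> level_set (Suc n)" for x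
  proof -
    have x: "x \<in> V" "x \<noteq> \<rho>" "lev x = Suc n" using level_set_SucD[OF that] by auto
    have "Y k w x \<le> entries (hist w n) x" by (rule Y_le_entries[OF g n(2) k x(1,2)])
    then show ?thesis using entries_zero[OF g, of n x] x by simp
  qed
  then show ?thesis by blast
qed

definition extinct :: "nat \<Rightarrow> nat \<Rightarrow> ('a \<Rightarrow> nat list \<Rightarrow> nat) set" where
  "extinct k N = {w. \<forall>x\<in>level_set (Suc N). Y k w x = 0}"

lemma extinct_sets: "extinct k N \<in> sets Om"
proof -
  have e: "extinct k N = space Om - (\<Union>x\<in>level_set (Suc N). {w. Y k w x \<in> {1..}})"
    by (auto simp: extinct_def Suc_le_eq)
  show ?thesis unfolding e by (intro sets.compl_sets sets.finite_UN Y_event finite_level_set[OF lf])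
qed

lemma extinct_mono: "extinct k N \<subseteq> extinct k (Suc N)"
proof
  fix w assume w: "w \<in> extinct k N"
  have "Y k w c = 0" if c: "c \<in> level_set (Suc (Suc N))" for c
  proof -
    have "c \<in> (\<Union>x\<in>level_set (Suc N). ch x)" using c by (simp only: level_set_Suc[of "Suc N"])
    then obtain x where x: "x \<in> level_set (Suc N)" "c \<in> ch x" by (elim UN_E)
    have "x \<noteq> \<rho>" using level_set_SucD[OF x(1)] by (elim conjE)
    moreover have "Y k w x = 0" using w x(1) unfolding extinct_def by simp
    ultimately show ?thesis by (rule Y_zero_child[OF x(2)])
  qed
  then show "w \<in> extinct k (Suc N)" unfolding extinct_def by simp
qed

lemma extinct_incseq: "incseq (extinct k)"
  by (rule incseq_SucI) (rule extinct_mono)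

text \<open>Cauchy-Schwarz on the event of survival, for the flow-weighted sum over a level. As the
  chain is only nearly a martingale, the first moment is bounded below through \<open>g\<close> and
  the second above through \<open>h\<close>; both equal \<open>real k\<close> up to
  \<open>o(k)\<close>. From generation to generation the second moment grows by at most a constant
  times \<open>real k * real (Suc n) powr (- t)\<close>, which is summable.\<close>

lemma extinction_bound:
  assumes \<gamma>: "\<gamma> > 1 / 2" and \<delta>: "\<delta> > 0"
    and inf: "ennreal \<delta> \<le> (INF \<pi>\<in>cutsets E \<rho>. \<Sum>\<^sub>\<infinity>e\<in>\<pi>. ennreal (real (edge_height V E \<rho> e) powr (- \<gamma>)))"
  obtains a A B C where "0 < a" "a < 1" "A \<ge> 0" "B \<ge> 0" "C \<ge> 0"
    "\<And>k N. k \<ge> 1 \<Longrightarrow> real k - B * lyap a A k \<ge> 0 \<Longrightarrow>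
      (real k - B * lyap a A k) ^ 2 \<le> ((real k + B * lyap a A k) ^ 2 + C * real k) * (1 - Om.prob (extinct k N))"
proof -
  \<comment> \<open>Here the threshold 1/2 enters: with \<open>a < 2 * \<gamma> - 1\<close> the
    decay \<open>\<gamma>\<close> of the flow and the decay \<open>(1 - a) / 2\<close> of the
    survival probability add up to more than 1.\<close>
  define a where "a = min (1 / 2) ((2 * \<gamma> - 1) / 2)"
  have a: "0 < a" "a < 1" using \<gamma> by (auto simp: a_def)
  have a2: "a < 2 * \<gamma> - 1" using \<gamma> by (auto simp: a_def min_def)
  define s where "s = (1 - a) / 2"
  define t where "t = \<gamma> + s"
  have t: "t > 1" using a2 by (simp add: t_def s_def field_simps)
  have es: "- (1 - a) / 2 = - s" by (simp only: s_def minus_divide_left)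
  obtain A c B where A: "A \<ge> 0" and c: "c > 0" and B: "B \<ge> 0"
    and hb1: "\<And>k. k \<ge> 1 \<Longrightarrow> (\<integral>\<^sup>+m. ennreal (lyap a A m) \<partial>kern k) + ennreal (c * real k powr (a - 2)) \<le> ennreal (lyap a A k)"
    and super: "\<And>k. (\<integral>\<^sup>+m. ennreal (real m + B * lyap a A m) \<partial>kern k) \<le> ennreal (real k + B * lyap a A k)"
    and sub: "\<And>k. ennreal (real k - B * lyap a A k) \<le> (\<integral>\<^sup>+m. ennreal (real m - B * lyap a A m) \<partial>kern k)"
    by (rule harmonic_bounds[OF a]) (rule that)
  define h where "h m = real m + B * lyap a A m" for m
  define g where "g m = real m - B * lyap a A m" for m
  have h0: "h m \<ge> 0" for m using B lyap_nonneg[OF A] by (simp add: h_def)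
  have hsup: "(\<integral>\<^sup>+m. ennreal (h m) \<partial>kern k) \<le> ennreal (h k)" for k unfolding h_def by (rule super)
  have gsub: "ennreal (g k) \<le> (\<integral>\<^sup>+m. ennreal (g m) \<partial>kern k)" for k unfolding g_def by (rule sub)
  have gh: "g m \<le> h m" for m using B lyap_nonneg[OF A, of a m] by (simp add: g_def h_def)
  have lip: "\<bar>h m - h k\<bar> \<le> (1 + B * (1 + A)) * \<bar>real m - real k\<bar>" for m k
  proof -
    have "h m - h k = (real m - real k) + B * (lyap a A m - lyap a A k)" by (simp add: h_def algebra_simps)
    then have "\<bar>h m - h k\<bar> \<le> \<bar>real m - real k\<bar> + B * \<bar>lyap a A m - lyap a A k\<bar>"
      using abs_triangle_ineq[of "real m - real k" "B * (lyap a A m - lyap a A k)"] B by (simp add: abs_mult)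
    also have "\<dots> \<le> \<bar>real m - real k\<bar> + B * ((1 + A) * \<bar>real m - real k\<bar>)"
      using B lyap_lipschitz[OF a A, of m k] by (intro add_left_mono mult_left_mono) auto
    finally show ?thesis by (simp add: algebra_simps)
  qed
  obtain C where C: "C \<ge> 0" and hsq: "\<And>k. (\<integral>\<^sup>+m. ennreal (h m ^ 2) \<partial>kern k) \<le> ennreal (h k ^ 2 + C * of_bool (k \<ge> 1))"
    by (rule second_moment_step[OF lip h0 hsup]) (rule that)
  obtain K where K: "K > 0" and surv: "\<And>k x. k \<ge> 1 \<Longrightarrow> x \<in> V \<Longrightarrow> x \<noteq> \<rho> \<Longrightarrow>
     emeasure Om {w. Y k w x \<ge> 1} \<le> ennreal (K * real k * real (lev x) powr (- (1 - a) / 2))"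
    using Y_survival[OF a] by blast
  have summ: "summable (\<lambda>n. real (Suc n) powr (- t))"
    using t by (subst summable_Suc_iff) (simp add: summable_real_powr_iff)
  define S where "S = (\<Sum>n. real (Suc n) powr (- t))"
  have partial: "(\<Sum>i<n. real (Suc i) powr (- t)) \<le> S" for n
    unfolding S_def by (rule sum_le_suminf[OF summ]) auto
  have S0: "S \<ge> 0" using partial[of 0] by simp
  define C2 where "C2 = C * (K / \<delta>) * S"
  have C2: "C2 \<ge> 0" using C K \<delta> S0 by (simp add: C2_def)
  have main: "g k ^ 2 \<le> (h k ^ 2 + C2 * real k) * (1 - Om.prob (extinct k N))" if k: "k \<ge> 1" and gk: "g k \<ge> 0" for k N
  proof -
    obtain \<theta> :: "'a \<Rightarrow> real" where th0: "\<And>x. \<theta> x \<ge> 0" and th1: "(\<Sum>y\<in>ch \<rho>. \<theta> y) = 1"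
      and thf: "\<And>x. x \<in> V \<Longrightarrow> x \<noteq> \<rho> \<Longrightarrow> lev x \<le> N \<Longrightarrow> (\<Sum>y\<in>ch x. \<theta> y) = \<theta> x"
      and thb: "\<And>x. x \<in> V \<Longrightarrow> x \<noteq> \<rho> \<Longrightarrow> lev x \<le> Suc N \<Longrightarrow> \<theta> x \<le> real (lev x) powr (- \<gamma>) / \<delta>"
      by (rule flow_exists[OF lf _ \<delta> inf, where N=N]) (use \<gamma> in simp, rule that)
    have thsum: "n \<le> N \<Longrightarrow> (\<Sum>x\<in>level_set (Suc n). \<theta> x) = 1" for n
    proof (induction n)
      case 0
      then show ?case using th1 by (simp add: level_set_Suc[of 0] level_set_0)
    next
      case (Suc n)
      have "(\<Sum>x\<in>level_set (Suc (Suc n)). \<theta> x) = (\<Sum>x\<in>level_set (Suc n). \<Sum>y\<in>ch x. \<theta> y)" by (rule sum_level_set_Suc)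
      also have "\<dots> = (\<Sum>x\<in>level_set (Suc n). \<theta> x)"
      proof (rule sum.cong[OF refl])
        fix x assume "x \<in> level_set (Suc n)"
        from level_set_SucD[OF this] show "(\<Sum>y\<in>ch x. \<theta> y) = \<theta> x" using thf[of x] Suc.prems by simp
      qed
      finally show ?case using Suc by simp
    qed
    \<comment> \<open>One factor \<open>\<theta> x\<close> is kept and sums to 1; the other is
      replaced by its bound from the capacities.\<close>
    have trm: "(\<Sum>x\<in>level_set (Suc n). ennreal (\<theta> x) * ennreal (\<theta> x) * emeasure Om {w. Y k w x \<ge> 1})
        \<le> ennreal (K / \<delta> * real k * real (Suc n) powr (- t))" if n: "n \<le> N" for n
    proof -
      let ?u = "K / \<delta> * real k * real (Suc n) powr (- t)"
      have "(\<Sum>x\<in>level_set (Suc n). ennreal (\<theta> x) * ennreal (\<theta> x) * emeasure Om {w. Y k w x \<ge> 1})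
        \<le> (\<Sum>x\<in>level_set (Suc n). ennreal (\<theta> x * ?u))"
      proof (rule sum_mono)
        fix x assume x: "x \<in> level_set (Suc n)"
        have xx: "x \<in> V" "x \<noteq> \<rho>" "lev x = Suc n" using level_set_SucD[OF x] by auto
        have b: "\<theta> x \<le> real (Suc n) powr (- \<gamma>) / \<delta>" using thb[OF xx(1,2)] xx(3) n by simp
        have p: "emeasure Om {w. Y k w x \<ge> 1} \<le> ennreal (K * real k * real (Suc n) powr (- s))"
          using surv[OF k xx(1,2)] unfolding es xx(3) .
        have "ennreal (\<theta> x) * ennreal (\<theta> x) * emeasure Om {w. Y k w x \<ge> 1}
          \<le> ennreal (\<theta> x) * ennreal (real (Suc n) powr (- \<gamma>) / \<delta>) * ennreal (K * real k * real (Suc n) powr (- s))"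
          using b p by (intro mult_mono ennreal_leI) auto
        also have "\<dots> = ennreal (\<theta> x * (real (Suc n) powr (- \<gamma>) / \<delta>) * (K * real k * real (Suc n) powr (- s)))"
          using th0[of x] \<delta> K by (simp only: ennreal_mult[symmetric] mult_nonneg_nonneg divide_nonneg_pos powr_ge_zero less_imp_le of_nat_0_le_iff)
        also have "\<theta> x * (real (Suc n) powr (- \<gamma>) / \<delta>) * (K * real k * real (Suc n) powr (- s)) = \<theta> x * ?u"
        proof -
          have "real (Suc n) powr (- t) = real (Suc n) powr (- \<gamma>) * real (Suc n) powr (- s)"
            by (simp add: t_def powr_add[symmetric])
          then show ?thesis by (simp only: times_divide_eq_left times_divide_eq_right mult_ac)
        qed
        finally show "ennreal (\<theta> x) * ennreal (\<theta> x) * emeasure Om {w. Y k w x \<ge> 1} \<le> ennreal (\<theta> x * ?u)" .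
      qed
      also have "\<dots> = ennreal (\<Sum>x\<in>level_set (Suc n). \<theta> x * ?u)" using th0 K \<delta> by (intro sum_ennreal mult_nonneg_nonneg) auto
      also have "(\<Sum>x\<in>level_set (Suc n). \<theta> x * ?u) = ?u" by (simp only: sum_distrib_right[symmetric] thsum[OF n] mult_1_left)
      finally show ?thesis .
    qed
    have Z2: "n \<le> N \<Longrightarrow> (\<integral>\<^sup>+w. flow_sum \<theta> h k n w ^ 2 \<partial>Om) \<le> ennreal (h k ^ 2 + C * (K / \<delta> * real k) * (\<Sum>i<n. real (Suc i) powr (- t)))" for n
    proof (induction n)
      case 0
      have "flow_sum \<theta> h k 0 w = ennreal (h k)" for w
      proof -
        have "flow_sum \<theta> h k 0 w = (\<Sum>x\<in>ch \<rho>. ennreal (\<theta> x) * ennreal (h k))"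
          unfolding flow_sum_def level_set_Suc[of 0] level_set_0 by (simp add: Y_root_child)
        also have "\<dots> = ennreal (\<Sum>x\<in>ch \<rho>. \<theta> x) * ennreal (h k)"
          using th0 by (simp only: sum_distrib_right[symmetric] sum_ennreal)
        finally show ?thesis using th1 by simp
      qed
      then show ?case using h0 Om.emeasure_space_1 by (simp add: ennreal_power)
    next
      case (Suc n)
      let ?T = "K / \<delta> * real k"
      have "(\<integral>\<^sup>+w. flow_sum \<theta> h k (Suc n) w ^ 2 \<partial>Om) \<le> (\<integral>\<^sup>+w. flow_sum \<theta> h k n w ^ 2 \<partial>Om)
         + ennreal C * (\<Sum>x\<in>level_set (Suc n). ennreal (\<theta> x) * ennreal (\<theta> x) * emeasure Om {w. Y k w x \<ge> 1})"
      proof (rule second_moment_growth[OF h0 hsup C hsq th0])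
        fix x assume "x \<in> level_set (Suc n)"
        from level_set_SucD[OF this] show "(\<Sum>y\<in>ch x. \<theta> y) = \<theta> x" using thf[of x] Suc.prems by simp
      qed
      also have "\<dots> \<le> ennreal (h k ^ 2 + C * ?T * (\<Sum>i<n. real (Suc i) powr (- t))) + ennreal C * ennreal (?T * real (Suc n) powr (- t))"
        using Suc.IH Suc.prems trm[of n] by (intro add_mono mult_left_mono) auto
      also have "\<dots> = ennreal (h k ^ 2 + C * ?T * (\<Sum>i<n. real (Suc i) powr (- t)) + C * (?T * real (Suc n) powr (- t)))"
      proof -
        have T: "?T \<ge> 0" using K \<delta> by simp
        have "h k ^ 2 + C * ?T * (\<Sum>i<n. real (Suc i) powr (- t)) \<ge> 0"
          by (intro add_nonneg_nonneg mult_nonneg_nonneg sum_nonneg C T) auto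
        moreover have "C * (?T * real (Suc n) powr (- t)) \<ge> 0" by (intro mult_nonneg_nonneg C T) auto
        moreover have "ennreal C * ennreal (?T * real (Suc n) powr (- t)) = ennreal (C * (?T * real (Suc n) powr (- t)))"
          using C by (rule ennreal_mult'[symmetric])
        ultimately show ?thesis by (simp only: ennreal_plus)
      qed
      also have "h k ^ 2 + C * ?T * (\<Sum>i<n. real (Suc i) powr (- t)) + C * (?T * real (Suc n) powr (- t))
         = h k ^ 2 + C * ?T * (\<Sum>i<Suc n. real (Suc i) powr (- t))"
        by (simp add: algebra_simps)
      finally show ?case .
    qed
    have ZN: "(\<integral>\<^sup>+w. flow_sum \<theta> h k N w ^ 2 \<partial>Om) \<le> ennreal (h k ^ 2 + C2 * real k)"
    proof -
      have "C * (K / \<delta> * real k) * (\<Sum>i<N. real (Suc i) powr (- t)) \<le> C * (K / \<delta> * real k) * S"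
        using partial[of N] C K \<delta> by (intro mult_left_mono) auto
      also have "\<dots> = C2 * real k" by (simp add: C2_def mult_ac)
      finally have "ennreal (h k ^ 2 + C * (K / \<delta> * real k) * (\<Sum>i<N. real (Suc i) powr (- t))) \<le> ennreal (h k ^ 2 + C2 * real k)"
        by (intro ennreal_leI) simp
      then show ?thesis using Z2[of N] by simp
    qed
    have lower: "ennreal (g k) \<le> (\<integral>\<^sup>+w. flow_sum \<theta> g k N w \<partial>Om)"
    proof -
      have ch: "ennreal (g k) \<le> (\<integral>\<^sup>+y. ennreal (g y) \<partial>chain k n)" for n
      proof (induction n)
        case (Suc n)
        have "(\<integral>\<^sup>+y. ennreal (g y) \<partial>chain k n) \<le> (\<integral>\<^sup>+y. ennreal (g y) \<partial>chain k (Suc n))"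
          by (simp add: nn_integral_mono[OF gsub])
        then show ?case using Suc by simp
      qed simp
      have m: "(\<lambda>w. ennreal (\<theta> x) * ennreal (g (Y k w x))) \<in> borel_measurable Om" for x
        using measurable_Y_fun[of "\<lambda>y. ennreal (\<theta> x) * ennreal (g y)"] .
      have "ennreal (g k) = ennreal (\<Sum>x\<in>level_set (Suc N). \<theta> x) * ennreal (g k)" using thsum[of N] by simp
      also have "\<dots> = (\<Sum>x\<in>level_set (Suc N). ennreal (\<theta> x) * ennreal (g k))"
        using th0 by (simp only: sum_distrib_right[symmetric] sum_ennreal)
      also have "\<dots> \<le> (\<Sum>x\<in>level_set (Suc N). ennreal (\<theta> x) * (\<integral>\<^sup>+w. ennreal (g (Y k w x)) \<partial>Om))"
      proof (intro sum_mono mult_left_mono)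
        fix x assume "x \<in> level_set (Suc N)"
        from level_set_SucD[OF this] show "ennreal (g k) \<le> (\<integral>\<^sup>+w. ennreal (g (Y k w x)) \<partial>Om)"
          using ch by (subst Y_law[where \<phi>="\<lambda>y. ennreal (g y)"]) auto
      qed simp
      also have "\<dots> = (\<Sum>x\<in>level_set (Suc N). (\<integral>\<^sup>+w. ennreal (\<theta> x) * ennreal (g (Y k w x)) \<partial>Om))"
        by (intro sum.cong refl nn_integral_cmult[symmetric] measurable_Y_fun[of "\<lambda>y. ennreal (g y)"])
      also have "\<dots> = (\<integral>\<^sup>+w. flow_sum \<theta> g k N w \<partial>Om)"
        unfolding flow_sum_def using m by (subst nn_integral_sum) auto
      finally show ?thesis .
    qed
    let ?I = "\<lambda>w. indicator (space Om - extinct k N) w :: ennreal"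
    have Im: "space Om - extinct k N \<in> sets Om" by (rule sets.compl_sets[OF extinct_sets])
    have g0: "g 0 = 0" by (simp add: g_def)
    \<comment> \<open>Because \<open>g 0 = 0\<close>, the sum is carried by the event of
      survival.\<close>
    have ZI: "flow_sum \<theta> g k N w = flow_sum \<theta> g k N w * ?I w" for w
    proof (cases "w \<in> extinct k N")
      case True
      then have "flow_sum \<theta> g k N w = 0" by (simp add: flow_sum_def extinct_def g0)
      then show ?thesis by simp
    qed simp
    have Zle: "flow_sum \<theta> g k N w \<le> flow_sum \<theta> h k N w" for w
      unfolding flow_sum_def by (intro sum_mono mult_left_mono ennreal_leI gh) auto
    have "ennreal (g k) ^ 2 \<le> (\<integral>\<^sup>+w. flow_sum \<theta> g k N w * ?I w \<partial>Om) ^ 2"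
      using lower ZI by (intro power_mono) auto
    also have "\<dots> \<le> (\<integral>\<^sup>+w. flow_sum \<theta> g k N w ^ 2 \<partial>Om) * (\<integral>\<^sup>+w. ?I w ^ 2 \<partial>Om)"
      using Im by (intro Cauchy_Schwarz_nn_integral measurable_flow_sum) auto
    also have "\<dots> \<le> ennreal (h k ^ 2 + C2 * real k) * ennreal (1 - Om.prob (extinct k N))"
    proof (rule mult_mono)
      have "(\<integral>\<^sup>+w. flow_sum \<theta> g k N w ^ 2 \<partial>Om) \<le> (\<integral>\<^sup>+w. flow_sum \<theta> h k N w ^ 2 \<partial>Om)"
        by (intro nn_integral_mono power_mono Zle) auto
      then show "(\<integral>\<^sup>+w. flow_sum \<theta> g k N w ^ 2 \<partial>Om) \<le> ennreal (h k ^ 2 + C2 * real k)" using ZN by simp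
      have "(\<integral>\<^sup>+w. ?I w ^ 2 \<partial>Om) = (\<integral>\<^sup>+w. ?I w \<partial>Om)" by (intro nn_integral_cong) (auto simp: indicator_def)
      also have "\<dots> = ennreal (1 - Om.prob (extinct k N))"
        using Im extinct_sets[of k N] by (simp add: Om.emeasure_eq_measure Om.prob_compl[symmetric])
      finally show "(\<integral>\<^sup>+w. ?I w ^ 2 \<partial>Om) \<le> ennreal (1 - Om.prob (extinct k N))" by simp
    qed auto
    finally have "ennreal (g k ^ 2) \<le> ennreal ((h k ^ 2 + C2 * real k) * (1 - Om.prob (extinct k N)))"
      using gk C2 Om.prob_le_1[of "extinct k N"] by (simp add: ennreal_power ennreal_mult)
    moreover have "(h k ^ 2 + C2 * real k) * (1 - Om.prob (extinct k N)) \<ge> 0"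
      using C2 Om.prob_le_1[of "extinct k N"] by (intro mult_nonneg_nonneg) auto
    ultimately show ?thesis by (subst (asm) ennreal_le_iff) auto
  qed
  show ?thesis
    by (rule that[OF a A B C2]) (use main in \<open>simp add: g_def h_def\<close>)
qed

text \<open>Divide the bound by \<open>real k ^ 2\<close>. Since \<open>lyap a A k / real k\<close>
  and \<open>C / real k\<close> tend to 0, the survival probability is bounded below by a quantity
  that tends to 1, uniformly in \<open>N\<close>.\<close>

lemma extinction_small:
  assumes \<gamma>: "\<gamma> > 1 / 2" and \<delta>: "\<delta> > 0"
    and inf: "ennreal \<delta> \<le> (INF \<pi>\<in>cutsets E \<rho>. \<Sum>\<^sub>\<infinity>e\<in>\<pi>. ennreal (real (edge_height V E \<rho> e) powr (- \<gamma>)))"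
    and \<eta>: "\<eta> > 0"
  shows "\<exists>k. \<forall>N. Om.prob (extinct k N) \<le> \<eta>"
proof -
  obtain a A B C where a: "0 < a" "a < 1" and A: "A \<ge> 0" and B: "B \<ge> 0" and C: "C \<ge> 0"
    and bd: "\<And>k N. k \<ge> 1 \<Longrightarrow> real k - B * lyap a A k \<ge> 0 \<Longrightarrow>
      (real k - B * lyap a A k) ^ 2 \<le> ((real k + B * lyap a A k) ^ 2 + C * real k) * (1 - Om.prob (extinct k N))"
    by (rule extinction_bound[OF \<gamma> \<delta> inf]) (rule that)
  define r where "r k = lyap a A k / real k" for k
  have r: "r \<longlonglongrightarrow> 0"
  proof -
    have "(\<lambda>k. real k powr (a - 1)) \<longlonglongrightarrow> 0"
      using a by (intro tendsto_neg_powr filterlim_real_sequentially) auto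
    moreover have "(\<lambda>k. A / real k) \<longlonglongrightarrow> 0" by (rule lim_const_over_n)
    ultimately have "(\<lambda>k. real k powr (a - 1) + A / real k) \<longlonglongrightarrow> 0 + 0" by (rule tendsto_add)
    moreover have "\<forall>\<^sub>F k in sequentially. real k powr (a - 1) + A / real k = r k"
      using eventually_ge_at_top[of 1]
      by eventually_elim (simp add: r_def lyap_def add_divide_distrib powr_diff)
    ultimately show ?thesis using tendsto_cong by force
  qed
  have "(\<lambda>k. (1 - B * r k) ^ 2 - (1 - \<eta>) * ((1 + B * r k) ^ 2 + C / real k)) \<longlonglongrightarrow> (1 - B * 0) ^ 2 - (1 - \<eta>) * ((1 + B * 0) ^ 2 + 0)"
    by (intro tendsto_intros r lim_const_over_n)
  then have e1: "\<forall>\<^sub>F k in sequentially. (1 - B * r k) ^ 2 - (1 - \<eta>) * ((1 + B * r k) ^ 2 + C / real k) > 0"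
    using \<eta> by (intro order_tendstoD) auto
  have "(\<lambda>k. 1 - B * r k) \<longlonglongrightarrow> 1 - B * 0" by (intro tendsto_intros r)
  then have e2: "\<forall>\<^sub>F k in sequentially. 1 - B * r k > 0" by (intro order_tendstoD) auto
  obtain k where k: "k \<ge> 1" "(1 - B * r k) ^ 2 - (1 - \<eta>) * ((1 + B * r k) ^ 2 + C / real k) > 0" "1 - B * r k > 0"
    using eventually_happens[OF eventually_conj[OF eventually_ge_at_top[of 1] eventually_conj[OF e1 e2]]] by auto
  have g: "real k - B * lyap a A k = real k * (1 - B * r k)" "real k + B * lyap a A k = real k * (1 + B * r k)"
    using k(1) by (simp_all add: r_def field_simps)
  have Ck: "C * real k = real k ^ 2 * (C / real k)" using k(1) by (simp add: power2_eq_square)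
  have "Om.prob (extinct k N) \<le> \<eta>" for N
  proof (rule ccontr)
    assume "\<not> ?thesis"
    then have lt: "1 - Om.prob (extinct k N) \<le> 1 - \<eta>" by simp
    have "real k * (1 - B * r k) \<ge> 0" using k(3) by simp
    then have "(real k * (1 - B * r k)) ^ 2 \<le> ((real k * (1 + B * r k)) ^ 2 + real k ^ 2 * (C / real k)) * (1 - Om.prob (extinct k N))"
      using bd[OF k(1), of N] unfolding g Ck by simp
    also have "\<dots> \<le> ((real k * (1 + B * r k)) ^ 2 + real k ^ 2 * (C / real k)) * (1 - \<eta>)"
      using lt C by (intro mult_left_mono add_nonneg_nonneg mult_nonneg_nonneg) auto
    also have "\<dots> = real k ^ 2 * ((1 - \<eta>) * ((1 + B * r k) ^ 2 + C / real k))"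
      unfolding power_mult_distrib distrib_left[symmetric] by (simp only: mult_ac)
    finally have "real k ^ 2 * (1 - B * r k) ^ 2 \<le> real k ^ 2 * ((1 - \<eta>) * ((1 + B * r k) ^ 2 + C / real k))"
      unfolding power_mult_distrib .
    then have "(1 - B * r k) ^ 2 \<le> (1 - \<eta>) * ((1 + B * r k) ^ 2 + C / real k)"
      using k(1) by (subst (asm) mult_le_cancel_left_pos) auto
    then show False using k(2) by simp
  qed
  then show ?thesis by blast
qed

end

lemma count_list_map_upt: "count_list (map f [0..<n]) v = card {k. k < n \<and> f k = v}"
proof (induction n)
  case (Suc n)
  have "{k. k < Suc n \<and> f k = v} = {k. k < n \<and> f k = v} \<union> (if f n = v then {n} else {})"
    by (auto simp: less_Suc_eq)
  then show ?case using Suc by auto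
qed simp

section \<open>The two alternatives for the given walk\<close>

context tsaw_walk
begin

lemma count_histM: "count_list (histM n \<omega>) v = card {k. k < Suc n \<and> X k \<omega> = v}"
  unfolding histM_def by (rule count_list_map_upt)

lemma infinite_visits_iff: "infinite {n. X n \<omega> = v} \<longleftrightarrow> (\<forall>m. \<exists>n. count_list (histM n \<omega>) v \<ge> m)"
proof
  assume inf: "infinite {n. X n \<omega> = v}"
  show "\<forall>m. \<exists>n. count_list (histM n \<omega>) v \<ge> m"
  proof
    fix m
    obtain t where "card {i. i < t \<and> X i \<omega> = v} \<ge> m" using infinite_count[OF inf] by blast
    moreover have "card {i. i < t \<and> X i \<omega> = v} \<le> card {i. i < Suc t \<and> X i \<omega> = v}" by (intro card_mono) auto
    ultimately have "count_list (histM t \<omega>) v \<ge> m" unfolding count_histM by simp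
    then show "\<exists>n. count_list (histM n \<omega>) v \<ge> m" by blast
  qed
next
  assume a: "\<forall>m. \<exists>n. count_list (histM n \<omega>) v \<ge> m"
  show "infinite {n. X n \<omega> = v}"
  proof
    assume fin: "finite {n. X n \<omega> = v}"
    obtain n where "count_list (histM n \<omega>) v \<ge> Suc (card {n. X n \<omega> = v})" using a by blast
    moreover have "card {k. k < Suc n \<and> X k \<omega> = v} \<le> card {n. X n \<omega> = v}" using fin by (intro card_mono) auto
    ultimately show False by (simp add: count_histM)
  qed
qed

lemma visits_transfer:
  "emeasure M {\<omega> \<in> space M. \<exists>n. count_list (histM n \<omega>) v \<ge> m} = emeasure Om {w. \<exists>n. count_list (hist w n) v \<ge> m}"
  by (rule transfer_eventually) simp

lemma visits_sets:
  "{\<omega> \<in> space M. \<exists>n. count_list (histM n \<omega>) v \<ge> m} \<in> sets M" "{w. \<exists>n. count_list (hist w n) v \<ge> m} \<in> sets Om"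
proof -
  show "{\<omega> \<in> space M. \<exists>n. count_list (histM n \<omega>) v \<ge> m} \<in> sets M"
    by (intro sets.sets_Collect_countable_Ex hist_pred_sets(1))
  have "{w \<in> space Om. \<exists>n. count_list (hist w n) v \<ge> m} \<in> sets Om"
    by (rule sets.sets_Collect_countable_Ex) (use hist_pred_sets(2)[of "\<lambda>p. count_list p v \<ge> m"] in simp)
  then show "{w. \<exists>n. count_list (hist w n) v \<ge> m} \<in> sets Om" by simp
qed

lemma unbdd_sets: "{w. unbdd w v} \<in> sets Om"
proof -
  have "{w \<in> space Om. \<forall>m. \<exists>n. count_list (hist w n) v \<ge> m} \<in> sets Om"
    by (rule sets.sets_Collect_countable_All) (use visits_sets(2)[of _ v] in simp)
  then show ?thesis by (simp add: unbdd_def)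
qed

text \<open>If the root is left at most \<open>M\<close> times, then for every cutset some
  \<open>Y M\<close> at the lower end of one of its edges is positive. By the survival bound this
  has probability at most a constant, depending on \<open>M\<close>, times the weight of the cutset,
  and that weight can be made arbitrarily small.\<close>

lemma AE_unbdd_root:
  assumes "branching_ruin V E \<rho> < 1 / 2"
  shows "AE w in Om. unbdd w \<rho>"
proof -
  obtain \<gamma> where \<gamma>: "0 < \<gamma>" "\<gamma> < 1 / 2" and small:
    "\<And>\<epsilon>. \<epsilon> > 0 \<Longrightarrow> \<exists>\<pi>\<in>cutsets E \<rho>. (\<Sum>\<^sub>\<infinity>e\<in>\<pi>. ennreal (real (edge_height V E \<rho> e) powr (- \<gamma>))) < \<epsilon>"
    using branching_ruin_less[OF assms] by blast
  \<comment> \<open>With \<open>a = 1 - 2 * \<gamma>\<close> the survival exponent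
    \<open>(1 - a) / 2\<close> is exactly the exponent \<open>\<gamma>\<close> of the cutset
    weights.\<close>
  have a: "0 < 1 - 2 * \<gamma>" "1 - 2 * \<gamma> < 1" using \<gamma> by auto
  have ex: "- (1 - (1 - 2 * \<gamma>)) / 2 = - \<gamma>" by simp
  obtain K where K: "K > 0" and surv: "\<And>k x. k \<ge> 1 \<Longrightarrow> x \<in> V \<Longrightarrow> x \<noteq> \<rho> \<Longrightarrow>
     emeasure Om {w. Y k w x \<ge> 1} \<le> ennreal (K * real k * real (lev x) powr (- (1 - (1 - 2 * \<gamma>)) / 2))"
    using Y_survival[OF a] by blast
  have null: "AE w in Om. \<not> (\<forall>n. length (exits (hist w n) \<rho>) \<le> M)" if M: "M \<ge> 1" for M
  proof -
    define L where "L = {w. \<forall>n. length (exits (hist w n) \<rho>) \<le> M}"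
    have Lm: "L \<in> sets Om"
    proof -
      have "{w \<in> space Om. \<forall>n. length (exits (hist w n) \<rho>) \<le> M} \<in> sets Om"
        by (rule sets.sets_Collect_countable_All) (use hist_pred_sets(2)[of "\<lambda>p. length (exits p \<rho>) \<le> M"] in simp)
      then show ?thesis by (simp add: L_def)
    qed
    have bound: "Om.prob L \<le> K * real M * \<epsilon>" if \<epsilon>: "\<epsilon> > 0" for \<epsilon>
    proof -
      obtain \<pi> where \<pi>: "\<pi> \<in> cutsets E \<rho>" and s: "(\<Sum>\<^sub>\<infinity>e\<in>\<pi>. ennreal (real (edge_height V E \<rho> e) powr (- \<gamma>))) < ennreal \<epsilon>"
        using small[of "ennreal \<epsilon>"] \<epsilon> by auto
      have sep: "separates_root E \<rho> \<pi>" using \<pi> by (simp add: cutsets_def)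
      define F where "F = {y \<in> V. y \<noteq> \<rho> \<and> {par y, y} \<in> \<pi>}"
      have F: "countable F" by (rule countable_subset[OF _ countable_V[OF lf]]) (auto simp: F_def)
      define c where "c y = ennreal (real (lev y) powr (- \<gamma>))" for y
      have "emeasure Om L \<le> emeasure Om (\<Union>y\<in>F. {w. Y M w y \<in> {1..}})"
      proof (rule emeasure_mono_AE)
        show "(\<Union>y\<in>F. {w. Y M w y \<in> {1..}}) \<in> sets Om" using F by (rule sets.countable_UN') (use Y_event in blast)
        show "AE w in Om. w \<in> L \<longrightarrow> w \<in> (\<Union>y\<in>F. {w. Y M w y \<in> {1..}})"
          using AE_good
        proof eventually_elim
          case (elim w)
          show ?case
          proof
            assume "w \<in> L"
            then have l: "\<And>n. length (exits (hist w n) \<rho>) \<le> M" by (simp add: L_def)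
            obtain y where "y \<in> V" "y \<noteq> \<rho>" "{par y, y} \<in> \<pi>" "Y M w y \<ge> 1"
              using transient_crosses[OF elim l sep] by blast
            then show "w \<in> (\<Union>y\<in>F. {w. Y M w y \<in> {1..}})" by (intro UN_I[of y]) (auto simp: F_def)
          qed
        qed
      qed
      also have "\<dots> \<le> ennreal (K * real M) * infsum c F"
      proof (rule emeasure_UN_le_infsum[OF F Y_event])
        fix y assume "y \<in> F"
        then have y: "y \<in> V" "y \<noteq> \<rho>" by (auto simp: F_def)
        have "emeasure Om {w. Y M w y \<in> {1..}} \<le> ennreal (K * real M * real (lev y) powr (- \<gamma>))"
          using surv[OF M y] unfolding ex by simp
        also have "\<dots> = ennreal (K * real M) * c y" using K by (simp add: c_def ennreal_mult)
        finally show "emeasure Om {w. Y M w y \<in> {1..}} \<le> ennreal (K * real M) * c y" .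
      qed
      also have "infsum c F = (\<Sum>\<^sub>\<infinity>e\<in>\<pi>. ennreal (real (edge_height V E \<rho> e) powr (- \<gamma>)))"
      proof -
        let ?h = "\<lambda>y. {par y, y}"
        have inj: "inj_on ?h F"
        proof (rule inj_onI)
          fix y z assume "y \<in> F" "z \<in> F" and e: "?h y = ?h z"
          then have "y \<in> V" "y \<noteq> \<rho>" "z \<in> V" "z \<noteq> \<rho>" unfolding F_def by blast+
          then show "y = z" using e by (rule edge_inj)
        qed
        have img: "?h ` F = \<pi>"
        proof
          show "?h ` F \<subseteq> \<pi>" by (auto simp: F_def)
          show "\<pi> \<subseteq> ?h ` F"
          proof
            fix e assume e: "e \<in> \<pi>"
            then have "e \<in> E" using sep unfolding separates_root_def by blast
            then obtain y where y: "y \<in> V" "y \<noteq> \<rho>" "e = {par y, y}" by (rule edge_parent_child)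
            then have "y \<in> F" using e unfolding F_def by simp
            then show "e \<in> ?h ` F" using y(3) by (rule rev_image_eqI)
          qed
        qed
        have "(\<Sum>\<^sub>\<infinity>e\<in>?h ` F. ennreal (real (edge_height V E \<rho> e) powr (- \<gamma>)))
          = infsum ((\<lambda>e. ennreal (real (edge_height V E \<rho> e) powr (- \<gamma>))) \<circ> ?h) F"
          by (rule infsum_reindex[OF inj])
        also have "\<dots> = infsum c F"
        proof (rule infsum_cong)
          fix y assume "y \<in> F"
          then have "y \<in> V" "y \<noteq> \<rho>" unfolding F_def by blast+
          then show "((\<lambda>e. ennreal (real (edge_height V E \<rho> e) powr (- \<gamma>))) \<circ> ?h) y = c y"
            by (simp add: c_def edge_height_eq)
        qed
        finally show ?thesis unfolding img by simp
      qed
      also have "ennreal (K * real M) * \<dots> \<le> ennreal (K * real M) * ennreal \<epsilon>"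
        using s by (intro mult_left_mono) auto
      also have "\<dots> = ennreal (K * real M * \<epsilon>)" using K \<epsilon> by (simp add: ennreal_mult)
      finally show ?thesis using K \<epsilon> unfolding Om.emeasure_eq_measure by (subst (asm) ennreal_le_iff) auto
    qed
    have "Om.prob L = 0"
    proof (rule ccontr)
      assume "Om.prob L \<noteq> 0"
      then have p: "Om.prob L > 0" by (simp add: zero_less_measure_iff)
      have KM: "K * real M > 0" using K M by simp
      have "Om.prob L \<le> K * real M * (Om.prob L / (2 * (K * real M)))"
        by (rule bound) (use p KM in simp)
      also have "\<dots> = Om.prob L / 2" using K M by simp
      finally show False using p by simp
    qed
    then have "AE w in Om. w \<notin> L" using Om.prob_eq_0[OF Lm] by simp
    then show ?thesis by (simp add: L_def)
  qed
  have "AE w in Om. \<forall>M. \<not> (\<forall>n. length (exits (hist w n) \<rho>) \<le> Suc M)"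
    by (subst AE_all_countable) (intro allI null, simp)
  then show ?thesis
  proof eventually_elim
    case (elim w)
    show ?case unfolding unbdd_exits
    proof
      fix m
      from spec[OF elim, of m] obtain n where "\<not> length (exits (hist w n) \<rho>) \<le> Suc m" by blast
      then have "length (exits (hist w n) \<rho>) \<ge> m" by simp
      then show "\<exists>n. length (exits (hist w n) \<rho>) \<ge> m" by blast
    qed
  qed
qed

lemma recurrent:
  assumes "branching_ruin V E \<rho> < 1 / 2"
  shows "as_recurrent M V X"
proof -
  have "AE \<omega> in M. \<forall>m. \<exists>n. count_list (histM n \<omega>) v \<ge> m" if v: "v \<in> V" for v
  proof (subst AE_all_countable, intro allI)
    fix m
    have "AE w in Om. w \<in> {w. \<exists>n. count_list (hist w n) v \<ge> m}"
      using AE_unbdd_root[OF assms] AE_good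
    proof eventually_elim
      case (elim w)
      have "unbdd w v" by (rule unbdd_all[OF elim(2,1) root_in_V v])
      then show ?case unfolding unbdd_def by blast
    qed
    then have "emeasure Om {w. \<exists>n. count_list (hist w n) v \<ge> m} = 1"
      by (rule Om.emeasure_eq_1_AE[OF visits_sets(2)])
    then have "emeasure M {\<omega> \<in> space M. \<exists>n. count_list (histM n \<omega>) v \<ge> m} = 1" by (simp only: visits_transfer)
    then have "prob {\<omega> \<in> space M. \<exists>n. count_list (histM n \<omega>) v \<ge> m} = 1" by (simp add: measure_def)
    then have "AE \<omega> in M. \<omega> \<in> {\<omega> \<in> space M. \<exists>n. count_list (histM n \<omega>) v \<ge> m}"
      by (rule AE_prob_1)
    then show "AE \<omega> in M. \<exists>n. count_list (histM n \<omega>) v \<ge> m" by eventually_elim simp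
  qed
  then have "AE \<omega> in M. \<forall>v\<in>V. \<forall>m. \<exists>n. count_list (histM n \<omega>) v \<ge> m"
    by (subst AE_ball_countable[OF countable_V[OF lf]]) blast
  then show ?thesis unfolding as_recurrent_def infinite_visits_iff .
qed

lemma transient:
  assumes "branching_ruin V E \<rho> > 1 / 2"
  shows "as_transient M V X"
proof -
  obtain \<gamma> \<delta> where \<gamma>: "\<gamma> > 1 / 2" and \<delta>: "\<delta> > 0"
    and inf: "ennreal \<delta> \<le> (INF \<pi>\<in>cutsets E \<rho>. \<Sum>\<^sub>\<infinity>e\<in>\<pi>. ennreal (real (edge_height V E \<rho> e) powr (- \<gamma>)))"
    using branching_ruin_greater[OF assms] by blast
  \<comment> \<open>Infinitely many visits to the root force extinction for every \<open>k\<close>,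
    so \<open>k\<close> may be chosen after \<open>\<eta>\<close>.\<close>
  have root: "Om.prob {w. unbdd w \<rho>} \<le> \<eta>" if \<eta>: "\<eta> > 0" for \<eta>
  proof -
    obtain k where k: "\<And>N. Om.prob (extinct k N) \<le> \<eta>" using extinction_small[OF \<gamma> \<delta> inf \<eta>] by blast
    have Un: "(\<Union>N. extinct k N) \<in> sets Om" using extinct_sets by blast
    have "Om.prob {w. unbdd w \<rho>} \<le> Om.prob (\<Union>N. extinct k N)"
    proof (rule Om.finite_measure_mono_AE[OF _ Un])
      show "AE w in Om. w \<in> {w. unbdd w \<rho>} \<longrightarrow> w \<in> (\<Union>N. extinct k N)"
        using AE_good
      proof eventually_elim
        case (elim w)
        show ?case
        proof
          assume "w \<in> {w. unbdd w \<rho>}"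
          then have "unbdd w \<rho>" by simp
          from unbdd_extinct[OF elim this, of k] show "w \<in> (\<Union>N. extinct k N)" by (auto simp: extinct_def)
        qed
      qed
    qed
    also have "\<dots> \<le> \<eta>"
    proof (rule LIMSEQ_le_const2)
      show "(\<lambda>N. Om.prob (extinct k N)) \<longlonglongrightarrow> Om.prob (\<Union>N. extinct k N)"
        using extinct_sets extinct_incseq by (intro Om.finite_Lim_measure_incseq) auto
      show "\<exists>N0. \<forall>N\<ge>N0. Om.prob (extinct k N) \<le> \<eta>" using k by blast
    qed
    finally show ?thesis .
  qed
  have "Om.prob {w. unbdd w \<rho>} = 0"
  proof (rule ccontr)
    assume "Om.prob {w. unbdd w \<rho>} \<noteq> 0"
    then have p: "Om.prob {w. unbdd w \<rho>} > 0" by (simp add: zero_less_measure_iff)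
    then have "Om.prob {w. unbdd w \<rho>} \<le> Om.prob {w. unbdd w \<rho>} / 2" by (intro root) simp
    then show False using p by simp
  qed
  then have nr: "AE w in Om. w \<notin> {w. unbdd w \<rho>}" using Om.prob_eq_0[OF unbdd_sets] by simp
  have "AE \<omega> in M. \<not> (\<forall>m. \<exists>n. count_list (histM n \<omega>) v \<ge> m)" if v: "v \<in> V" for v
  proof -
    let ?A = "\<lambda>m. {w. \<exists>n. count_list (hist w n) v \<ge> m}"
    let ?B = "\<lambda>m. {\<omega> \<in> space M. \<exists>n. count_list (histM n \<omega>) v \<ge> m}"
    have mono: "decseq ?A" by (intro decseq_SucI) (auto intro: Suc_leD)
    have I: "(\<Inter>m. ?A m) = {w. unbdd w v}" by (auto simp: unbdd_def)
    have "AE w in Om. w \<notin> {w. unbdd w v}"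
      using nr AE_good
    proof eventually_elim
      case (elim w)
      then show ?case using unbdd_all[OF elim(2) _ v root_in_V] by blast
    qed
    then have z: "Om.prob {w. unbdd w v} = 0" using Om.prob_eq_0[OF unbdd_sets] by simp
    \<comment> \<open>Only the events of at least \<open>m\<close> visits can be transferred
      directly; infinitely many visits are their decreasing intersection.\<close>
    have "(\<lambda>m. Om.prob (?A m)) \<longlonglongrightarrow> Om.prob (\<Inter>m. ?A m)"
      using visits_sets(2) mono by (intro Om.finite_Lim_measure_decseq) auto
    then have lim: "(\<lambda>m. Om.prob (?A m)) \<longlonglongrightarrow> 0" unfolding I z .
    have eq: "prob (?B m) = Om.prob (?A m)" for m by (simp only: measure_def visits_transfer)
    have Bs: "(\<Inter>m. ?B m) \<in> sets M" using visits_sets(1) by blast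
    have "prob (\<Inter>m. ?B m) \<le> 0"
    proof (rule LIMSEQ_le_const[OF lim], intro exI allI impI)
      fix m
      show "prob (\<Inter>m. ?B m) \<le> Om.prob (?A m)"
        unfolding eq[symmetric] by (rule finite_measure_mono[OF _ visits_sets(1)]) blast
    qed
    then have "prob (\<Inter>m. ?B m) = 0" by (simp add: measure_le_0_iff)
    then have "AE \<omega> in M. \<omega> \<notin> (\<Inter>m. ?B m)" using prob_eq_0[OF Bs] by simp
    with AE_space show ?thesis by eventually_elim blast
  qed
  then have "AE \<omega> in M. \<forall>v\<in>V. \<not> (\<forall>m. \<exists>n. count_list (histM n \<omega>) v \<ge> m)"
    by (subst AE_ball_countable[OF countable_V[OF lf]]) blast
  then show ?thesis unfolding as_transient_def infinite_visits_iff[symmetric] not_not .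
qed

end

theorem theorem1p1:
  fixes M :: "'w measure" and V :: "'a set" and E :: "'a set set" and \<rho> :: 'a
    and \<beta> :: real and X :: "nat \<Rightarrow> 'w \<Rightarrow> 'a"
  assumes "\<beta> > 0"
    and "rooted_tree V E \<rho>"
    and "infinite V"
    and "locally_finite V E"
    and "tsaw M V E \<rho> \<beta> X"
  shows "(branching_ruin V E \<rho> < 1 / 2 \<longrightarrow> as_recurrent M V X) \<and>
         (branching_ruin V E \<rho> > 1 / 2 \<longrightarrow> as_transient M V X)"
proof -
  have w: "tsaw_walk M V E \<rho> \<beta> X"
    unfolding tsaw_walk_def walk_tree_def repulsion_def walk_tree_axioms_def using assms by blast
  show ?thesis using tsaw_walk.recurrent[OF w] tsaw_walk.transient[OF w] by simp
qed

end
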